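(* Let $d\ge 1$ be an integer. There exists a constant $C>0$ (depending only on $d$) such that for every $t\ge 0$ and every $0<\varepsilon<1$ there exist a positive integer $n\le \lceil C t^2/\varepsilon\rceil$ (that is, $n=O(t^2/\varepsilon)$) and a quantum channel $\Lambda$, mapping operators on $\mathcal{H}_S\otimes(\mathcal{H}_H\otimes\mathcal{H}_P\otimes\mathcal{H}_Q)^{\otimes n}$ to operators on $\mathcal{H}_S$, where $\mathcal{H}_S,\mathcal{H}_H,\mathcal{H}_P,\mathcal{H}_Q$ are copies of $\mathbb{C}^d$, such that $\Lambda$ does not depend on $L$ or on the Hamiltonian $\sigma$ and the following holds. For every density operator $\sigma$ on $\mathbb{C}^d$ and every linear operator $L$ on $\mathbb{C}^d$ with $\|L\|_2=1$, let $|\psi\rangle=(L\otimes I)|\Gamma\rangle\in\mathcal{H}_P\otimes\mathcal{H}_Q$, let $\psi=|\psi\rangle\langle\psi|$, let $\omega=\sigma\otimes\psi$ be the program state on $\mathcal{H}_H\otimes\mathcal{H}_P\otimes\mathcal{H}_Q$ (encoding the Hamiltonian $H=\sigma$ and the Lindblad operator $L$), and let $$\mathcal{L}(\rho)=-i[\sigma,\rho]+L\rho L^\dagger-\frac12\{L^\dagger L,\rho\}.$$ Then the channel $\mathcal{A}$ on $\mathcal{H}_S$ defined by $\mathcal{A}(\rho)=\Lambda(\rho\otimes\omega^{\otimes n})$ satisfies $$\frac12\left\| e^{\mathcal{L}t}-\mathcal{A}\right\|_{\diamond}\le\varepsilon .$$ In other words, a quantum algorithm that is given $n=O(t^2/\varepsilon)$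 copies of the program state $\omega$ can approximate the channel $e^{\mathcal{L}t}$ up to error $\varepsilon$ in normalized diamond distance.
   Context: All Hilbert spaces are finite-dimensional. $|\Gamma\rangle=\sum_{j=1}^d|j\rangle\otimes|j\rangle$ is the unnormalized maximally entangled vector in $\mathbb{C}^d\otimes\mathbb{C}^d$, with respect to the standard orthonormal basis. $\|A\|_2=\sqrt{\operatorname{Tr}[A^\dagger A]}$ is the Hilbert--Schmidt norm, $\|A\|_1=\operatorname{Tr}[(A^\dagger A)^{1/2}]$ is the trace norm, $[A,B]=AB-BA$, and $\{A,B\}=AB+BA$. A quantum channel is a completely positive trace-preserving linear map. For a linear superoperator $\mathcal{L}$, $e^{\mathcal{L}t}=\sum_{k\ge0}\mathcal{L}^k t^k/k!$, where $\mathcal{L}^k$ is the $k$-fold composition. For channels $\mathcal{N},\mathcal{M}$ on $\mathcal{H}_S$, the diamond distance is $\|\mathcal{N}-\mathcal{M}\|_\diamond=\sup_{\rho}\|(\mathcal{I}_R\otimes\mathcal{N})(\rho)-(\mathcal{I}_R\otimes\mathcal{M})(\rho)\|_1$, where the supremum is over all finite-dimensional reference systems $R$ and all density operators $\rho$ on $\mathcal{H}_R\otimes\mathcal{H}_S$, and $\mathcal{I}_R$ is the identity channel. A quantum algorithm with access to $n$ copies of an unknown program state $\omega$ means a fixed quantum channel (independent of $\omega$) applied to the input state together with $\omega^{\otimes n}$.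
   Formalization: At t = 0 the bound n ≤ ⌈C t²/ε⌉ = 0 excludes a positive integer n, so positivity of n is required only for t > 0; at t = 0 the bound and the approximation are kept, with n = 0 copies allowed. *)

theory Defs
  imports
    "HOL-Library.Extended_Real"
    "Jordan_Normal_Form.Schur_Decomposition"
begin

text \<open>
  Operators on a Hilbert space of dimension \<open>n\<close> are the elements of
  \<^term>\<open>carrier_mat n n :: complex mat set\<close>. The basis vector
  \<open>|i\<rangle> \<otimes> |j\<rangle>\<close> of a tensor product whose second factor has dimension \<open>n\<close>
  has index \<open>i * n + j\<close>.
\<close>

definition kron_vec :: "complex vec \<Rightarrow> complex vec \<Rightarrow> complex vec" where
  "kron_vec u v = vec (dim_vec u * dim_vec v)
     (\<lambda>i. u $ (i div dim_vec v) * v $ (i mod dim_vec v))"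

definition kron :: "complex mat \<Rightarrow> complex mat \<Rightarrow> complex mat" where
  "kron A B = mat (dim_row A * dim_row B) (dim_col A * dim_col B)
     (\<lambda>(i, j). A $$ (i div dim_row B, j div dim_col B) * B $$ (i mod dim_row B, j mod dim_col B))"

fun tensor_power :: "complex mat \<Rightarrow> nat \<Rightarrow> complex mat" where
  "tensor_power A 0 = 1\<^sub>m 1"
| "tensor_power A (Suc n) = kron A (tensor_power A n)"

definition trace :: "complex mat \<Rightarrow> complex" where
  "trace A = (\<Sum>i<dim_row A. A $$ (i, i))"

text \<open>
  The order on \<^typ>\<open>complex\<close> is the one of \<open>HOL-Library.Complex_Order\<close>, so
  \<open>0 \<le> z\<close> says that \<open>z\<close> is real and nonnegative. As the scalars are complex, this
  forces \<open>A\<close> to be Hermitian.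
\<close>

definition psd :: "nat \<Rightarrow> complex mat \<Rightarrow> bool" where
  "psd n A \<longleftrightarrow> A \<in> carrier_mat n n \<and> (\<forall>v \<in> carrier_vec n. 0 \<le> (A *\<^sub>v v) \<bullet>c v)"

definition density_operator :: "nat \<Rightarrow> complex mat \<Rightarrow> bool" where
  "density_operator n \<rho> \<longleftrightarrow> psd n \<rho> \<and> trace \<rho> = 1"

text \<open>Every positive semidefinite operator has exactly one positive semidefinite square root.\<close>

definition psd_sqrt :: "complex mat \<Rightarrow> complex mat" where
  "psd_sqrt A = (THE B. psd (dim_row A) B \<and> B * B = A)"

definition trace_norm :: "complex mat \<Rightarrow> real" where
  "trace_norm A = Re (trace (psd_sqrt (mat_adjoint A * A)))"

definition hs_norm :: "complex mat \<Rightarrow> real" where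
  "hs_norm A = sqrt (Re (trace (mat_adjoint A * A)))"

definition commutator :: "complex mat \<Rightarrow> complex mat \<Rightarrow> complex mat" where
  "commutator A B = A * B - B * A"

definition anticommutator :: "complex mat \<Rightarrow> complex mat \<Rightarrow> complex mat" where
  "anticommutator A B = A * B + B * A"

definition linear_superop :: "nat \<Rightarrow> nat \<Rightarrow> (complex mat \<Rightarrow> complex mat) \<Rightarrow> bool" where
  "linear_superop m n \<Phi> \<longleftrightarrow>
     (\<forall>A \<in> carrier_mat m m. \<Phi> A \<in> carrier_mat n n) \<and>
     (\<forall>A \<in> carrier_mat m m. \<forall>B \<in> carrier_mat m m. \<Phi> (A + B) = \<Phi> A + \<Phi> B) \<and>
     (\<forall>c. \<forall>A \<in> carrier_mat m m. \<Phi> (c \<cdot>\<^sub>m A) = c \<cdot>\<^sub>m \<Phi> A)"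

text \<open>
  \<open>id_tensor r m n \<Phi>\<close> is \<open>\<I>\<^sub>R \<otimes> \<Phi>\<close> for a reference system \<open>R\<close> of dimension \<open>r\<close> and a
  superoperator \<open>\<Phi>\<close> from dimension \<open>m\<close> to dimension \<open>n\<close>: it applies \<open>\<Phi>\<close> to each of the
  \<open>r \<times> r\<close> blocks of its argument.
\<close>

definition sub_block :: "nat \<Rightarrow> complex mat \<Rightarrow> nat \<Rightarrow> nat \<Rightarrow> complex mat" where
  "sub_block m X a b = mat m m (\<lambda>(k, l). X $$ (a * m + k, b * m + l))"

definition id_tensor ::
  "nat \<Rightarrow> nat \<Rightarrow> nat \<Rightarrow> (complex mat \<Rightarrow> complex mat) \<Rightarrow> complex mat \<Rightarrow> complex mat" where
  "id_tensor r m n \<Phi> X = mat (r * n) (r * n)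
     (\<lambda>(i, j). \<Phi> (sub_block m X (i div n) (j div n)) $$ (i mod n, j mod n))"

lemma id_tensor_kron:
  assumes "linear_superop m n \<Phi>" "A \<in> carrier_mat r r" "B \<in> carrier_mat m m"
  shows "id_tensor r m n \<Phi> (kron A B) = kron A (\<Phi> B)"
proof -
  have \<Phi>B: "\<Phi> B \<in> carrier_mat n n" using assms by (auto simp: linear_superop_def)
  have lt: "a * m + k < r * m" if "a < r" "k < m" for a k :: nat
  proof -
    have "a * m + k < Suc a * m" using that by simp
    also have "\<dots> \<le> r * m" using that by (intro mult_le_mono1) simp
    finally show ?thesis .
  qed
  have blk: "sub_block m (kron A B) a b = A $$ (a, b) \<cdot>\<^sub>m B" if "a < r" "b < r" for a b
    using assms that lt by (intro eq_matI) (auto simp: sub_block_def kron_def)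
  show ?thesis
  proof (rule eq_matI)
    fix i j assume "i < dim_row (kron A (\<Phi> B))" "j < dim_col (kron A (\<Phi> B))"
    hence ij: "i < r * n" "j < r * n" using assms \<Phi>B by (auto simp: kron_def)
    hence n: "n > 0" by (cases n) auto
    have q: "i div n < r" "j div n < r" using ij n by (auto simp: div_less_iff_less_mult)
    have "\<Phi> (sub_block m (kron A B) (i div n) (j div n)) = A $$ (i div n, j div n) \<cdot>\<^sub>m \<Phi> B"
      using assms by (simp add: blk[OF q] linear_superop_def)
    hence "id_tensor r m n \<Phi> (kron A B) $$ (i, j) = (A $$ (i div n, j div n) \<cdot>\<^sub>m \<Phi> B) $$ (i mod n, j mod n)"
      using ij by (simp add: id_tensor_def)
    thus "id_tensor r m n \<Phi> (kron A B) $$ (i, j) = kron A (\<Phi> B) $$ (i, j)"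
      using ij n \<Phi>B assms by (simp add: kron_def)
  qed (use assms \<Phi>B in \<open>auto simp: id_tensor_def kron_def\<close>)
qed

definition completely_positive :: "nat \<Rightarrow> nat \<Rightarrow> (complex mat \<Rightarrow> complex mat) \<Rightarrow> bool" where
  "completely_positive m n \<Phi> \<longleftrightarrow> (\<forall>r X. psd (r * m) X \<longrightarrow> psd (r * n) (id_tensor r m n \<Phi> X))"

definition quantum_channel :: "nat \<Rightarrow> nat \<Rightarrow> (complex mat \<Rightarrow> complex mat) \<Rightarrow> bool" where
  "quantum_channel m n \<Phi> \<longleftrightarrow> linear_superop m n \<Phi> \<and> completely_positive m n \<Phi> \<and>
     (\<forall>A \<in> carrier_mat m m. trace (\<Phi> A) = trace A)"

text \<open>The supremum is taken in \<^typ>\<open>ereal\<close>, so that it needs no boundedness assumption.\<close>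

definition diamond_dist ::
  "nat \<Rightarrow> (complex mat \<Rightarrow> complex mat) \<Rightarrow> (complex mat \<Rightarrow> complex mat) \<Rightarrow> ereal" where
  "diamond_dist d N M = (SUP (r, \<rho>) \<in> {(r, \<rho>). density_operator (r * d) \<rho>}.
     ereal (trace_norm (id_tensor r d d N \<rho> - id_tensor r d d M \<rho>)))"

text \<open>The exponential series, summed entrywise.\<close>

definition exp_superop ::
  "nat \<Rightarrow> (complex mat \<Rightarrow> complex mat) \<Rightarrow> real \<Rightarrow> complex mat \<Rightarrow> complex mat" where
  "exp_superop d G t \<rho> =
     mat d d (\<lambda>(i, j). \<Sum>k. (G ^^ k) \<rho> $$ (i, j) * of_real (t ^ k / fact k))"

definition lindbladian :: "complex mat \<Rightarrow> complex mat \<Rightarrow> complex mat \<Rightarrow> complex mat" where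
  "lindbladian H L \<rho> =
     (- \<i>) \<cdot>\<^sub>m commutator H \<rho> + L * \<rho> * mat_adjoint L
     - (1 / 2) \<cdot>\<^sub>m anticommutator (mat_adjoint L * L) \<rho>"

definition max_entangled :: "nat \<Rightarrow> complex vec" where
  "max_entangled d = vec (d * d) (\<lambda>i. \<Sum>j<d. kron_vec (unit_vec d j) (unit_vec d j) $ i)"

definition ket_bra :: "complex vec \<Rightarrow> complex mat" where
  "ket_bra v = mat (dim_vec v) (dim_vec v) (\<lambda>(i, j). v $ i * cnj (v $ j))"

definition program_vec :: "nat \<Rightarrow> complex mat \<Rightarrow> complex vec" where
  "program_vec d L = kron L (1\<^sub>m d) *\<^sub>v max_entangled d"

definition program_state :: "nat \<Rightarrow> complex mat \<Rightarrow> complex mat \<Rightarrow> complex mat" where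
  "program_state d \<sigma> L = kron \<sigma> (ket_bra (program_vec d L))"

end

theory Submission
  imports Defs "HOL-Computational_Algebra.Fundamental_Theorem_Algebra"
begin

text \<open>
  One program copy is consumed per time step \<open>s = t / n\<close> by a channel whose effect on \<open>\<rho>\<close> is
  \<open>\<rho> + s \<L>(\<rho>) + O(s\<^sup>2)\<close>. It mixes with equal weights a partial swap of \<open>S\<close> with \<open>H\<close>, which
  yields \<open>-i[\<sigma>, \<rho>]\<close>, and a weak teleportation: as \<open>(I\<^sub>P \<otimes> \<langle>\<Gamma>|\<^sub>S\<^sub>Q) (|\<phi>\<rangle> \<otimes> |\<psi>\<rangle>) = L |\<phi>\<rangle>\<close>,
  projecting \<open>SQ\<close> on the maximally entangled vector applies \<open>L\<close>. The remainder is controlled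
  uniformly in the reference system, since any Hermiticity preserving \<open>\<Psi>\<close> satisfies
  \<open>\<plusminus>(\<I> \<otimes> \<Psi>)(X) \<le> c (Tr\<^sub>S X \<otimes> I)\<close> for positive \<open>X\<close>. Channels contract the trace norm, so the \<open>n\<close>
  errors of order \<open>s\<^sup>2\<close> add up to \<open>O(t\<^sup>2 / n)\<close>.
\<close>

text \<open>Both branches run at doubled rate, because mixing them with equal weights halves each
  generator. They are built so that their Kraus families are complete exactly and not only to first
  order: \<open>I - 2is SWAP\<close> needs only a scalar normalisation, since SWAP squares to the
  identity, and the jump weight \<open>2 * s - d * s\<^sup>2\<close> compensates the quadratic term
  of the no-jump operator. This weight must be nonnegative; steps are therefore kept below
  \<open>1 / d\<close>, which costs a summand \<open>d\<^sup>2\<close> in the final constant.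

  The trace norm is given by a definite description of a square root and is awkward to estimate. All
  estimates bound the total trace of a decomposition into positive parts, and reach the trace norm
  only through \<open>trace_norm_limit\<close>.

  The exponential is never shown to be a channel. Only the steps are known to be contractions, so a
  coarse step is compared with many fine ones, and the exponential enters as the limit of the
  latter.\<close>

declare index_mult_mat(1) [simp del]

section \<open>The spectral theorem\<close>

text \<open>Dimension equations replace carrier premises with free dimensions, so simp can
  reassociate products with this rule.\<close>

lemma mult_assoc_dim:
  assumes "dim_col A = dim_row B" "dim_col B = dim_row C"
  shows "A * B * C = A * (B * (C :: 'a :: semiring_0 mat))"
  using assms by (intro assoc_mult_mat[of A "dim_row A" "dim_row B" B "dim_row C" C "dim_col C"]) auto

lemma mat_adjoint_dim [simp]:
  "dim_row (mat_adjoint A) = dim_col A" "dim_col (mat_adjoint A) = dim_row A"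
  by (auto simp: mat_adjoint_def)

lemma mat_adjoint_carrier [simp, intro]:
  "A \<in> carrier_mat n m \<Longrightarrow> mat_adjoint A \<in> carrier_mat m n"
  by (auto intro!: carrier_matI)

lemma mat_adjoint_index [simp]:
  fixes A :: "complex mat"
  assumes "i < dim_col A" "j < dim_row A"
  shows "mat_adjoint A $$ (i, j) = cnj (A $$ (j, i))"
  using assms by (simp add: mat_adjoint_def mat_of_rows_index)

lemma mat_adjoint_adjoint [simp]:
  fixes A :: "complex mat"
  shows "mat_adjoint (mat_adjoint A) = A"
  by (intro eq_matI) auto

text \<open>Products stay folded under simp and are expanded through this explicit sum only where
  entries are wanted.\<close>

lemma mult_index:
  assumes "A \<in> carrier_mat n m" "B \<in> carrier_mat m p" "i < n" "j < p"
  shows "(A * B) $$ (i, j) = (\<Sum>k<m. A $$ (i, k) * B $$ (k, j))"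
  using assms by (auto simp: index_mult_mat(1) scalar_prod_def atLeast0LessThan intro!: sum.cong)

lemma mat_adjoint_mult:
  fixes A :: "complex mat"
  assumes "A \<in> carrier_mat n m" "B \<in> carrier_mat m p"
  shows "mat_adjoint (A * B) = mat_adjoint B * mat_adjoint A"
  using assms
  by (intro eq_matI)
     (auto simp: index_mult_mat(1) scalar_prod_def mult.commute intro!: sum.cong)

section \<open>Hermitian and unitary matrices\<close>

definition hermitian :: "nat \<Rightarrow> complex mat \<Rightarrow> bool" where
  "hermitian n A \<longleftrightarrow> A \<in> carrier_mat n n \<and> (\<forall>i<n. \<forall>j<n. cnj (A $$ (i, j)) = A $$ (j, i))"

lemma hermitianD:
  assumes "hermitian n A"
  shows "A \<in> carrier_mat n n" "i < n \<Longrightarrow> j < n \<Longrightarrow> cnj (A $$ (i, j)) = A $$ (j, i)"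
  using assms by (auto simp: hermitian_def)

lemma hermitian_adjoint: "hermitian n A \<Longrightarrow> mat_adjoint A = A"
  by (intro eq_matI) (auto simp: hermitian_def)

lemma hermitian_diff: "hermitian n A \<Longrightarrow> hermitian n B \<Longrightarrow> hermitian n (A - B)"
  by (auto simp: hermitian_def)

definition unitary :: "nat \<Rightarrow> complex mat \<Rightarrow> bool" where
  "unitary n U \<longleftrightarrow> U \<in> carrier_mat n n \<and> mat_adjoint U * U = 1\<^sub>m n"

lemma unitaryD:
  assumes "unitary n U"
  shows "U \<in> carrier_mat n n" "mat_adjoint U * U = 1\<^sub>m n" "U * mat_adjoint U = 1\<^sub>m n"
  using assms mat_mult_left_right_inverse[of "mat_adjoint U" n U] by (auto simp: unitary_def)

lemma unitary_mult:
  assumes "unitary n U" "unitary n V"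
  shows "unitary n (U * V)"
proof -
  note c = unitaryD(1)[OF assms(1)] unitaryD(1)[OF assms(2)]
  have "mat_adjoint (U * V) * (U * V) = mat_adjoint V * (mat_adjoint U * U) * V"
    using c by (simp add: mat_adjoint_mult[OF c] mult_assoc_dim)
  also have "\<dots> = 1\<^sub>m n"
    using unitaryD[OF assms(1)] unitaryD[OF assms(2)] by simp
  finally show ?thesis using c by (auto simp: unitary_def)
qed

lemma of_real_sqrt_square:
  "0 \<le> y \<Longrightarrow> complex_of_real (sqrt y) * complex_of_real (sqrt y) = complex_of_real y"
  by (metis of_real_mult real_sqrt_mult_self abs_of_nonneg)

text \<open>The deflating unitary of the spectral theorem. Gram-Schmidt keeps the first vector of a
  completed basis but does not normalise, so the columns are divided by their lengths and column 0
  is only a multiple of \<open>v\<close>.\<close>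

lemma unitary_completion:
  assumes "v \<in> carrier_vec n" "v \<noteq> 0\<^sub>v n"
  shows "\<exists>W c. unitary n W \<and> c \<noteq> 0 \<and> col W 0 = c \<cdot>\<^sub>v v"
proof -
  interpret cof_vec_space n "TYPE(complex)" .
  define ws where "ws = gram_schmidt n (basis_completion v)"
  note bc = basis_completion[OF assms]
  note gs = gram_schmidt_result[OF bc(2) bc(4) bc(5) ws_def]
  have len: "length ws = n" using gs bc by simp
  have n: "0 < n" using assms by (cases n) auto
  have hd: "ws ! 0 = v"
  proof -
    have "basis_completion v = v # tl (basis_completion v)"
      using bc(6,7) n by (cases "basis_completion v") auto
    hence "hd ws = v"
      unfolding ws_def using gram_schmidt_hd[OF assms(1)] by metis
    thus ?thesis using len n by (cases ws) auto
  qed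
  have car: "ws ! i \<in> carrier_vec n" if "i < n" for i using gs(3) len that by force
  have orth: "(ws ! j \<bullet>c ws ! i = 0) = (j \<noteq> i)" if "i < n" "j < n" for i j
    using corthogonalD[OF gs(2), of j i] len that by simp
  define r where "r j = complex_of_real (sqrt (Re (ws ! j \<bullet>c ws ! j)))" for j
  have rr: "r j * cnj (r j) = ws ! j \<bullet>c ws ! j" "r j \<noteq> 0" if "j < n" for j
  proof -
    have "0 \<le> ws ! j \<bullet>c ws ! j" by (rule conjugate_square_ge_0_vec)
    moreover have "ws ! j \<bullet>c ws ! j \<noteq> 0" using orth[OF that that] by simp
    ultimately have "Re (ws ! j \<bullet>c ws ! j) > 0"
      "ws ! j \<bullet>c ws ! j = complex_of_real (Re (ws ! j \<bullet>c ws ! j))"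
      by (auto simp: less_eq_complex_def complex_eq_iff)
    then obtain x where x: "x > 0" "ws ! j \<bullet>c ws ! j = complex_of_real x" by blast
    have "complex_of_real (sqrt x) * complex_of_real (sqrt x) = complex_of_real x"
      using x(1) by (intro of_real_sqrt_square) simp
    thus "r j * cnj (r j) = ws ! j \<bullet>c ws ! j" "r j \<noteq> 0"
      using x by (simp_all add: r_def)
  qed
  define W where "W = mat n n (\<lambda>(i, j). (ws ! j) $ i / r j)"
  have sp: "(\<Sum>k<n. cnj (ws ! i $ k) * ws ! j $ k) = ws ! j \<bullet>c ws ! i" if "i < n" "j < n" for i j
    using car[OF that(1)] car[OF that(2)]
    by (auto simp: scalar_prod_def atLeast0LessThan mult.commute intro!: sum.cong)
  have "mat_adjoint W * W = 1\<^sub>m n"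
  proof (rule eq_matI)
    fix i j assume "i < dim_row (1\<^sub>m n)" "j < dim_col (1\<^sub>m n)"
    hence ij: "i < n" "j < n" by auto
    have "(mat_adjoint W * W) $$ (i, j) = (\<Sum>k<n. cnj (ws ! i $ k) * ws ! j $ k / (cnj (r i) * r j))"
      using ij by (subst mult_index[of _ n n _ n]) (auto simp: W_def intro!: sum.cong)
    also have "\<dots> = ws ! j \<bullet>c ws ! i / (cnj (r i) * r j)"
      by (simp add: sp[OF ij] flip: sum_divide_distrib)
    also have "\<dots> = 1\<^sub>m n $$ (i, j)"
      using ij rr[OF ij(1)] orth[OF ij] by (auto simp: mult.commute)
    finally show "(mat_adjoint W * W) $$ (i, j) = 1\<^sub>m n $$ (i, j)" .
  qed (auto simp: W_def)
  moreover have "col W 0 = (1 / r 0) \<cdot>\<^sub>v v"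
    using n assms hd by (intro eq_vecI) (auto simp: W_def)
  ultimately show ?thesis
    using rr(2)[OF n] by (intro exI[of _ W] exI[of _ "1 / r 0"]) (auto simp: unitary_def W_def)
qed

lemma conj_index:
  fixes A :: "complex mat"
  assumes "A \<in> carrier_mat n n" "U \<in> carrier_mat n m" "i < m" "j < m"
  shows "(mat_adjoint U * A * U) $$ (i, j) =
    (\<Sum>k<n. \<Sum>l<n. cnj (U $$ (k, i)) * A $$ (k, l) * U $$ (l, j))"
proof -
  have "(mat_adjoint U * A) $$ (i, l) = (\<Sum>k<n. cnj (U $$ (k, i)) * A $$ (k, l))" if "l < n" for l
    using assms that by (subst mult_index[of _ m n _ n]) auto
  hence "(mat_adjoint U * A * U) $$ (i, j) =
      (\<Sum>l<n. (\<Sum>k<n. cnj (U $$ (k, i)) * A $$ (k, l)) * U $$ (l, j))"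
    using assms by (subst mult_index[of _ m n _ m]) auto
  also have "\<dots> = (\<Sum>k<n. \<Sum>l<n. cnj (U $$ (k, i)) * A $$ (k, l) * U $$ (l, j))"
    by (simp add: sum_distrib_right) (rule sum.swap)
  finally show ?thesis .
qed

lemma hermitian_conj:
  assumes "hermitian n A" "U \<in> carrier_mat n m"
  shows "hermitian m (mat_adjoint U * A * U)"
proof -
  note A = hermitianD(1)[OF assms(1)]
  have "cnj ((mat_adjoint U * A * U) $$ (i, j)) = (mat_adjoint U * A * U) $$ (j, i)"
    if "i < m" "j < m" for i j
  proof -
    have "cnj ((mat_adjoint U * A * U) $$ (i, j)) =
       (\<Sum>k<n. \<Sum>l<n. cnj (U $$ (l, j)) * A $$ (l, k) * U $$ (k, i))"
      unfolding conj_index[OF A assms(2) that] cnj_sum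
      by (intro sum.cong) (auto simp: hermitianD(2)[OF assms(1)])
    also have "\<dots> = (mat_adjoint U * A * U) $$ (j, i)"
      unfolding conj_index[OF A assms(2) that(2,1)] by (rule sum.swap)
    finally show ?thesis .
  qed
  thus ?thesis using A assms(2) by (auto simp: hermitian_def)
qed

lemma conj_conj:
  fixes A :: "complex mat"
  assumes "A \<in> carrier_mat n n" "W \<in> carrier_mat n n" "V \<in> carrier_mat n n"
  shows "mat_adjoint (W * V) * A * (W * V) = mat_adjoint V * (mat_adjoint W * A * W) * V"
  using assms by (simp add: mat_adjoint_mult[of W n n V n] mult_assoc_dim)

text \<open>Induction on the dimension. A unitary whose first column is an eigenvector clears the
  first column of the conjugated matrix below the diagonal; Hermiticity clears the first row as
  well, and the induction hypothesis diagonalises the remaining block.\<close>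

theorem spectral_theorem:
  assumes "hermitian n A"
  shows "\<exists>U. unitary n U \<and> diagonal_mat (mat_adjoint U * A * U)"
  using assms
proof (induction n arbitrary: A)
  case 0
  thus ?case by (intro exI[of _ "1\<^sub>m 0"]) (auto simp: unitary_def diagonal_mat_def hermitian_def)
next
  case (Suc n)
  let ?N = "Suc n"
  note A = hermitianD(1)[OF Suc.prems]
  obtain e where "eigenvalue A e"
  proof -
    have "degree (char_poly A) = ?N" using degree_monic_char_poly[OF A] by simp
    hence "\<not> constant (poly (char_poly A))" by (simp add: constant_degree)
    thus ?thesis
      using fundamental_theorem_of_algebra that by (auto simp: eigenvalue_root_char_poly[OF A])
  qed
  then obtain v where v: "v \<in> carrier_vec ?N" "v \<noteq> 0\<^sub>v ?N" "A *\<^sub>v v = e \<cdot>\<^sub>v v"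
    using A by (auto simp: eigenvalue_def eigenvector_def)
  obtain W c where W: "unitary ?N W" "col W 0 = c \<cdot>\<^sub>v v"
    using unitary_completion[OF v(1,2)] by blast
  note Wc = unitaryD(1)[OF W(1)]
  define B where "B = mat_adjoint W * A * W"
  have hB: "hermitian ?N B" unfolding B_def by (rule hermitian_conj[OF Suc.prems Wc])
  note Bc = hermitianD(1)[OF hB]
  \<comment> \<open>The first column of \<open>A * W\<close> is \<open>e\<close> times that of
    \<open>W\<close>, so column 0 of \<open>B\<close> is \<open>e\<close> times column 0 of the
    identity.\<close>
  have B0: "B $$ (i, 0) = 0" if "0 < i" "i < ?N" for i
  proof -
    have AW: "(A * W) $$ (k, 0) = e * W $$ (k, 0)" if "k < ?N" for k
    proof -
      have "(A * W) $$ (k, 0) = (A *\<^sub>v col W 0) $ k"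
        using that A Wc by (simp add: index_mult_mat(1))
      also have "\<dots> = e * W $$ (k, 0)"
      proof -
        have "A *\<^sub>v (c \<cdot>\<^sub>v v) = e \<cdot>\<^sub>v (c \<cdot>\<^sub>v v)"
          using A v by (simp add: mult_mat_vec smult_smult_assoc mult.commute)
        hence "(A *\<^sub>v col W 0) $ k = e * col W 0 $ k"
          using that v(1) by (simp add: W(2))
        thus ?thesis using that Wc by simp
      qed
      finally show ?thesis .
    qed
    have "B $$ (i, 0) = (mat_adjoint W * (A * W)) $$ (i, 0)"
      using A Wc by (simp add: B_def mult_assoc_dim)
    also have "\<dots> = (\<Sum>k<?N. mat_adjoint W $$ (i, k) * (e * W $$ (k, 0)))"
      using that A Wc by (subst mult_index[of _ ?N ?N _ ?N]) (auto simp: AW simp del: sum.lessThan_Suc)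
    also have "\<dots> = e * (mat_adjoint W * W) $$ (i, 0)"
      using that Wc by (subst mult_index[of _ ?N ?N _ ?N])
        (auto simp: sum_distrib_left mult_ac simp del: sum.lessThan_Suc intro!: sum.cong)
    also have "\<dots> = 0" using unitaryD(2)[OF W(1)] that by simp
    finally show ?thesis .
  qed
  have B0': "B $$ (0, i) = 0" if "0 < i" "i < ?N" for i
    using B0[OF that] hermitianD(2)[OF hB, of i 0] that by simp
  define B3 where "B3 = mat n n (\<lambda>(i, j). B $$ (Suc i, Suc j))"
  have "hermitian n B3" using hB by (auto simp: hermitian_def B3_def)
  then obtain U3 where U3: "unitary n U3" "diagonal_mat (mat_adjoint U3 * B3 * U3)"
    using Suc.IH by blast
  note U3c = unitaryD(1)[OF U3(1)]
  have B3c: "B3 \<in> carrier_mat n n" by (simp add: B3_def)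
  \<comment> \<open>The block sum of the 1 by 1 identity and \<open>U3\<close>.\<close>
  define V where "V = mat ?N ?N (\<lambda>(i, j). if i = 0 then (if j = 0 then 1 else 0)
    else if j = 0 then 0 else U3 $$ (i - 1, j - 1))"
  have Vc: "V \<in> carrier_mat ?N ?N" by (simp add: V_def)
  have Vs: "V $$ (0, 0) = 1" "i < n \<Longrightarrow> V $$ (0, Suc i) = 0" "i < n \<Longrightarrow> V $$ (Suc i, 0) = 0"
    "i < n \<Longrightarrow> j < n \<Longrightarrow> V $$ (Suc i, Suc j) = U3 $$ (i, j)" for i j
    by (auto simp: V_def)
  have "unitary ?N V"
  proof -
    have "mat_adjoint V * V = 1\<^sub>m ?N"
    proof (rule eq_matI)
      fix i j assume "i < dim_row (1\<^sub>m ?N)" "j < dim_col (1\<^sub>m ?N)"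
      hence ij: "i < ?N" "j < ?N" by auto
      have *: "(\<Sum>k<n. cnj (U3 $$ (k, i)) * U3 $$ (k, j)) = (if i = j then 1 else 0)"
        if "i < n" "j < n" for i j
      proof -
        have "(\<Sum>k<n. cnj (U3 $$ (k, i)) * U3 $$ (k, j)) = (mat_adjoint U3 * U3) $$ (i, j)"
          using that U3c by (subst mult_index[of _ n n _ n]) auto
        thus ?thesis using that by (simp add: unitaryD(2)[OF U3(1)])
      qed
      have "(mat_adjoint V * V) $$ (i, j) = (\<Sum>k<?N. cnj (V $$ (k, i)) * V $$ (k, j))"
        using ij Vc by (subst mult_index[of _ ?N ?N _ ?N]) (auto simp del: sum.lessThan_Suc)
      also have "\<dots> = 1\<^sub>m ?N $$ (i, j)"
        using ij by (cases i; cases j) (auto simp: sum.lessThan_Suc_shift Vs * simp del: sum.lessThan_Suc)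
      finally show "(mat_adjoint V * V) $$ (i, j) = 1\<^sub>m ?N $$ (i, j)" .
    qed (use Vc in auto)
    thus ?thesis using Vc by (simp add: unitary_def)
  qed
  moreover have "diagonal_mat (mat_adjoint V * B * V)"
    unfolding diagonal_mat_def
  proof (intro allI impI)
    fix i j assume "i < dim_row (mat_adjoint V * B * V)" "j < dim_col (mat_adjoint V * B * V)"
      and ne: "i \<noteq> j"
    hence ij: "i < ?N" "j < ?N" using Vc by auto
    have *: "(\<Sum>k<n. \<Sum>l<n. cnj (U3 $$ (k, i)) * B $$ (Suc k, Suc l) * U3 $$ (l, j)) = 0"
      if "i < n" "j < n" "i \<noteq> j" for i j
    proof -
      have "(mat_adjoint U3 * B3 * U3) $$ (i, j) = 0"
        using U3(2) U3c that by (auto simp: diagonal_mat_def)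
      thus ?thesis unfolding conj_index[OF B3c U3c that(1,2)] by (simp add: B3_def)
    qed
    show "(mat_adjoint V * B * V) $$ (i, j) = 0"
      unfolding conj_index[OF Bc Vc ij] using ij ne
      by (cases i; cases j)
         (auto simp: sum.lessThan_Suc_shift Vs B0 B0' * simp del: sum.lessThan_Suc)
  qed
  ultimately show ?case
    using unitary_mult[OF W(1)] conj_conj[OF A Wc Vc] unfolding B_def by metis
qed

section \<open>Positive semidefinite matrices and the trace norm\<close>

text \<open>Test vectors are functions on the naturals, so they can be written as lambda terms
  without dimension obligations.\<close>

definition qform :: "nat \<Rightarrow> complex mat \<Rightarrow> (nat \<Rightarrow> complex) \<Rightarrow> complex" where
  "qform n A v = (\<Sum>i<n. \<Sum>j<n. cnj (v i) * A $$ (i, j) * v j)"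

lemma psd_iff: "psd n A \<longleftrightarrow> A \<in> carrier_mat n n \<and> (\<forall>v. 0 \<le> qform n A v)"
proof -
  have eq: "(A *\<^sub>v w) \<bullet>c w = qform n A (\<lambda>i. w $ i)"
    if "A \<in> carrier_mat n n" "w \<in> carrier_vec n" for w
    using that
    by (auto simp: qform_def scalar_prod_def atLeast0LessThan sum_distrib_right sum_distrib_left
        mult_ac intro!: sum.cong)
  have "0 \<le> qform n A v" if "A \<in> carrier_mat n n" "\<forall>w\<in>carrier_vec n. 0 \<le> (A *\<^sub>v w) \<bullet>c w" for v
  proof -
    have "qform n A v = qform n A (\<lambda>i. vec n v $ i)"
      by (auto simp: qform_def intro!: sum.cong)
    moreover have "0 \<le> (A *\<^sub>v vec n v) \<bullet>c vec n v" using that by simp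
    ultimately show ?thesis using eq[OF that(1), of "vec n v"] by simp
  qed
  thus ?thesis using eq by (auto simp: psd_def)
qed

lemma psd_carrier: "psd n A \<Longrightarrow> A \<in> carrier_mat n n"
  by (simp add: psd_def)

lemma sum_two_points:
  fixes f :: "nat \<Rightarrow> complex"
  assumes "i < n" "j < n" "i \<noteq> j"
  shows "(\<Sum>l<n. f l * (if l = i then a else if l = j then b else 0)) = f i * a + f j * b"
proof -
  have "f l * (if l = i then a else if l = j then b else 0) =
      (if l = i then f i * a else 0) + (if l = j then f j * b else 0)" for l
    using assms by auto
  thus ?thesis using assms by (simp add: sum.distrib)
qed

text \<open>Hermiticity and the entry bounds of positive matrices are read off from the form on the
  span of two basis vectors.\<close>

lemma qform_two_points:
  assumes "i < n" "j < n" "i \<noteq> j"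
  shows "qform n A (\<lambda>l. if l = i then a else if l = j then b else 0) =
    cnj a * a * A $$ (i, i) + cnj b * b * A $$ (j, j)
    + cnj a * b * A $$ (i, j) + cnj b * a * A $$ (j, i)"
proof -
  let ?v = "\<lambda>l. if l = i then a else if l = j then b else 0"
  have "qform n A ?v = (\<Sum>k<n. (A $$ (k, i) * a + A $$ (k, j) * b) * cnj (?v k))"
    unfolding qform_def
  proof (rule sum.cong[OF refl])
    fix k
    have "(\<Sum>l<n. cnj (?v k) * A $$ (k, l) * ?v l) = cnj (?v k) * (\<Sum>l<n. A $$ (k, l) * ?v l)"
      by (simp only: sum_distrib_left mult.assoc)
    also have "\<dots> = (A $$ (k, i) * a + A $$ (k, j) * b) * cnj (?v k)"
      by (simp only: sum_two_points[OF assms] mult.commute)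
    finally show "(\<Sum>l<n. cnj (?v k) * A $$ (k, l) * ?v l) =
      (A $$ (k, i) * a + A $$ (k, j) * b) * cnj (?v k)" .
  qed
  also have "(\<lambda>k. cnj (?v k)) = (\<lambda>k. if k = i then cnj a else if k = j then cnj b else 0)"
    by auto
  hence "(\<Sum>k<n. (A $$ (k, i) * a + A $$ (k, j) * b) * cnj (?v k)) =
      (\<Sum>k<n. (A $$ (k, i) * a + A $$ (k, j) * b) * (if k = i then cnj a else if k = j then cnj b else 0))"
    by (intro sum.cong) (auto simp: fun_eq_iff)
  also have "\<dots> = (A $$ (i, i) * a + A $$ (i, j) * b) * cnj a + (A $$ (j, i) * a + A $$ (j, j) * b) * cnj b"
    by (rule sum_two_points[OF assms])
  finally show ?thesis by (simp add: algebra_simps)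
qed

lemma qform_unit: "i < n \<Longrightarrow> qform n A (\<lambda>l. if l = i then 1 else 0) = A $$ (i, i)"
  by (simp add: qform_def if_distrib[of "\<lambda>x. _ * x"] if_distrib[of cnj]
        if_distrib[of "\<lambda>x. x * _"] if_distribR cong: if_cong)

lemma psd_diag:
  assumes "psd n A" "i < n"
  shows "0 \<le> A $$ (i, i)"
  using assms qform_unit[OF assms(2), of A] by (metis psd_iff)

lemma psd_hermitian:
  assumes "psd n A"
  shows "hermitian n A"
  unfolding hermitian_def
proof (intro conjI allI impI)
  fix i j assume ij: "i < n" "j < n"
  have d: "Im (A $$ (i, i)) = 0" "Im (A $$ (j, j)) = 0"
    using psd_diag[OF assms] ij by (auto simp: less_eq_complex_def)
  show "cnj (A $$ (i, j)) = A $$ (j, i)"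
  proof (cases "i = j")
    case True
    thus ?thesis using d by (simp add: complex_eq_iff)
  next
    case False
    have q: "Im (qform n A v) = 0" for v using assms by (auto simp: psd_iff less_eq_complex_def)
    \<comment> \<open>Reality of the form at \<open>e_i + e_j\<close> relates the imaginary parts of
      the two entries, at \<open>e_i + \<i> e_j\<close> their real parts.\<close>
    show ?thesis
      using q[of "\<lambda>l. if l = i then 1 else if l = j then 1 else 0"]
        q[of "\<lambda>l. if l = i then 1 else if l = j then \<i> else 0"] d
      unfolding qform_two_points[OF ij False] by (simp add: complex_eq_iff)
  qed
qed (use assms in \<open>auto simp: psd_def\<close>)

lemma psd_trace_nonneg:
  assumes "psd n A"
  shows "0 \<le> Re (trace A)" "i < n \<Longrightarrow> Re (A $$ (i, i)) \<le> Re (trace A)"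
proof -
  have d: "0 \<le> Re (A $$ (i, i))" if "i < n" for i
    using psd_diag[OF assms that] by (auto simp: less_eq_complex_def)
  have t: "Re (trace A) = (\<Sum>i<n. Re (A $$ (i, i)))"
    using psd_carrier[OF assms] by (simp add: trace_def)
  show "0 \<le> Re (trace A)" unfolding t using d by (intro sum_nonneg) auto
  show "i < n \<Longrightarrow> Re (A $$ (i, i)) \<le> Re (trace A)"
    unfolding t using d by (intro member_le_sum) auto
qed

lemma cmod_cnj_sgn: "cnj (sgn z) * z = complex_of_real (cmod z)"
proof (cases "z = 0")
  case False
  have "cnj (sgn z) * z = (cnj z * z) / cmod z" by (simp add: sgn_div_norm scaleR_conv_of_real field_simps)
  also have "cnj z * z = complex_of_real ((cmod z)\<^sup>2)"
    using complex_norm_square[of z] by (simp add: mult.commute)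
  finally show ?thesis using False by (simp add: power2_eq_square)
qed auto

text \<open>A phase \<open>?b\<close> makes both off-diagonal contributions to the form at
  \<open>e_i + ?b e_j\<close> equal to minus the modulus of the entry; positivity then bounds it by
  the diagonal.\<close>

lemma psd_entry_mean:
  assumes "psd n A" "i < n" "j < n"
  shows "cmod (A $$ (i, j)) \<le> (Re (A $$ (i, i)) + Re (A $$ (j, j))) / 2"
proof (cases "i = j \<or> A $$ (i, j) = 0")
  case True
  thus ?thesis using psd_diag[OF assms(1,2)] psd_diag[OF assms(1,3)]
    by (auto simp: less_eq_complex_def cmod_eq_Re)
next
  case False
  hence ne: "i \<noteq> j" by auto
  let ?z = "A $$ (i, j)"
  let ?b = "- cnj (sgn ?z)"
  have "0 \<le> qform n A (\<lambda>l. if l = i then 1 else if l = j then ?b else 0)"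
    using assms by (auto simp: psd_iff)
  moreover have "cnj ?b * ?b = 1"
  proof -
    have "cnj ?b * ?b = complex_of_real ((cmod (sgn ?z))\<^sup>2)"
      by (metis complex_norm_square complex_cnj_cnj complex_cnj_minus mult_minus_left
          mult_minus_right minus_minus of_real_power)
    thus ?thesis using False by (simp add: norm_sgn)
  qed
  moreover have "A $$ (j, i) = cnj ?z" using hermitianD(2)[OF psd_hermitian[OF assms(1)]] assms by simp
  moreover have "?b * ?z = - complex_of_real (cmod ?z)"
    using cmod_cnj_sgn[of ?z] by simp
  moreover have "cnj ?b * cnj ?z = - complex_of_real (cmod ?z)"
    using arg_cong[OF cmod_cnj_sgn[of ?z], of cnj] by simp
  ultimately have "0 \<le> A $$ (i, i) + A $$ (j, j) + (- complex_of_real (cmod ?z)) + (- complex_of_real (cmod ?z))"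
    unfolding qform_two_points[OF assms(2,3) ne] by (simp only: complex_cnj_one mult_1 mult_1_right)
  thus ?thesis by (auto simp: less_eq_complex_def)
qed

lemma psd_entry_bound:
  assumes "psd n A" "i < n" "j < n"
  shows "cmod (A $$ (i, j)) \<le> Re (trace A)"
  using psd_entry_mean[OF assms] psd_trace_nonneg(2)[OF assms(1,2)] psd_trace_nonneg(2)[OF assms(1,3)]
  by simp

section \<open>The cone of positive matrices and the trace\<close>

lemma qform_add: "A \<in> carrier_mat n n \<Longrightarrow> B \<in> carrier_mat n n \<Longrightarrow>
    qform n (A + B) v = qform n A v + qform n B v"
  by (simp add: qform_def algebra_simps sum.distrib)

lemma qform_smult: "A \<in> carrier_mat n n \<Longrightarrow> qform n (c \<cdot>\<^sub>m A) v = c * qform n A v"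
  by (simp add: qform_def sum_distrib_left mult_ac)

lemma psd_add: "psd n A \<Longrightarrow> psd n B \<Longrightarrow> psd n (A + B)"
  by (auto simp: psd_iff qform_add)

lemma psd_smult: "psd n A \<Longrightarrow> 0 \<le> c \<Longrightarrow> psd n (complex_of_real c \<cdot>\<^sub>m A)"
  by (auto simp: psd_iff qform_smult less_eq_complex_def)

lemma psd_zero: "psd n (0\<^sub>m n n)"
  by (auto simp: psd_iff qform_def)

lemma trace_add: "A \<in> carrier_mat n n \<Longrightarrow> B \<in> carrier_mat n n \<Longrightarrow> trace (A + B) = trace A + trace B"
  by (auto simp: trace_def sum.distrib)

lemma trace_smult: "A \<in> carrier_mat n n \<Longrightarrow> trace (c \<cdot>\<^sub>m A) = c * trace A"
  by (auto simp: trace_def sum_distrib_left)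

lemma trace_mult_comm:
  assumes "A \<in> carrier_mat n m" "B \<in> carrier_mat m n"
  shows "trace (A * B) = trace (B * A)"
proof -
  have "trace (A * B) = (\<Sum>i<n. \<Sum>k<m. A $$ (i, k) * B $$ (k, i))"
    using assms by (auto simp: trace_def mult_index[of _ n m _ n] intro!: sum.cong)
  also have "\<dots> = (\<Sum>k<m. \<Sum>i<n. B $$ (k, i) * A $$ (i, k))"
    by (subst sum.swap) (simp add: mult.commute)
  also have "\<dots> = trace (B * A)"
    using assms by (auto simp: trace_def mult_index[of _ m n _ m] intro!: sum.cong)
  finally show ?thesis .
qed

section \<open>Spectral calculus in a fixed eigenbasis\<close>

definition rdiag :: "nat \<Rightarrow> (nat \<Rightarrow> real) \<Rightarrow> complex mat" where
  "rdiag n l = mat n n (\<lambda>(i, j). if i = j then complex_of_real (l i) else 0)"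

text \<open>For a fixed \<open>U\<close>, products act on the eigenvalues \<open>l\<close> alone,
  which supplies squares and absolute values.\<close>

definition spec :: "nat \<Rightarrow> complex mat \<Rightarrow> (nat \<Rightarrow> real) \<Rightarrow> complex mat" where
  "spec n U l = U * rdiag n l * mat_adjoint U"

lemma rdiag_carrier [simp]: "rdiag n l \<in> carrier_mat n n" "dim_row (rdiag n l) = n" "dim_col (rdiag n l) = n"
  by (auto simp: rdiag_def)

lemma rdiag_index [simp]:
  "i < n \<Longrightarrow> j < n \<Longrightarrow> rdiag n l $$ (i, j) = (if i = j then complex_of_real (l i) else 0)"
  by (auto simp: rdiag_def)

lemma rdiag_mult: "rdiag n l * rdiag n m = rdiag n (\<lambda>i. l i * m i)"
  by (intro eq_matI)
    (auto simp: mult_index[of _ n n _ n] if_distrib[of "\<lambda>x. _ * x"] if_distribR cong: if_cong)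

lemma spec_carrier: "unitary n U \<Longrightarrow> spec n U l \<in> carrier_mat n n"
  by (auto simp: spec_def unitary_def)

lemma spec_index:
  assumes "unitary n U" "i < n" "j < n"
  shows "spec n U l $$ (i, j) = (\<Sum>k<n. U $$ (i, k) * l k * cnj (U $$ (j, k)))"
proof -
  note U = unitaryD(1)[OF assms(1)]
  have "(U * rdiag n l) $$ (i, k) = U $$ (i, k) * l k" if "k < n" for k
    using U assms that
    by (subst mult_index[of _ n n _ n])
       (auto simp: if_distrib[of "\<lambda>x. _ * x"] if_distribR cong: if_cong)
  thus ?thesis using U assms unfolding spec_def
    by (subst mult_index[of _ n n _ n]) auto
qed

lemma spec_mult:
  assumes "unitary n U"
  shows "spec n U l * spec n U m = spec n U (\<lambda>i. l i * m i)"
proof -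
  note U = unitaryD[OF assms]
  have "spec n U l * spec n U m = U * (rdiag n l * ((mat_adjoint U * U) * rdiag n m)) * mat_adjoint U"
    using U(1) by (simp add: spec_def mult_assoc_dim)
  thus ?thesis by (simp add: U(2) spec_def rdiag_mult left_mult_one_mat[of _ n n])
qed

lemma spec_trace:
  assumes "unitary n U"
  shows "trace (spec n U l) = complex_of_real (\<Sum>k<n. l k)"
proof -
  note U = unitaryD[OF assms]
  have "trace (spec n U l) = trace (U * (rdiag n l * mat_adjoint U))"
    using U(1) by (simp add: spec_def mult_assoc_dim)
  also have "\<dots> = trace (rdiag n l * (mat_adjoint U * U))"
    using U(1) by (subst trace_mult_comm[of _ n n]) (auto simp: mult_assoc_dim)
  also have "\<dots> = complex_of_real (\<Sum>k<n. l k)"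
    by (simp add: U(2) right_mult_one_mat[of _ n n]) (simp add: trace_def)
  finally show ?thesis .
qed

lemma spec_conj:
  assumes "unitary n U"
  shows "mat_adjoint U * spec n U l * U = rdiag n l"
proof -
  note U = unitaryD[OF assms]
  have "mat_adjoint U * spec n U l * U = (mat_adjoint U * U) * rdiag n l * (mat_adjoint U * U)"
    using U(1) by (simp add: spec_def mult_assoc_dim)
  thus ?thesis by (simp add: U(2) left_mult_one_mat[of _ n n] right_mult_one_mat[of _ n n])
qed

lemma conj_diff:
  assumes "A \<in> carrier_mat n n" "B \<in> carrier_mat n n" "U \<in> carrier_mat n n"
  shows "mat_adjoint U * (A - B) * U = mat_adjoint U * A * U - mat_adjoint U * B * U"
proof -
  have "mat_adjoint U * (A - B) = mat_adjoint U * A - mat_adjoint U * B"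
    using assms by (intro mult_minus_distrib_mat) auto
  moreover have "(mat_adjoint U * A - mat_adjoint U * B) * U =
      mat_adjoint U * A * U - mat_adjoint U * B * U"
    using assms by (intro minus_mult_distrib_mat[of _ n n]) (auto intro!: mult_carrier_mat)
  ultimately show ?thesis by simp
qed

lemma psd_spec:
  assumes "unitary n U" "\<And>k. k < n \<Longrightarrow> 0 \<le> l k"
  shows "psd n (spec n U l)"
proof -
  have "0 \<le> qform n (spec n U l) v" for v
  proof -
    \<comment> \<open>Coordinates of \<open>v\<close> in the eigenbasis, up to conjugation; the form
      becomes a sum of squared moduli weighted by \<open>l k\<close>.\<close>
    define z where "z k = (\<Sum>i<n. cnj (v i) * U $$ (i, k))" for k
    have "qform n (spec n U l) v =
        (\<Sum>i<n. \<Sum>j<n. \<Sum>k<n. l k * (cnj (v i) * U $$ (i, k)) * cnj (cnj (v j) * U $$ (j, k)))"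
      by (auto simp: qform_def spec_index[OF assms(1)] sum_distrib_left sum_distrib_right mult_ac
          intro!: sum.cong)
    also have "\<dots> = (\<Sum>k<n. \<Sum>i<n. \<Sum>j<n. l k * (cnj (v i) * U $$ (i, k)) * cnj (cnj (v j) * U $$ (j, k)))"
      by (rule trans[OF sum.cong[OF refl sum.swap] sum.swap])
    also have "\<dots> = (\<Sum>k<n. l k * (z k * cnj (z k)))"
      by (simp add: z_def sum_distrib_left sum_distrib_right mult_ac)
    also have "0 \<le> \<dots>"
    proof (rule sum_nonneg)
      fix k assume "k \<in> {..<n}"
      thus "0 \<le> l k * (z k * cnj (z k))"
        using assms(2)[of k] by (simp add: complex_norm_square[symmetric] less_eq_complex_def
            flip: of_real_power of_real_mult)
    qed
    finally show ?thesis .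
  qed
  thus ?thesis using spec_carrier[OF assms(1)] by (simp add: psd_iff)
qed

lemma hermitian_spec:
  assumes "hermitian n X"
  shows "\<exists>U l. unitary n U \<and> X = spec n U l"
proof -
  obtain U where U: "unitary n U" "diagonal_mat (mat_adjoint U * X * U)"
    using spectral_theorem[OF assms] by blast
  define D where "D = mat_adjoint U * X * U"
  have X: "X \<in> carrier_mat n n" using assms by (simp add: hermitian_def)
  have hD: "hermitian n D" unfolding D_def by (rule hermitian_conj[OF assms unitaryD(1)[OF U(1)]])
  hence Dc: "D \<in> carrier_mat n n" by (simp add: hermitian_def)
  have "complex_of_real (Re (D $$ (i, i))) = D $$ (i, i)" if "i < n" for i
    using hermitianD(2)[OF hD that that] by (simp add: complex_eq_iff)
  hence D: "D = rdiag n (\<lambda>i. Re (D $$ (i, i)))"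
    using Dc U(2) by (intro eq_matI) (auto simp: diagonal_mat_def D_def[symmetric])
  have "U * D * mat_adjoint U = (U * mat_adjoint U) * X * (U * mat_adjoint U)"
    using X unitaryD(1)[OF U(1)] by (simp add: D_def mult_assoc_dim)
  hence "X = U * D * mat_adjoint U"
    using X by (simp add: unitaryD(3)[OF U(1)])
  thus ?thesis using U(1) D unfolding spec_def by metis
qed

lemma conj_diag_qform:
  assumes "A \<in> carrier_mat n n" "U \<in> carrier_mat n n" "k < n"
  shows "(mat_adjoint U * A * U) $$ (k, k) = qform n A (\<lambda>i. U $$ (i, k))"
  using conj_index[OF assms(1,2,3,3)] by (simp add: qform_def)

text \<open>
  Diagonalise \<open>A - B\<close>: since \<open>(A - B) A + B (A - B) = A\<^sup>2 - B\<^sup>2 = 0\<close>, an eigenvector for a nonzero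
  eigenvalue would have vanishing expectation under both \<open>A\<close> and \<open>B\<close>.
\<close>

lemma psd_sqrt_unique:
  assumes A: "psd n A" and B: "psd n B" and eq: "A * A = B * B"
  shows "A = B"
proof -
  have c: "A \<in> carrier_mat n n" "B \<in> carrier_mat n n" using A B by (auto simp: psd_def)
  obtain U l where U: "unitary n U" and C: "A - B = spec n U l"
    using hermitian_spec[OF hermitian_diff[OF psd_hermitian[OF A] psd_hermitian[OF B]]] by blast
  note Uc = unitaryD(1)[OF U]
  define A' where "A' = mat_adjoint U * A * U"
  define B' where "B' = mat_adjoint U * B * U"
  have c': "A' \<in> carrier_mat n n" "B' \<in> carrier_mat n n" using Uc c by (auto simp: A'_def B'_def)
  have D: "rdiag n l = A' - B'"
  proof -
    have "rdiag n l = mat_adjoint U * (A - B) * U" by (simp add: C spec_conj[OF U])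
    also have "\<dots> = A' - B'"
      using Uc c by (simp add: A'_def B'_def conj_diff)
    finally show ?thesis .
  qed
  have eq': "A' * A' = B' * B'"
  proof -
    have "M' * M' = mat_adjoint U * (M * M) * U"
      if "M' = mat_adjoint U * M * U" "M \<in> carrier_mat n n" for M M'
    proof -
      have "M' * M' = mat_adjoint U * M * (U * mat_adjoint U) * M * U"
        using that Uc by (simp add: mult_assoc_dim)
      also have "\<dots> = mat_adjoint U * M * M * U"
        using that Uc by (simp add: unitaryD(3)[OF U] right_mult_one_mat[of _ n n])
      finally show ?thesis using that Uc by (simp add: mult_assoc_dim)
    qed
    thus ?thesis using A'_def B'_def c eq by metis
  qed
  have "l k = 0" if k: "k < n" for k
  proof -
    \<comment> \<open>The identity \<open>(A - B) A + B (A - B) = 0\<close> in the eigenbasis of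
      \<open>A - B\<close>.\<close>
    have "rdiag n l * A' + B' * rdiag n l = 0\<^sub>m n n"
    proof -
      have "rdiag n l * A' + B' * rdiag n l = (A' * A' - B' * A') + (B' * A' - B' * B')"
        using c' by (simp add: D mult_minus_distrib_mat[of _ n n] minus_mult_distrib_mat[of _ n n])
      also have "\<dots> = 0\<^sub>m n n" using c' by (intro eq_matI) (auto simp: eq')
      finally show ?thesis .
    qed
    hence "(rdiag n l * A') $$ (k, k) + (B' * rdiag n l) $$ (k, k) = 0"
      using k c' by (metis index_add_mat(1) index_zero_mat(1) index_mult_mat(2,3) carrier_matD rdiag_carrier(1))
    hence *: "l k * (A' $$ (k, k) + B' $$ (k, k)) = 0"
      using k c'
      by (simp add: mult_index[of _ n n _ n] if_distrib[of "\<lambda>x. _ * x"] if_distribR algebra_simps cong: if_cong)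
    have "complex_of_real (l k) = A' $$ (k, k) - B' $$ (k, k)"
      using arg_cong[OF D, of "\<lambda>M. M $$ (k, k)"] k c' by simp
    moreover have "0 \<le> A' $$ (k, k)" "0 \<le> B' $$ (k, k)"
      using A B k Uc c by (auto simp: A'_def B'_def conj_diag_qform psd_iff)
    \<comment> \<open>\<open>l k\<close> is the difference of two nonnegative reals, and its product
      with their sum vanishes, so it is zero.\<close>
    ultimately show ?thesis using *
      by (auto simp: less_eq_complex_def complex_eq_iff)
  qed
  hence "A - B = 0\<^sub>m n n"
    unfolding C using carrier_matD[OF spec_carrier[OF U]] by (intro eq_matI) (auto simp: spec_index[OF U])
  hence "A $$ (i, j) - B $$ (i, j) = 0" if "i < n" "j < n" for i j
    using that c by (metis index_minus_mat(1) index_zero_mat(1) carrier_matD)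
  thus ?thesis using c by (intro eq_matI) auto
qed

text \<open>Uniqueness makes the definite description computable: exhibiting one positive root
  suffices.\<close>

lemma psd_sqrt_eq:
  assumes "psd n B" "A = B * B"
  shows "psd_sqrt A = B"
proof -
  have "dim_row A = n" using assms psd_carrier[OF assms(1)] by simp
  thus ?thesis unfolding psd_sqrt_def
    using assms psd_sqrt_unique by (intro the_equality) auto
qed

lemma trace_norm_spec:
  assumes "unitary n U"
  shows "trace_norm (spec n U l) = (\<Sum>k<n. \<bar>l k\<bar>)"
proof -
  have h: "hermitian n (spec n U l)"
    unfolding hermitian_def using spec_carrier[OF assms]
    by (auto simp: spec_index[OF assms] mult_ac)
  have "mat_adjoint (spec n U l) * spec n U l = spec n U (\<lambda>k. \<bar>l k\<bar>) * spec n U (\<lambda>k. \<bar>l k\<bar>)"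
    by (simp add: hermitian_adjoint[OF h] spec_mult[OF assms])
  hence "psd_sqrt (mat_adjoint (spec n U l) * spec n U l) = spec n U (\<lambda>k. \<bar>l k\<bar>)"
    by (intro psd_sqrt_eq[OF psd_spec[OF assms]]) auto
  thus ?thesis by (simp add: trace_norm_def spec_trace[OF assms])
qed

text \<open>Applied to \<sigma>, the columns of \<open>B\<close> yield the Kraus operators of the
  channel that appends the program state.\<close>

lemma psd_factor:
  assumes "psd n A"
  shows "\<exists>B\<in>carrier_mat n n. \<forall>i<n. \<forall>j<n. A $$ (i, j) = (\<Sum>k<n. B $$ (i, k) * cnj (B $$ (j, k)))"
proof -
  obtain U l where U: "unitary n U" and A: "A = spec n U l"
    using hermitian_spec[OF psd_hermitian[OF assms]] by blast
  have l: "0 \<le> l k" if "k < n" for k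
  proof -
    have "0 \<le> (mat_adjoint U * A * U) $$ (k, k)"
      using assms that unitaryD(1)[OF U] conj_diag_qform[of A n U k] by (simp add: psd_iff)
    thus ?thesis using that by (simp add: A spec_conj[OF U] less_eq_complex_def)
  qed
  define B where "B = mat n n (\<lambda>(i, k). U $$ (i, k) * complex_of_real (sqrt (l k)))"
  have "U $$ (i, k) * l k * cnj (U $$ (j, k)) = B $$ (i, k) * cnj (B $$ (j, k))"
    if "i < n" "j < n" "k < n" for i j k
  proof -
    define s where "s = complex_of_real (sqrt (l k))"
    have "complex_of_real (l k) = s * s"
      unfolding s_def by (rule of_real_sqrt_square[OF l[OF that(3)], symmetric])
    moreover have "B $$ (i, k) = U $$ (i, k) * s" "B $$ (j, k) = U $$ (j, k) * s" "cnj s = s"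
      using that by (simp_all add: B_def s_def)
    ultimately show ?thesis by simp
  qed
  thus ?thesis
    by (intro bexI[of _ B]) (auto simp: A spec_index[OF U] B_def intro!: sum.cong)
qed

text \<open>
  The decomposition norm on Hermitian matrices. Unlike for \<^const>\<open>trace_norm\<close>, its triangle inequality
  and its contraction under channels are immediate.
\<close>

definition jbound :: "nat \<Rightarrow> real \<Rightarrow> complex mat \<Rightarrow> bool" where
  "jbound n c X \<longleftrightarrow>
    (\<exists>P N. psd n P \<and> psd n N \<and> X = P - N \<and> Re (trace P) + Re (trace N) \<le> c)"

lemma jbound_carrier: "jbound n c X \<Longrightarrow> X \<in> carrier_mat n n"
  by (auto simp: jbound_def psd_def)

lemma jbound_nonneg: "jbound n c X \<Longrightarrow> 0 \<le> c"
  unfolding jbound_def using psd_trace_nonneg(1) by (smt (verit))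

lemma jbound_hermitian: "jbound n c X \<Longrightarrow> hermitian n X"
  unfolding jbound_def using hermitian_diff psd_hermitian by blast

lemma jbound_mono: "jbound n c X \<Longrightarrow> c \<le> c' \<Longrightarrow> jbound n c' X"
  unfolding jbound_def by force

lemma jbound_psd:
  assumes "psd n P"
  shows "jbound n (Re (trace P)) P"
  unfolding jbound_def using assms psd_zero[of n] psd_carrier[OF assms]
  by (intro exI[of _ P] exI[of _ "0\<^sub>m n n"]) (auto simp: trace_def)

lemma jbound_add:
  assumes "jbound n a X" "jbound n b Y"
  shows "jbound n (a + b) (X + Y)"
proof -
  obtain P N where 1: "psd n P" "psd n N" "X = P - N" "Re (trace P) + Re (trace N) \<le> a"
    using assms(1) by (auto simp: jbound_def)
  obtain Q M where 2: "psd n Q" "psd n M" "Y = Q - M" "Re (trace Q) + Re (trace M) \<le> b"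
    using assms(2) by (auto simp: jbound_def)
  note c = 1(1,2)[THEN psd_carrier] 2(1,2)[THEN psd_carrier]
  have "X + Y = (P + Q) - (N + M)" using c 1 2 by (intro eq_matI) auto
  moreover have "Re (trace (P + Q)) + Re (trace (N + M)) \<le> a + b"
    using c 1 2 by (simp add: trace_add)
  ultimately show ?thesis unfolding jbound_def using psd_add 1 2 by blast
qed

lemma jbound_uminus:
  assumes "jbound n a X"
  shows "jbound n a (- X)"
proof -
  obtain P N where 1: "psd n P" "psd n N" "X = P - N" "Re (trace P) + Re (trace N) \<le> a"
    using assms(1) by (auto simp: jbound_def)
  have "- X = N - P" using 1(1,2)[THEN psd_carrier] 1(3) by (intro eq_matI) auto
  thus ?thesis unfolding jbound_def using 1 by (intro exI[of _ N] exI[of _ P]) auto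
qed

lemma jbound_smult:
  assumes "jbound n a X" "0 \<le> s"
  shows "jbound n (s * a) (complex_of_real s \<cdot>\<^sub>m X)"
proof -
  obtain P N where 1: "psd n P" "psd n N" "X = P - N" "Re (trace P) + Re (trace N) \<le> a"
    using assms(1) by (auto simp: jbound_def)
  note c = 1(1,2)[THEN psd_carrier]
  have "complex_of_real s \<cdot>\<^sub>m X = complex_of_real s \<cdot>\<^sub>m P - complex_of_real s \<cdot>\<^sub>m N"
    using c 1(3) by (intro eq_matI) (auto simp: algebra_simps)
  moreover have "Re (trace (complex_of_real s \<cdot>\<^sub>m P)) + Re (trace (complex_of_real s \<cdot>\<^sub>m N)) \<le> s * a"
    using mult_left_mono[OF 1(4) assms(2)] c by (simp add: trace_smult algebra_simps)
  ultimately show ?thesis unfolding jbound_def using psd_smult assms(2) 1 by blast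
qed

text \<open>Turns the norm growth of the powers of the generator into entrywise convergence of its
  exponential series.\<close>

lemma jbound_entry:
  assumes "jbound n c X" "i < n" "j < n"
  shows "cmod (X $$ (i, j)) \<le> c"
proof -
  obtain P N where 1: "psd n P" "psd n N" "X = P - N" "Re (trace P) + Re (trace N) \<le> c"
    using assms(1) by (auto simp: jbound_def)
  have "cmod (X $$ (i, j)) \<le> cmod (P $$ (i, j)) + cmod (N $$ (i, j))"
    using 1(1,2)[THEN psd_carrier] 1(3) assms by (simp add: norm_triangle_ineq4)
  thus ?thesis using psd_entry_bound[OF 1(1) assms(2,3)] psd_entry_bound[OF 1(2) assms(2,3)] 1(4)
    by simp
qed

lemma trace_conj:
  assumes "unitary n U" "A \<in> carrier_mat n n"
  shows "trace (mat_adjoint U * A * U) = trace A"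
proof -
  note U = unitaryD[OF assms(1)]
  have "trace (mat_adjoint U * A * U) = trace ((U * mat_adjoint U) * A)"
    using U(1) assms(2) by (subst trace_mult_comm[of _ n n]) (auto simp: mult_assoc_dim)
  thus ?thesis using U assms by simp
qed

text \<open>In any orthonormal basis the diagonals of the two positive parts are nonnegative and sum
  to their traces. In an eigenbasis of \<open>X\<close> the left-hand side is the trace
  norm.\<close>

lemma jbound_conj_diag:
  assumes "jbound n c X" "unitary n U"
  shows "(\<Sum>k<n. cmod ((mat_adjoint U * X * U) $$ (k, k))) \<le> c"
proof -
  obtain P N where 1: "psd n P" "psd n N" "X = P - N" "Re (trace P) + Re (trace N) \<le> c"
    using assms(1) by (auto simp: jbound_def)
  note U = unitaryD[OF assms(2)]
  note c = 1(1,2)[THEN psd_carrier]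
  let ?P = "mat_adjoint U * P * U" and ?N = "mat_adjoint U * N * U"
  have nn: "0 \<le> ?P $$ (k, k)" "0 \<le> ?N $$ (k, k)" if "k < n" for k
    using 1 c U(1) that by (auto simp: conj_diag_qform psd_iff)
  have X: "mat_adjoint U * X * U = ?P - ?N"
    using U c by (simp add: 1(3) conj_diff)
  have "cmod ((mat_adjoint U * X * U) $$ (k, k)) \<le> Re (?P $$ (k, k)) + Re (?N $$ (k, k))" if "k < n" for k
  proof -
    have "cmod ((mat_adjoint U * X * U) $$ (k, k)) \<le> cmod (?P $$ (k, k)) + cmod (?N $$ (k, k))"
      using that U(1) c by (simp add: X norm_triangle_ineq4)
    thus ?thesis using nn[OF that] by (simp add: less_eq_complex_def cmod_eq_Re)
  qed
  hence "(\<Sum>k<n. cmod ((mat_adjoint U * X * U) $$ (k, k))) \<le>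
      (\<Sum>k<n. Re (?P $$ (k, k)) + Re (?N $$ (k, k)))"
    by (intro sum_mono) auto
  also have "\<dots> = Re (trace ?P) + Re (trace ?N)"
    using U(1) by (simp add: trace_def sum.distrib)
  also have "\<dots> \<le> c" using 1(4) c by (simp add: trace_conj[OF assms(2)])
  finally show ?thesis .
qed

text \<open>The bridge to the trace norm, for entrywise limits since the exponential is reached only
  in that way. All \<open>Y m\<close> are conjugated with one eigenbasis of the limit. They need not
  be diagonal there, but the sums of their absolute diagonal entries converge to the trace norm of
  \<open>X\<close>.\<close>

lemma trace_norm_limit:
  assumes Y: "\<And>m. jbound n (c m) (Y m)"
    and lim: "\<And>i j. i < n \<Longrightarrow> j < n \<Longrightarrow> (\<lambda>m. Y m $$ (i, j)) \<longlonglongrightarrow> X $$ (i, j)"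
    and X: "X \<in> carrier_mat n n" and c: "c \<longlonglongrightarrow> c'"
  shows "trace_norm X \<le> c'"
proof -
  have "hermitian n X"
    unfolding hermitian_def
  proof (intro conjI allI impI X)
    fix i j assume ij: "i < n" "j < n"
    have "(\<lambda>m. cnj (Y m $$ (i, j))) \<longlonglongrightarrow> cnj (X $$ (i, j))"
      using lim[OF ij] by (intro tendsto_cnj)
    moreover have "(\<lambda>m. cnj (Y m $$ (i, j))) = (\<lambda>m. Y m $$ (j, i))"
      using hermitianD(2)[OF jbound_hermitian[OF Y] ij] by auto
    ultimately show "cnj (X $$ (i, j)) = X $$ (j, i)"
      using lim[OF ij(2,1)] LIMSEQ_unique by metis
  qed
  then obtain U l where U: "unitary n U" and X': "X = spec n U l"
    using hermitian_spec by blast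
  note Uc = unitaryD(1)[OF U]
  have "(\<lambda>m. \<Sum>k<n. cmod ((mat_adjoint U * Y m * U) $$ (k, k))) \<longlonglongrightarrow>
      (\<Sum>k<n. cmod ((mat_adjoint U * X * U) $$ (k, k)))"
  proof (intro tendsto_sum tendsto_norm)
    fix k assume "k \<in> {..<n}"
    thus "(\<lambda>m. (mat_adjoint U * Y m * U) $$ (k, k)) \<longlonglongrightarrow> (mat_adjoint U * X * U) $$ (k, k)"
      using Uc X jbound_carrier[OF Y] lim
      by (auto simp: conj_index[of _ n U n] intro!: tendsto_sum tendsto_mult)
  qed
  hence "(\<Sum>k<n. cmod ((mat_adjoint U * X * U) $$ (k, k))) \<le> c'"
    using c jbound_conj_diag[OF Y U] by (intro LIMSEQ_le) auto
  thus ?thesis by (simp add: X' trace_norm_spec[OF U] spec_conj[OF U])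
qed

section \<open>Superoperators and Kraus families\<close>

lemma sum_mult_split:
  fixes f :: "nat \<Rightarrow> 'a :: comm_monoid_add"
  shows "(\<Sum>i<r * m. f i) = (\<Sum>a<r. \<Sum>k<m. f (a * m + k))"
proof -
  have "sum f {a * m..<a * m + m} = (\<Sum>k<m. f (a * m + k))" for a
    using sum.shift_bounds_nat_ivl[of f 0 "a * m" m] by (simp add: atLeast0LessThan add.commute)
  thus ?thesis by (simp flip: sum.nat_group)
qed

lemma mult_split_less: "a < r \<Longrightarrow> k < m \<Longrightarrow> a * m + k < r * (m :: nat)"
proof -
  assume "a < r" "k < m"
  hence "a * m + k < Suc a * m" by simp
  also have "\<dots> \<le> r * m" using \<open>a < r\<close> by (intro mult_le_mono1) simp
  finally show ?thesis .
qed

lemma div_mod_less: "i < r * m \<Longrightarrow> i div m < r \<and> i mod m < (m :: nat)"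
  by (cases "m = 0") (auto simp: div_less_iff_less_mult)

lemma sum_delta_mult [simp]:
  fixes f :: "'a \<Rightarrow> 'b :: semiring_1"
  assumes "finite A"
  shows "(\<Sum>x\<in>A. (if x = j then 1 else 0) * f x) = (if j \<in> A then f j else 0)"
    "(\<Sum>x\<in>A. (if j = x then 1 else 0) * f x) = (if j \<in> A then f j else 0)"
    "(\<Sum>x\<in>A. f x * (if x = j then 1 else 0)) = (if j \<in> A then f j else 0)"
    "(\<Sum>x\<in>A. f x * (if j = x then 1 else 0)) = (if j \<in> A then f j else 0)"
proof -
  have "(if P then 1 else 0) * y = (if P then y else 0)" "y * (if P then 1 else 0) = (if P then y else 0)"
    for P and y :: 'b
    by auto
  thus "(\<Sum>x\<in>A. (if x = j then 1 else 0) * f x) = (if j \<in> A then f j else 0)"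
    "(\<Sum>x\<in>A. (if j = x then 1 else 0) * f x) = (if j \<in> A then f j else 0)"
    "(\<Sum>x\<in>A. f x * (if x = j then 1 else 0)) = (if j \<in> A then f j else 0)"
    "(\<Sum>x\<in>A. f x * (if j = x then 1 else 0)) = (if j \<in> A then f j else 0)"
    using assms by simp_all
qed

section \<open>Linear superoperators and their extension to a reference system\<close>

lemma linear_superopD:
  assumes "linear_superop m n \<Phi>"
  shows "A \<in> carrier_mat m m \<Longrightarrow> \<Phi> A \<in> carrier_mat n n"
    "A \<in> carrier_mat m m \<Longrightarrow> B \<in> carrier_mat m m \<Longrightarrow> \<Phi> (A + B) = \<Phi> A + \<Phi> B"
    "A \<in> carrier_mat m m \<Longrightarrow> \<Phi> (c \<cdot>\<^sub>m A) = c \<cdot>\<^sub>m \<Phi> A"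
  using assms by (auto simp: linear_superop_def)

lemma linear_superop_diff:
  assumes "linear_superop m n \<Phi>" "A \<in> carrier_mat m m" "B \<in> carrier_mat m m"
  shows "\<Phi> (A - B) = \<Phi> A - \<Phi> B"
proof -
  have "A - B = A + (- 1) \<cdot>\<^sub>m B" using assms by (intro eq_matI) auto
  hence "\<Phi> (A - B) = \<Phi> A + (- 1) \<cdot>\<^sub>m \<Phi> B"
    using assms by (simp add: linear_superop_def)
  thus ?thesis using linear_superopD(1)[OF assms(1)] assms(2,3) by (intro eq_matI) auto
qed

lemma linear_superop_comp:
  "linear_superop m n \<Phi> \<Longrightarrow> linear_superop n p \<Psi> \<Longrightarrow> linear_superop m p (\<lambda>X. \<Psi> (\<Phi> X))"
  by (simp add: linear_superop_def)

lemma linear_superop_funpow: "linear_superop n n \<Phi> \<Longrightarrow> linear_superop n n (\<Phi> ^^ k)"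
  by (induction k) (auto simp: linear_superop_def)

text \<open>Supplies the coefficients with which \<open>id_tensor_domination\<close> estimates the
  extension of a superoperator to a reference system.\<close>

lemma linear_superop_matrix_units:
  assumes \<Psi>: "linear_superop m n \<Psi>" and A: "A \<in> carrier_mat m m" and il: "i < n" "l < n"
  shows "\<Psi> A $$ (i, l) = (\<Sum>j<m. \<Sum>k<m. A $$ (j, k) *
    \<Psi> (mat m m (\<lambda>p. if p = (j, k) then 1 else 0)) $$ (i, l))"
proof -
  define e where "e p = mat m m (\<lambda>q. if q = p then 1 else (0 :: complex))" for p
  \<comment> \<open>Induction over the set of positions at which \<open>A\<close> is kept; linearity
    is available for two summands at a time.\<close>
  have gen: "\<Psi> (mat m m (\<lambda>q. if q \<in> S then A $$ q else 0)) $$ (i, l) =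
      (\<Sum>p\<in>S. A $$ p * \<Psi> (e p) $$ (i, l))" if "finite S" "S \<subseteq> {..<m} \<times> {..<m}" for S
    using that
  proof (induction S)
    case empty
    \<comment> \<open>The value at the zero matrix comes from homogeneity with the scalar 0.\<close>
    have "mat m m (\<lambda>q. if q \<in> {} then A $$ q else 0) = 0 \<cdot>\<^sub>m A"
      using A by (intro eq_matI) auto
    thus ?case using linear_superopD(3)[OF \<Psi> A, of 0] linear_superopD(1)[OF \<Psi> A] il by simp
  next
    case (insert p S)
    let ?M = "mat m m (\<lambda>q. if q \<in> S then A $$ q else 0)"
    have "mat m m (\<lambda>q. if q \<in> insert p S then A $$ q else 0) = ?M + A $$ p \<cdot>\<^sub>m e p"
      using insert.hyps by (intro eq_matI) (auto simp: e_def)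
    moreover have "\<Psi> (?M + A $$ p \<cdot>\<^sub>m e p) = \<Psi> ?M + A $$ p \<cdot>\<^sub>m \<Psi> (e p)"
      using \<Psi> by (simp add: linear_superop_def e_def)
    moreover have "\<Psi> ?M \<in> carrier_mat n n" "\<Psi> (e p) \<in> carrier_mat n n"
      using linear_superopD(1)[OF \<Psi>] by (auto simp: e_def)
    ultimately show ?case using insert il by (simp add: add.commute)
  qed
  have "mat m m (\<lambda>q. if q \<in> {..<m} \<times> {..<m} then A $$ q else 0) = A"
    using A by (intro eq_matI) auto
  hence "\<Psi> A $$ (i, l) = (\<Sum>p\<in>{..<m} \<times> {..<m}. A $$ p * \<Psi> (e p) $$ (i, l))"
    using gen[of "{..<m} \<times> {..<m}"] by (simp only: finite_cartesian_product finite_lessThan order_refl)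
  thus ?thesis
    by (simp only: sum.cartesian_product e_def case_prod_unfold prod.collapse)
qed

lemma sub_block_carrier [simp]: "sub_block m X a b \<in> carrier_mat m m"
  "dim_row (sub_block m X a b) = m" "dim_col (sub_block m X a b) = m"
  by (simp_all add: sub_block_def)

lemma sub_block_index [simp]:
  "k < m \<Longrightarrow> l < m \<Longrightarrow> sub_block m X a b $$ (k, l) = X $$ (a * m + k, b * m + l)"
  by (simp add: sub_block_def)

lemma id_tensor_carrier [simp]: "id_tensor r m n \<Phi> X \<in> carrier_mat (r * n) (r * n)"
  "dim_row (id_tensor r m n \<Phi> X) = r * n" "dim_col (id_tensor r m n \<Phi> X) = r * n"
  by (simp_all add: id_tensor_def)

lemma id_tensor_index:
  assumes "a < r" "b < r" "i < n" "j < n"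
  shows "id_tensor r m n \<Phi> X $$ (a * n + i, b * n + j) = \<Phi> (sub_block m X a b) $$ (i, j)"
  using assms by (simp add: id_tensor_def mult_split_less)

lemma sub_block_id_tensor:
  assumes "linear_superop m n \<Phi>" "a < r" "b < r"
  shows "sub_block n (id_tensor r m n \<Phi> X) a b = \<Phi> (sub_block m X a b)"
  using linear_superopD(1)[OF assms(1) sub_block_carrier(1), of X a b] assms
  by (intro eq_matI) (auto simp: id_tensor_index)

lemma block_eqI:
  assumes "A \<in> carrier_mat (r * n) (r * n)" "B \<in> carrier_mat (r * n) (r * n)"
    "\<And>a b i j. a < r \<Longrightarrow> b < r \<Longrightarrow> i < n \<Longrightarrow> j < n \<Longrightarrow>
      A $$ (a * n + i, b * n + j) = B $$ (a * n + i, b * n + j)"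
  shows "A = B"
proof (rule eq_matI)
  fix i j assume "i < dim_row B" "j < dim_col B"
  hence "i < r * n" "j < r * n" using assms(2) by auto
  from this[THEN div_mod_less] show "A $$ (i, j) = B $$ (i, j)"
    using assms(3)[of "i div n" "j div n" "i mod n" "j mod n"] by simp
qed (use assms in auto)

lemma linear_superop_id_tensor:
  assumes "linear_superop m n \<Phi>"
  shows "linear_superop (r * m) (r * n) (id_tensor r m n \<Phi>)"
  unfolding linear_superop_def
proof (intro conjI ballI allI)
  fix A B :: "complex mat" assume AB: "A \<in> carrier_mat (r * m) (r * m)" "B \<in> carrier_mat (r * m) (r * m)"
  show "id_tensor r m n \<Phi> (A + B) = id_tensor r m n \<Phi> A + id_tensor r m n \<Phi> B"
  proof (rule block_eqI[of _ r n])
    fix a b i j assume ab: "a < r" "b < r" "i < n" "j < n"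
    have "sub_block m (A + B) a b = sub_block m A a b + sub_block m B a b"
      using AB ab by (intro eq_matI) (auto simp: mult_split_less)
    thus "id_tensor r m n \<Phi> (A + B) $$ (a * n + i, b * n + j) =
        (id_tensor r m n \<Phi> A + id_tensor r m n \<Phi> B) $$ (a * n + i, b * n + j)"
      using ab linear_superopD(1)[OF assms sub_block_carrier(1)]
      by (simp add: id_tensor_index linear_superopD(2)[OF assms] mult_split_less
          carrier_matD[OF linear_superopD(1)[OF assms sub_block_carrier(1)]])
  qed auto
next
  fix c and A :: "complex mat" assume A: "A \<in> carrier_mat (r * m) (r * m)"
  show "id_tensor r m n \<Phi> (c \<cdot>\<^sub>m A) = c \<cdot>\<^sub>m id_tensor r m n \<Phi> A"
  proof (rule block_eqI[of _ r n])
    fix a b i j assume ab: "a < r" "b < r" "i < n" "j < n"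
    have "sub_block m (c \<cdot>\<^sub>m A) a b = c \<cdot>\<^sub>m sub_block m A a b"
      using A ab by (intro eq_matI) (auto simp: mult_split_less)
    thus "id_tensor r m n \<Phi> (c \<cdot>\<^sub>m A) $$ (a * n + i, b * n + j) =
        (c \<cdot>\<^sub>m id_tensor r m n \<Phi> A) $$ (a * n + i, b * n + j)"
      using ab
      by (simp add: id_tensor_index linear_superopD(3)[OF assms] mult_split_less
          carrier_matD[OF linear_superopD(1)[OF assms sub_block_carrier(1)]])
  qed auto
qed auto

lemma id_tensor_comp:
  assumes "linear_superop m n \<Phi>"
  shows "id_tensor r m p (\<lambda>X. \<Psi> (\<Phi> X)) X = id_tensor r n p \<Psi> (id_tensor r m n \<Phi> X)"
proof (rule block_eqI[of _ r p])
  fix a b i j assume "a < r" "b < r" "i < p" "j < p"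
  thus "id_tensor r m p (\<lambda>X. \<Psi> (\<Phi> X)) X $$ (a * p + i, b * p + j) =
     id_tensor r n p \<Psi> (id_tensor r m n \<Phi> X) $$ (a * p + i, b * p + j)"
    by (simp add: id_tensor_index sub_block_id_tensor[OF assms])
qed auto

text \<open>Carries the exponential series through the reference system: powers of the extended
  generator are computed block by block.\<close>

lemma sub_block_funpow_id_tensor:
  assumes "linear_superop n n \<Phi>" "a < r" "b < r"
  shows "sub_block n ((id_tensor r n n \<Phi> ^^ k) X) a b = (\<Phi> ^^ k) (sub_block n X a b)"
  by (induction k) (simp_all add: sub_block_id_tensor[OF assms])

lemma trace_blocks:
  assumes "X \<in> carrier_mat (r * m) (r * m)"
  shows "trace X = (\<Sum>a<r. trace (sub_block m X a a))"
  using assms by (simp add: trace_def sum_mult_split)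

lemma trace_id_tensor:
  assumes "linear_superop m n \<Phi>"
    and "\<forall>A\<in>carrier_mat m m. trace (\<Phi> A) = trace A" "X \<in> carrier_mat (r * m) (r * m)"
  shows "trace (id_tensor r m n \<Phi> X) = trace X"
  using assms(2)
  by (simp add: trace_blocks[OF assms(3)] trace_blocks[OF id_tensor_carrier(1)] sub_block_id_tensor[OF assms(1)])

lemma quantum_channel_comp:
  assumes "quantum_channel m n \<Phi>" "quantum_channel n p \<Psi>"
  shows "quantum_channel m p (\<lambda>X. \<Psi> (\<Phi> X))"
  using assms linear_superopD(1)[of m n \<Phi>]
  unfolding quantum_channel_def completely_positive_def
  by (auto simp: linear_superop_comp id_tensor_comp)

lemma jbound_id_tensor_channel:
  assumes "quantum_channel m n \<Phi>" "jbound (r * m) c X"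
  shows "jbound (r * n) c (id_tensor r m n \<Phi> X)"
proof -
  have lin: "linear_superop m n \<Phi>" and tp: "\<forall>A\<in>carrier_mat m m. trace (\<Phi> A) = trace A"
    and cp: "psd (r * m) X \<Longrightarrow> psd (r * n) (id_tensor r m n \<Phi> X)" for X
    using assms(1) by (auto simp: quantum_channel_def completely_positive_def)
  obtain P N where 1: "psd (r * m) P" "psd (r * m) N" "X = P - N" "Re (trace P) + Re (trace N) \<le> c"
    using assms(2) by (auto simp: jbound_def)
  note c = 1(1,2)[THEN psd_carrier]
  show ?thesis
    unfolding jbound_def
    using 1 cp c linear_superop_diff[OF linear_superop_id_tensor[OF lin] c] trace_id_tensor[OF lin tp]
    by (intro exI[of _ "id_tensor r m n \<Phi> P"] exI[of _ "id_tensor r m n \<Phi> N"]) auto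
qed

text \<open>Kraus operators are coefficient functions labelled by an arbitrary type, so that labels
  can be tuples and no matrices have to be assembled.\<close>

definition kraus ::
  "'a set \<Rightarrow> ('a \<Rightarrow> nat \<Rightarrow> nat \<Rightarrow> complex) \<Rightarrow> nat \<Rightarrow> nat \<Rightarrow> complex mat \<Rightarrow> complex mat" where
  "kraus A K m n \<tau> = mat n n
     (\<lambda>(i, k). \<Sum>a\<in>A. \<Sum>x<m. \<Sum>y<m. K a i x * \<tau> $$ (x, y) * cnj (K a k y))"

definition kraus_complete ::
  "'a set \<Rightarrow> ('a \<Rightarrow> nat \<Rightarrow> nat \<Rightarrow> complex) \<Rightarrow> nat \<Rightarrow> nat \<Rightarrow> bool" where
  "kraus_complete A K m n \<longleftrightarrow> (\<forall>x<m. \<forall>y<m.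
     (\<Sum>a\<in>A. \<Sum>i<n. cnj (K a i x) * K a i y) = (if x = y then 1 else 0))"

lemma kraus_carrier [simp]: "kraus A K m n \<tau> \<in> carrier_mat n n"
  "dim_row (kraus A K m n \<tau>) = n" "dim_col (kraus A K m n \<tau>) = n"
  by (simp_all add: kraus_def)

lemma kraus_index:
  "i < n \<Longrightarrow> k < n \<Longrightarrow> kraus A K m n \<tau> $$ (i, k) =
    (\<Sum>a\<in>A. \<Sum>x<m. \<Sum>y<m. K a i x * \<tau> $$ (x, y) * cnj (K a k y))"
  by (simp add: kraus_def)

lemma linear_superop_kraus: "linear_superop m n (kraus A K m n)"
  unfolding linear_superop_def
proof (intro conjI ballI allI)
  fix B C :: "complex mat" assume "B \<in> carrier_mat m m" "C \<in> carrier_mat m m"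
  thus "kraus A K m n (B + C) = kraus A K m n B + kraus A K m n C"
    by (intro eq_matI)
       (auto simp: kraus_index algebra_simps sum.distrib)
next
  fix c and B :: "complex mat" assume "B \<in> carrier_mat m m"
  thus "kraus A K m n (c \<cdot>\<^sub>m B) = c \<cdot>\<^sub>m kraus A K m n B"
    by (intro eq_matI)
       (auto simp: kraus_index sum_distrib_left mult_ac)
qed auto

lemma sum_sandwich:
  fixes X :: "nat \<Rightarrow> nat \<Rightarrow> complex"
  shows "(\<Sum>i<n. \<Sum>k<n'. p i * (\<Sum>x<m. \<Sum>y<m'. K i x * X x y * L k y) * q k) =
    (\<Sum>x<m. \<Sum>y<m'. (\<Sum>i<n. p i * K i x) * X x y * (\<Sum>k<n'. L k y * q k))"
proof -
  have "(\<Sum>i<n. \<Sum>k<n'. p i * (\<Sum>x<m. \<Sum>y<m'. K i x * X x y * L k y) * q k) =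
      (\<Sum>(i,k)\<in>{..<n} \<times> {..<n'}. \<Sum>(x,y)\<in>{..<m} \<times> {..<m'}. p i * K i x * X x y * (L k y * q k))"
    by (simp add: sum_distrib_left sum_distrib_right mult_ac flip: sum.cartesian_product)
  also have "\<dots> = (\<Sum>(x,y)\<in>{..<m} \<times> {..<m'}. \<Sum>(i,k)\<in>{..<n} \<times> {..<n'}. p i * K i x * X x y * (L k y * q k))"
    by (simp only: case_prod_unfold) (rule sum.swap)
  also have "\<dots> = (\<Sum>x<m. \<Sum>y<m'. \<Sum>i<n. \<Sum>k<n'. p i * K i x * X x y * (L k y * q k))"
    by (simp flip: sum.cartesian_product)
  also have "\<dots> = (\<Sum>x<m. \<Sum>y<m'. (\<Sum>i<n. p i * K i x) * X x y * (\<Sum>k<n'. L k y * q k))"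
    by (simp only: sum_distrib_left sum_distrib_right)
       (rule sum.cong[OF refl], rule sum.cong[OF refl], rule sum.swap)
  finally show ?thesis .
qed

lemma qform_blocks:
  "qform (r * n) A v = (\<Sum>b<r. \<Sum>b'<r. \<Sum>i<n. \<Sum>k<n.
     cnj (v (b * n + i)) * A $$ (b * n + i, b' * n + k) * v (b' * n + k))"
  unfolding qform_def sum_mult_split by (intro sum.cong[OF refl] sum.swap)

lemma completely_positive_kraus: "completely_positive m n (kraus A K m n)"
  unfolding completely_positive_def psd_iff
proof (intro allI impI conjI; (elim conjE)?)
  fix r X v assume X: "X \<in> carrier_mat (r * m) (r * m)" "\<forall>v. 0 \<le> qform (r * m) X v"
  \<comment> \<open>\<open>w a\<close> is \<open>(I \<otimes> K a\<^sup>\<dagger>) v\<close>; the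
    form of the image at \<open>v\<close> becomes the sum of the forms of \<open>X\<close> at these
    vectors.\<close>
  define w where "w a L = (\<Sum>k<n. cnj (K a k (L mod m)) * v ((L div m) * n + k))" for a L
  have "qform (r * n) (id_tensor r m n (kraus A K m n) X) v =
      (\<Sum>b<r. \<Sum>b'<r. \<Sum>i<n. \<Sum>k<n. \<Sum>a\<in>A. cnj (v (b * n + i)) *
        (\<Sum>x<m. \<Sum>y<m. K a i x * X $$ (b * m + x, b' * m + y) * cnj (K a k y)) * v (b' * n + k))"
    unfolding qform_blocks
    by (intro sum.cong[OF refl])
       (simp add: id_tensor_index kraus_index sum_distrib_left sum_distrib_right)
  also have "\<dots> = (\<Sum>a\<in>A. \<Sum>b<r. \<Sum>b'<r. \<Sum>i<n. \<Sum>k<n. cnj (v (b * n + i)) *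
        (\<Sum>x<m. \<Sum>y<m. K a i x * X $$ (b * m + x, b' * m + y) * cnj (K a k y)) * v (b' * n + k))"
    by (simp only: sum.swap[of _ A])
  also have "\<dots> = (\<Sum>a\<in>A. qform (r * m) X (w a))"
    unfolding qform_blocks sum_sandwich by (simp add: w_def mult.commute)
  also have "0 \<le> \<dots>" using X by (intro sum_nonneg) auto
  finally show "0 \<le> qform (r * n) (id_tensor r m n (kraus A K m n) X) v" .
qed auto

lemma trace_kraus:
  assumes "kraus_complete A K m n" "\<tau> \<in> carrier_mat m m"
  shows "trace (kraus A K m n \<tau>) = trace \<tau>"
proof -
  have "trace (kraus A K m n \<tau>) = (\<Sum>i<n. \<Sum>a\<in>A. \<Sum>x<m. \<Sum>y<m. K a i x * \<tau> $$ (x, y) * cnj (K a i y))"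
    by (simp add: trace_def kraus_index)
  also have "\<dots> = (\<Sum>i<n. \<Sum>a\<in>A. \<Sum>(x,y)\<in>{..<m} \<times> {..<m}. K a i x * \<tau> $$ (x, y) * cnj (K a i y))"
    by (simp flip: sum.cartesian_product)
  also have "\<dots> = (\<Sum>(x,y)\<in>{..<m} \<times> {..<m}. \<Sum>a\<in>A. \<Sum>i<n. K a i x * \<tau> $$ (x, y) * cnj (K a i y))"
    unfolding case_prod_unfold
    by (subst sum.swap, rule trans[OF sum.cong[OF refl sum.swap] sum.swap])
  also have "\<dots> = (\<Sum>x<m. \<Sum>y<m. \<tau> $$ (x, y) * (\<Sum>a\<in>A. \<Sum>i<n. cnj (K a i y) * K a i x))"
    by (simp add: sum_distrib_left mult_ac flip: sum.cartesian_product)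
  also have "\<dots> = (\<Sum>x<m. \<Sum>y<m. \<tau> $$ (x, y) * (if y = x then 1 else 0))"
    using assms(1) by (intro sum.cong) (auto simp: kraus_complete_def)
  also have "\<dots> = trace \<tau>" using assms(2) by (simp add: trace_def)
  finally show ?thesis .
qed

lemma quantum_channel_kraus:
  "kraus_complete A K m n \<Longrightarrow> quantum_channel m n (kraus A K m n)"
  by (simp add: quantum_channel_def linear_superop_kraus completely_positive_kraus trace_kraus)

text \<open>The operators \<open>K a \<otimes> I\<close> with the identity on a right factor of
  dimension \<open>e\<close>, which will hold the copies not yet consumed.\<close>

definition kraus_ampl :: "nat \<Rightarrow> ('a \<Rightarrow> nat \<Rightarrow> nat \<Rightarrow> complex) \<Rightarrow> 'a \<Rightarrow> nat \<Rightarrow> nat \<Rightarrow> complex" where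
  "kraus_ampl e K a i x = K a (i div e) (x div e) * (if i mod e = x mod e then 1 else 0)"

lemma kraus_complete_ampl:
  assumes "kraus_complete A K m n"
  shows "kraus_complete A (kraus_ampl e K) (m * e) (n * e)"
  unfolding kraus_complete_def
proof (intro allI impI)
  fix x y assume xy: "x < m * e" "y < m * e"
  note b = xy[THEN div_mod_less]
  have "(\<Sum>a\<in>A. \<Sum>i<n * e. cnj (kraus_ampl e K a i x) * kraus_ampl e K a i y) =
    (\<Sum>a\<in>A. \<Sum>i<n. \<Sum>k<e. (if k = x mod e then 1 else 0) *
       ((if k = y mod e then 1 else 0) * (cnj (K a i (x div e)) * K a i (y div e))))"
    unfolding sum_mult_split by (intro sum.cong[OF refl]) (simp add: kraus_ampl_def)
  also have "\<dots> = (if x mod e = y mod e then 1 else 0) *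
      (\<Sum>a\<in>A. \<Sum>i<n. cnj (K a i (x div e)) * K a i (y div e))"
    using b by simp
  also have "\<dots> = (if x = y then 1 else 0)"
  proof -
    have "x = y \<longleftrightarrow> x div e = y div e \<and> x mod e = y mod e" by (metis div_mult_mod_eq)
    thus ?thesis using assms b by (auto simp: kraus_complete_def)
  qed
  finally show "(\<Sum>a\<in>A. \<Sum>i<n * e. cnj (kraus_ampl e K a i x) * kraus_ampl e K a i y) =
    (if x = y then 1 else 0)" .
qed

section \<open>Tensor products of matrices\<close>

lemma kron_carrier [simp]:
  "A \<in> carrier_mat m n \<Longrightarrow> B \<in> carrier_mat p q \<Longrightarrow> kron A B \<in> carrier_mat (m * p) (n * q)"
  by (simp add: kron_def)

lemma kron_index:
  "A \<in> carrier_mat m n \<Longrightarrow> B \<in> carrier_mat p q \<Longrightarrow> i < m \<Longrightarrow> j < n \<Longrightarrow> k < p \<Longrightarrow> l < q \<Longrightarrow>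
    kron A B $$ (i * p + k, j * q + l) = A $$ (i, j) * B $$ (k, l)"
  by (simp add: kron_def mult_split_less)

lemma kraus_ampl_kron:
  assumes "\<tau> \<in> carrier_mat m m" "\<omega> \<in> carrier_mat e e"
  shows "kraus A (kraus_ampl e K) (m * e) (n * e) (kron \<tau> \<omega>) = kron (kraus A K m n \<tau>) \<omega>"
proof (rule block_eqI[of _ n e])
  fix i k u w assume ik: "i < n" "k < n" "u < e" "w < e"
  have "kraus A (kraus_ampl e K) (m * e) (n * e) (kron \<tau> \<omega>) $$ (i * e + u, k * e + w) =
    (\<Sum>a\<in>A. \<Sum>x<m. \<Sum>u'<e. \<Sum>y<m. \<Sum>w'<e. (if u = u' then 1 else 0) * ((if w = w' then 1 else 0) *
      (K a i x * \<tau> $$ (x, y) * \<omega> $$ (u', w') * cnj (K a k y))))"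
    using ik assms unfolding sum_mult_split
    by (subst kraus_index)
       (auto simp: mult_split_less sum_mult_split kraus_ampl_def kron_index intro!: sum.cong)
  also have "\<dots> = (\<Sum>a\<in>A. \<Sum>x<m. \<Sum>y<m. K a i x * \<tau> $$ (x, y) * \<omega> $$ (u, w) * cnj (K a k y))"
    using ik by (simp flip: sum_distrib_left)
  also have "\<dots> = kron (kraus A K m n \<tau>) \<omega> $$ (i * e + u, k * e + w)"
    unfolding kron_index[OF kraus_carrier(1) assms(2) ik] kraus_index[OF ik(1,2)] sum_distrib_right
    by (simp add: mult_ac)
  finally show "kraus A (kraus_ampl e K) (m * e) (n * e) (kron \<tau> \<omega>) $$ (i * e + u, k * e + w) =
    kron (kraus A K m n \<tau>) \<omega> $$ (i * e + u, k * e + w)" .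
qed (use assms in auto)

lemma kron_assoc:
  assumes "A \<in> carrier_mat a a" "B \<in> carrier_mat b b" "C \<in> carrier_mat c c"
  shows "kron A (kron B C) = kron (kron A B) C"
proof (rule eq_matI)
  fix i j assume "i < dim_row (kron (kron A B) C)" "j < dim_col (kron (kron A B) C)"
  hence ij: "i < a * b * c" "j < a * b * c" using assms by (auto simp: kron_def)
  hence pos: "0 < b" "0 < c" by (auto intro: gr0I)
  have lt: "i mod (b * c) < b * c" "j mod (b * c) < b * c" "i div c < a * b" "j div c < a * b"
    using pos ij by (auto simp: div_less_iff_less_mult)
  have m: "x mod (b * c) = c * (x div c mod b) + x mod c" for x
    using mod_mult2_eq[of x c b] by (simp add: mult.commute)
  have d: "x div (b * c) = x div c div b" for x
    using div_mult2_eq[of x c b] by (simp add: mult.commute)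
  show "kron A (kron B C) $$ (i, j) = kron (kron A B) C $$ (i, j)"
    using ij lt assms pos by (simp add: kron_def m d mult.assoc)
qed (use assms in \<open>auto simp: kron_def\<close>)

section \<open>Trace-norm bounds uniform in the reference system\<close>

lemma qform_hermitian_real:
  assumes "hermitian n A"
  shows "Im (qform n A v) = 0"
proof -
  have "cnj (qform n A v) = (\<Sum>i<n. \<Sum>j<n. cnj (v j) * A $$ (j, i) * v i)"
    unfolding qform_def by (simp add: hermitianD(2)[OF assms] mult_ac)
  also have "\<dots> = qform n A v" unfolding qform_def by (rule sum.swap)
  finally show ?thesis by (simp add: complex_eq_iff)
qed

text \<open>Cauchy-Schwarz weakened by the inequality of geometric and arithmetic means, from
  positivity at \<open>f + b * g\<close> for a suitable phase \<open>b\<close>. The additive form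
  can be summed directly over indices.\<close>

lemma psd_sesquilinear_bound:
  assumes "psd n A"
  shows "cmod (\<Sum>i<n. \<Sum>j<n. cnj (f i) * A $$ (i, j) * g j)
    \<le> (Re (qform n A f) + Re (qform n A g)) / 2"
proof -
  define s where "s f g = (\<Sum>i<n. \<Sum>j<n. cnj (f i) * A $$ (i, j) * g j)" for f g :: "nat \<Rightarrow> complex"
  have sc: "s g f = cnj (s f g)"
  proof -
    have "cnj (s f g) = (\<Sum>i<n. \<Sum>j<n. cnj (g j) * A $$ (j, i) * f i)"
      unfolding s_def by (simp add: hermitianD(2)[OF psd_hermitian[OF assms]] mult_ac)
    also have "\<dots> = s g f" unfolding s_def by (rule sum.swap)
    finally show ?thesis by simp
  qed
  define b where "b = - cnj (sgn (s f g))"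
  have "qform n A (\<lambda>i. f i + b * g i) = s f f + b * s f g + cnj b * s g f + cnj b * b * s g g"
    by (simp add: qform_def s_def algebra_simps sum.distrib sum_distrib_left)
  moreover have "b * s f g = - complex_of_real (cmod (s f g))"
    using cmod_cnj_sgn[of "s f g"] by (simp add: b_def)
  moreover from this have "cnj b * s g f = - complex_of_real (cmod (s f g))"
    unfolding sc by (metis complex_cnj_mult complex_cnj_minus complex_cnj_complex_of_real)
  ultimately have "0 \<le> s f f + - complex_of_real (cmod (s f g)) + - complex_of_real (cmod (s f g)) + cnj b * b * s g g"
    using assms unfolding psd_iff by metis
  hence *: "2 * cmod (s f g) \<le> Re (s f f) + Re (cnj b * b * s g g)"
    by (simp add: less_eq_complex_def)
  have gg: "0 \<le> s g g" "qform n A g = s g g" "qform n A f = s f f"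
    using assms by (auto simp: psd_iff qform_def s_def)
  have "cnj b * b = complex_of_real ((cmod b)\<^sup>2)"
    by (metis complex_norm_square mult.commute of_real_power)
  \<comment> \<open>An inequality, because \<open>sgn 0 = 0\<close> makes \<open>b\<close> vanish
    together with the cross term.\<close>
  moreover have "(cmod b)\<^sup>2 \<le> 1" by (simp add: b_def norm_sgn)
  ultimately have "Re (cnj b * b * s g g) \<le> Re (s g g)"
    using gg(1) mult_right_mono[of "(cmod b)\<^sup>2" 1 "Re (s g g)"]
    by (simp add: less_eq_complex_def)
  thus ?thesis using * gg by (simp add: s_def)
qed

text \<open>
  Writing \<open>\<Psi>(\<rho>) = \<Sum> c(i,j,k,l) |i\<rangle>\<langle>j| \<rho> |k\<rangle>\<langle>l|\<close>, Cauchy-Schwarz for the form given by \<open>X\<close> dominates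
  \<open>\<plusminus>(\<I> \<otimes> \<Psi>)(X)\<close> by a multiple of \<open>Tr\<^sub>S X \<otimes> I\<close>, uniformly in the dimension of the reference system.
\<close>

lemma id_tensor_domination:
  assumes lin: "linear_superop d d \<Psi>"
    and a: "\<And>A i j. A \<in> carrier_mat d d \<Longrightarrow> \<forall>i<d. \<forall>j<d. cmod (A $$ (i, j)) \<le> 1 \<Longrightarrow>
      i < d \<Longrightarrow> j < d \<Longrightarrow> cmod (\<Psi> A $$ (i, j)) \<le> a"
    and X: "psd (r * d) X"
  defines "Q \<equiv> id_tensor r d d (\<lambda>\<rho>. complex_of_real (a * d\<^sup>2) * trace \<rho> \<cdot>\<^sub>m 1\<^sub>m d) X"
  shows "cmod (qform (r * d) (id_tensor r d d \<Psi> X) v) \<le> Re (qform (r * d) Q v)"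
proof -
  \<comment> \<open>The coefficient of \<open>|i><l|\<close> in the image of
    \<open>|j><k|\<close>.\<close>
  define c where "c j k i l = \<Psi> (mat d d (\<lambda>p. if p = (j, k) then 1 else 0)) $$ (i, l)" for i j k l
  have ca: "cmod (c j k i l) \<le> a" if "i < d" "l < d" for i j k l
    unfolding c_def using that by (intro a) auto
  \<comment> \<open>\<open>f i j\<close> is \<open>(I \<otimes> |j><i|) v\<close>. The sums over the
    reference system are absorbed into \<open>S i j l k\<close>, the form of \<open>X\<close>
    between \<open>f i j\<close> and \<open>f l k\<close>; hence the bound does not see
    \<open>r\<close>.\<close>
  define f where "f i j L = (if L mod d = j then v ((L div d) * d + i) else 0)" for i j L
  define S where "S i j l k = (\<Sum>b<r. \<Sum>b'<r.
      cnj (v (b * d + i)) * X $$ (b * d + j, b' * d + k) * v (b' * d + l))" for i j k l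
  have S: "S i j l k = (\<Sum>I<r * d. \<Sum>J<r * d. cnj (f i j I) * X $$ (I, J) * f l k J)"
    if "j < d" "k < d" for i j k l
  proof -
    have "(\<Sum>I<r * d. \<Sum>J<r * d. cnj (f i j I) * X $$ (I, J) * f l k J) =
      (\<Sum>b<r. \<Sum>j'<d. (if j' = j then 1 else 0) * (\<Sum>b'<r. \<Sum>k'<d. (if k' = k then 1 else 0) *
        (cnj (v (b * d + i)) * X $$ (b * d + j', b' * d + k') * v (b' * d + l))))"
      unfolding sum_mult_split sum_distrib_left
      by (intro sum.cong[OF refl]) (simp add: f_def)
    also have "\<dots> = S i j l k" using that by (simp add: S_def)
    finally show ?thesis ..
  qed
  define h where "h i j = Re (qform (r * d) X (f i j))" for i j
  have Sb: "cmod (S i j l k) \<le> (h i j + h l k) / 2" if "j < d" "k < d" for i j k l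
    unfolding S[OF that] h_def by (rule psd_sesquilinear_bound[OF X])
  have Sh: "S i j i j = qform (r * d) X (f i j)" if "j < d" for i j
    unfolding S[OF that that] qform_def ..
  have "qform (r * d) (id_tensor r d d \<Psi> X) v = (\<Sum>b<r. \<Sum>b'<r. \<Sum>i<d. \<Sum>l<d. \<Sum>j<d. \<Sum>k<d.
      c j k i l * (cnj (v (b * d + i)) * X $$ (b * d + j, b' * d + k) * v (b' * d + l)))"
    unfolding qform_blocks
    by (intro sum.cong[OF refl])
       (simp add: id_tensor_index linear_superop_matrix_units[OF lin sub_block_carrier(1)] c_def
         sum_distrib_left sum_distrib_right mult_ac)
  also have "\<dots> = (\<Sum>i<d. \<Sum>l<d. \<Sum>j<d. \<Sum>k<d. c j k i l * S i j l k)"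
    unfolding S_def sum_distrib_left
    by (subst sum.swap[of _ "{..<d}" "{..<r}"])+ (rule refl)
  also have "cmod \<dots> \<le> (\<Sum>i<d. \<Sum>l<d. \<Sum>j<d. \<Sum>k<d. a * ((h i j + h l k) / 2))"
  proof -
    have "cmod (c j k i l * S i j l k) \<le> a * ((h i j + h l k) / 2)"
      if "i \<in> {..<d}" "l \<in> {..<d}" "j \<in> {..<d}" "k \<in> {..<d}" for i j k l
      unfolding norm_mult using that
      by (intro mult_mono ca Sb order.trans[OF norm_ge_zero ca[of i l j k]]) auto
    thus ?thesis by (intro order.trans[OF norm_sum] sum_mono)
  qed
  \<comment> \<open>Each half of the summand depends on two of the four indices; the other two give
    the factor \<open>d\<^sup>2\<close>.\<close>
  also have "\<dots> = a * d\<^sup>2 * (\<Sum>i<d. \<Sum>j<d. h i j)"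
    by (simp add: sum.distrib sum_distrib_left[symmetric] sum_divide_distrib[symmetric]
        power2_eq_square field_simps)
  \<comment> \<open>The form of \<open>Tr\<^sub>S X \<otimes> I\<close> at \<open>v\<close> is the
    sum of all \<open>h i j\<close>, and \<open>Q\<close> is \<open>a * d\<^sup>2\<close> times that
    matrix.\<close>
  also have "\<dots> = Re (qform (r * d) Q v)"
  proof -
    have "qform (r * d) Q v = (\<Sum>b<r. \<Sum>b'<r. \<Sum>i<d. \<Sum>l<d. (if i = l then 1 else 0) *
       (\<Sum>j<d. complex_of_real (a * d\<^sup>2) * (cnj (v (b * d + i)) * X $$ (b * d + j, b' * d + j) * v (b' * d + l))))"
      unfolding qform_blocks Q_def
      by (intro sum.cong[OF refl])
         (simp add: id_tensor_index trace_def
           sum_distrib_left sum_distrib_right mult_ac)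
    also have "\<dots> = (\<Sum>b<r. \<Sum>b'<r. \<Sum>i<d. \<Sum>j<d. complex_of_real (a * d\<^sup>2) *
        (cnj (v (b * d + i)) * X $$ (b * d + j, b' * d + j) * v (b' * d + i)))"
      by simp
    also have "\<dots> = complex_of_real (a * d\<^sup>2) * (\<Sum>i<d. \<Sum>j<d. S i j i j)"
      unfolding S_def sum_distrib_left
      by (subst sum.swap[of _ "{..<d}" "{..<r}"])+ (rule refl)
    finally show ?thesis by (simp add: Sh h_def)
  qed
  finally show ?thesis .
qed

lemma jbound_diff: "jbound n a X \<Longrightarrow> jbound n b Y \<Longrightarrow> jbound n (a + b) (X - Y)"
  using jbound_add[OF _ jbound_uminus, of n a X b Y] jbound_carrier[of n a X] jbound_carrier[of n b Y]
  by (simp add: minus_add_uminus_mat)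

lemma jbound_eq_mono: "X = Y \<Longrightarrow> jbound n c Y \<Longrightarrow> c \<le> c' \<Longrightarrow> jbound n c' X"
  using jbound_mono by blast

lemma jbound_zero: "jbound n 0 (0\<^sub>m n n)"
  using jbound_psd[OF psd_zero[of n]] by (simp add: trace_def)

lemma hermitian_id_tensor:
  assumes lin: "linear_superop d d \<Psi>"
    and adj: "\<And>A. A \<in> carrier_mat d d \<Longrightarrow> \<Psi> (mat_adjoint A) = mat_adjoint (\<Psi> A)"
    and X: "hermitian (r * d) X"
  shows "hermitian (r * d) (id_tensor r d d \<Psi> X)"
  unfolding hermitian_def
proof (intro conjI allI impI)
  fix I J assume "I < r * d" "J < r * d"
  note b = this[THEN div_mod_less]
  obtain a i a' j where ij: "I = a * d + i" "J = a' * d + j" "a < r" "a' < r" "i < d" "j < d"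
    using b by (metis div_mult_mod_eq)
  have "mat_adjoint (sub_block d X a a') = sub_block d X a' a"
    using hermitianD(2)[OF X] ij by (intro eq_matI) (auto simp: mult_split_less)
  hence "\<Psi> (sub_block d X a' a) = mat_adjoint (\<Psi> (sub_block d X a a'))"
    using adj[of "sub_block d X a a'"] by simp
  thus "cnj (id_tensor r d d \<Psi> X $$ (I, J)) = id_tensor r d d \<Psi> X $$ (J, I)"
    using ij carrier_matD[OF linear_superopD(1)[OF lin sub_block_carrier(1)]]
    by (simp add: id_tensor_index)
qed simp

text \<open>The image \<open>Y\<close> is split as \<open>(Q + Y) - Q\<close>, where both parts are
  positive by domination. As \<open>Tr Y \<le> Tr Q\<close>, their traces add up to at most three
  times \<open>Tr Q = a * d\<^sup>2 * d * Tr X\<close>, the last \<open>d\<close> being the trace of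
  the identity on the system.\<close>

lemma jbound_id_tensor_psd:
  assumes lin: "linear_superop d d \<Psi>"
    and adj: "\<And>A. A \<in> carrier_mat d d \<Longrightarrow> \<Psi> (mat_adjoint A) = mat_adjoint (\<Psi> A)"
    and a: "\<And>A i j. A \<in> carrier_mat d d \<Longrightarrow> \<forall>i<d. \<forall>j<d. cmod (A $$ (i, j)) \<le> 1 \<Longrightarrow>
      i < d \<Longrightarrow> j < d \<Longrightarrow> cmod (\<Psi> A $$ (i, j)) \<le> a"
    and X: "psd (r * d) X"
  shows "jbound (r * d) (3 * (a * d ^ 3) * Re (trace X)) (id_tensor r d d \<Psi> X)"
proof -
  define T where "T \<rho> = complex_of_real (a * d\<^sup>2) * trace \<rho> \<cdot>\<^sub>m 1\<^sub>m d" for \<rho> :: "complex mat"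
  define Q where "Q = id_tensor r d d T X"
  define Y where "Y = id_tensor r d d \<Psi> X"
  have linT: "linear_superop d d T"
    unfolding linear_superop_def T_def
    by (auto simp: trace_add trace_smult distrib_left intro!: eq_matI)
  have adjT: "T (mat_adjoint A) = mat_adjoint (T A)" if "A \<in> carrier_mat d d" for A
    using that by (intro eq_matI) (auto simp: T_def trace_def)
  note hX = psd_hermitian[OF X]
  have hQ: "hermitian (r * d) Q" and hY: "hermitian (r * d) Y"
    unfolding Q_def Y_def by (intro hermitian_id_tensor lin linT adj adjT hX; assumption)+
  have dom: "cmod (qform (r * d) Y v) \<le> Re (qform (r * d) Q v)" for v
    unfolding Q_def Y_def T_def by (rule id_tensor_domination[OF lin a X])
  have c: "Q \<in> carrier_mat (r * d) (r * d)" "Y \<in> carrier_mat (r * d) (r * d)"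
    by (auto simp: Q_def Y_def)
  have "0 \<le> Re (qform (r * d) Q v)" "0 \<le> Re (qform (r * d) Q v) + Re (qform (r * d) Y v)" for v
    using dom[of v] abs_Re_le_cmod[of "qform (r * d) Y v"] norm_ge_zero[of "qform (r * d) Y v"]
    by linarith+
  hence psd: "psd (r * d) Q" "psd (r * d) (Q + Y)"
    using c qform_hermitian_real[OF hQ] qform_hermitian_real[OF hY]
    by (auto simp: psd_iff qform_add less_eq_complex_def)
  have "Re (Y $$ (I, I)) \<le> Re (Q $$ (I, I))" if "I < r * d" for I
    using dom[of "\<lambda>l. if l = I then 1 else 0"] complex_Re_le_cmod[of "Y $$ (I, I)"] that
    by (simp add: qform_unit)
  hence tY: "Re (trace Y) \<le> Re (trace Q)"
    using c by (auto simp: trace_def intro!: sum_mono)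
  have "trace Q = (\<Sum>b<r. complex_of_real (a * d\<^sup>2) * trace (sub_block d X b b) * d)"
    using trace_blocks[of Q r d] c
    by (simp add: Q_def sub_block_id_tensor[OF linT]) (simp add: T_def trace_smult[of _ d] trace_def[of "1\<^sub>m d"])
  also have "\<dots> = complex_of_real (a * d ^ 3) * trace X"
    by (simp add: trace_blocks[OF psd_carrier[OF X]] sum_distrib_left power2_eq_square power3_eq_cube mult_ac)
  finally have tQ: "Re (trace Q) = a * d ^ 3 * Re (trace X)" by simp
  have "Y = (Q + Y) - Q" using c by (intro eq_matI) auto
  moreover have "Re (trace (Q + Y)) + Re (trace Q) \<le> 3 * (a * d ^ 3) * Re (trace X)"
    unfolding trace_add[OF c] plus_complex.sel using tY tQ by linarith
  ultimately show ?thesis using psd unfolding jbound_def Y_def[symmetric] by blast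
qed

lemma jbound_id_tensor_bounded:
  assumes lin: "linear_superop d d \<Psi>"
    and adj: "\<And>A. A \<in> carrier_mat d d \<Longrightarrow> \<Psi> (mat_adjoint A) = mat_adjoint (\<Psi> A)"
    and a: "\<And>A i j. A \<in> carrier_mat d d \<Longrightarrow> \<forall>i<d. \<forall>j<d. cmod (A $$ (i, j)) \<le> 1 \<Longrightarrow>
      i < d \<Longrightarrow> j < d \<Longrightarrow> cmod (\<Psi> A $$ (i, j)) \<le> a"
    and a0: "0 \<le> a" and X: "jbound (r * d) x X"
  shows "jbound (r * d) (3 * (a * d ^ 3) * x) (id_tensor r d d \<Psi> X)"
proof -
  obtain P N where 1: "psd (r * d) P" "psd (r * d) N" "X = P - N" "Re (trace P) + Re (trace N) \<le> x"
    using X by (auto simp: jbound_def)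
  note c = 1(1,2)[THEN psd_carrier]
  have "id_tensor r d d \<Psi> X = id_tensor r d d \<Psi> P - id_tensor r d d \<Psi> N"
    unfolding 1(3) by (rule linear_superop_diff[OF linear_superop_id_tensor[OF lin] c])
  moreover have "jbound (r * d) (3 * (a * d ^ 3) * Re (trace P) + 3 * (a * d ^ 3) * Re (trace N))
      (id_tensor r d d \<Psi> P - id_tensor r d d \<Psi> N)"
    by (intro jbound_diff jbound_id_tensor_psd lin adj a 1(1,2)) assumption+
  moreover have "3 * (a * d ^ 3) * Re (trace P) + 3 * (a * d ^ 3) * Re (trace N) \<le> 3 * (a * d ^ 3) * x"
    unfolding distrib_left[symmetric] using 1(4) a0 by (intro mult_left_mono) auto
  ultimately show ?thesis by (rule jbound_eq_mono)
qed

section \<open>Products of approximate steps\<close>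

lemma diff_add_diff_mat:
  fixes A :: "'a :: ab_group_add mat"
  assumes "A \<in> carrier_mat n m" "B \<in> carrier_mat n m" "C \<in> carrier_mat n m"
  shows "A - C = (A - B) + (B - C)"
  using assms by (intro eq_matI) auto

text \<open>\<open>A^(n+1) - B^(n+1) = A (A^n - B^n) + (A - B) B^n\<close>. Errors already made are
  propagated by the contraction \<open>A\<close> only, so \<open>B\<close> may expand by
  \<open>g\<close>. It serves with \<open>g = 1\<close> for two contractions and with
  \<open>g = 1 + K * s\<close> for Euler steps.\<close>

lemma jbound_telescope:
  assumes lin: "linear_superop N N A"
    and A: "\<And>x X. jbound N x X \<Longrightarrow> jbound N x (A X)"
    and B: "\<And>x X. jbound N x X \<Longrightarrow> jbound N (g * x) (B X)"
    and AB: "\<And>x X. jbound N x X \<Longrightarrow> jbound N (\<eta> * x) (A X - B X)"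
    and g: "1 \<le> g" and \<eta>: "0 \<le> \<eta>" and X: "jbound N x X"
  shows "jbound N (n * \<eta> * g ^ n * x) ((A ^^ n) X - (B ^^ n) X)"
proof (induction n)
  case 0
  thus ?case using jbound_zero[of N] jbound_carrier[OF X] by simp
next
  case (Suc n)
  have Bn: "jbound N (g ^ n * x) ((B ^^ n) X)" for n
  proof (induction n)
    case (Suc n)
    from B[OF this] show ?case by (simp add: mult.assoc)
  qed (use X in simp)
  have An: "(A ^^ n) X \<in> carrier_mat N N"
    using linear_superopD(1)[OF linear_superop_funpow[OF lin]] jbound_carrier[OF X] by blast
  note Bc = jbound_carrier[OF Bn]
  have "(A ^^ Suc n) X - (B ^^ Suc n) X =
      A ((A ^^ n) X - (B ^^ n) X) + (A ((B ^^ n) X) - B ((B ^^ n) X))"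
    unfolding linear_superop_diff[OF lin An Bc] funpow.simps o_apply
    using Bc[of "Suc n"]
    by (intro diff_add_diff_mat[of _ N N] linear_superopD(1)[OF lin] An Bc) simp
  moreover have "jbound N (n * \<eta> * g ^ n * x + \<eta> * (g ^ n * x))
      (A ((A ^^ n) X - (B ^^ n) X) + (A ((B ^^ n) X) - B ((B ^^ n) X)))"
    by (intro jbound_add A AB Suc.IH Bn)
  moreover have "n * \<eta> * g ^ n * x + \<eta> * (g ^ n * x) \<le> Suc n * \<eta> * g ^ Suc n * x"
  proof -
    have "(Suc n * \<eta> * x * g ^ n) * 1 \<le> (Suc n * \<eta> * x * g ^ n) * g"
      using g \<eta> jbound_nonneg[OF X] by (intro mult_left_mono) auto
    thus ?thesis by (simp add: algebra_simps)
  qed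
  ultimately show ?case by (rule jbound_eq_mono)
qed

text \<open>Pascal's rule in the shape of one more Euler step, where \<open>a k\<close> is an entry
  of the \<open>k\<close>-th power of the generator.\<close>

lemma binomial_step:
  fixes a :: "nat \<Rightarrow> complex" and s :: complex
  shows "(\<Sum>k\<le>n. (n choose k) * s ^ k * a k) + s * (\<Sum>k\<le>n. (n choose k) * s ^ k * a (Suc k)) =
    (\<Sum>k\<le>Suc n. (Suc n choose k) * s ^ k * a k)"
proof -
  have "(\<Sum>k\<le>Suc n. (Suc n choose k) * s ^ k * a k) =
      a 0 + (\<Sum>k\<le>n. (n choose Suc k) * s ^ Suc k * a (Suc k)) +
      (\<Sum>k\<le>n. (n choose k) * s ^ Suc k * a (Suc k))"
    by (simp add: sum.atMost_Suc_shift algebra_simps sum.distrib del: sum.atMost_Suc)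
  also have "a 0 + (\<Sum>k\<le>n. (n choose Suc k) * s ^ Suc k * a (Suc k)) =
      (\<Sum>k\<le>Suc n. (n choose k) * s ^ k * a k)"
    by (simp add: sum.atMost_Suc_shift del: sum.atMost_Suc)
  finally show ?thesis by (simp add: sum_distrib_left mult_ac)
qed

text \<open>
  As \<open>(n choose k) / n^k \<le> 1 / k!\<close>, the error is at most the same expression with \<open>a k\<close> replaced by
  \<open>B * K ^ k\<close>, namely \<open>B * (exp (t * K) - (1 + t * K / n) ^ n)\<close>.
\<close>

lemma binomial_exp_limit:
  fixes a :: "nat \<Rightarrow> complex"
  assumes a: "\<And>k. cmod (a k) \<le> B * K ^ k" and t: "0 \<le> t" and K: "0 \<le> K"
  shows "(\<lambda>n. \<Sum>k\<le>n. (n choose k) * complex_of_real (t / n) ^ k * a k) \<longlonglongrightarrow>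
    (\<Sum>k. a k * complex_of_real (t ^ k / fact k))"
proof -
  have B: "0 \<le> B" using order.trans[OF norm_ge_zero a[of 0]] by simp
  \<comment> \<open>These weights vanish for \<open>k > n\<close>, so the finite sums are series as
    well and can be compared termwise with the exponential.\<close>
  define w where "w n k = (n choose k) / real n ^ k" for n k
  have w: "0 \<le> w n k" "w n k \<le> 1 / fact k" if "0 < n" for n k
  proof -
    have "real ((n choose k) * fact k) \<le> real (n ^ k)"
      using binomial_fact_pow[of n k] of_nat_le_iff by blast
    thus "w n k \<le> 1 / fact k" using that by (simp add: w_def field_simps)
  qed (simp add: w_def)
  define S where "S = (\<Sum>k. a k * complex_of_real (t ^ k / fact k))"
  have ex: "(\<lambda>k. B * ((t * K) ^ k / fact k)) sums (B * exp (t * K))"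
    using exp_converges[of "t * K"] by (intro sums_mult) (simp add: scaleR_conv_of_real field_simps)
  have nb: "cmod (a k * complex_of_real (t ^ k / fact k)) \<le> B * ((t * K) ^ k / fact k)" for k
  proof -
    have "cmod (a k * complex_of_real (t ^ k / fact k)) = cmod (a k) * (t ^ k / fact k)"
      using t by (simp add: norm_mult norm_divide norm_power)
    also have "\<dots> \<le> B * K ^ k * (t ^ k / fact k)" using t a by (intro mult_right_mono) auto
    finally show ?thesis by (simp add: power_mult_distrib mult_ac)
  qed
  have S: "(\<lambda>k. a k * complex_of_real (t ^ k / fact k)) sums S"
    unfolding S_def by (intro summable_sums summable_comparison_test'[OF sums_summable[OF ex]] nb)
  have main: "cmod (S - (\<Sum>k\<le>n. (n choose k) * complex_of_real (t / n) ^ k * a k)) \<le>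
      B * exp (t * K) - B * (1 + t * K / n) ^ n" if n: "0 < n" for n
  proof -
    have "(\<lambda>k. w n k * complex_of_real (t ^ k) * a k) sums (\<Sum>k\<le>n. w n k * complex_of_real (t ^ k) * a k)"
      by (rule sums_finite) (auto simp: w_def binomial_eq_0)
    also have "(\<Sum>k\<le>n. w n k * complex_of_real (t ^ k) * a k) =
        (\<Sum>k\<le>n. (n choose k) * complex_of_real (t / n) ^ k * a k)"
      by (simp add: w_def power_divide)
    finally have s1: "(\<lambda>k. a k * complex_of_real (t ^ k / fact k) - w n k * complex_of_real (t ^ k) * a k)
      sums (S - (\<Sum>k\<le>n. (n choose k) * complex_of_real (t / n) ^ k * a k))"
      using S by (intro sums_diff)
    have "(\<lambda>k. B * (w n k * (t * K) ^ k)) sums (\<Sum>k\<le>n. B * (w n k * (t * K) ^ k))"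
      by (rule sums_finite) (auto simp: w_def binomial_eq_0)
    also have "(\<Sum>k\<le>n. B * (w n k * (t * K) ^ k)) = B * (1 + t * K / n) ^ n"
      unfolding add.commute[of 1] binomial_ring by (simp add: w_def power_divide sum_distrib_left)
    finally have s2: "(\<lambda>k. B * ((t * K) ^ k / fact k) - B * (w n k * (t * K) ^ k))
      sums (B * exp (t * K) - B * (1 + t * K / n) ^ n)"
      using ex by (intro sums_diff)
    have "cmod (a k * complex_of_real (t ^ k / fact k) - w n k * complex_of_real (t ^ k) * a k) \<le>
        B * ((t * K) ^ k / fact k) - B * (w n k * (t * K) ^ k)" for k
    proof -
      have "a k * complex_of_real (t ^ k / fact k) - w n k * complex_of_real (t ^ k) * a k =
          complex_of_real ((1 / fact k - w n k) * t ^ k) * a k" by (simp add: algebra_simps)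
      also have "cmod \<dots> = (1 / fact k - w n k) * t ^ k * cmod (a k)"
        unfolding norm_mult norm_of_real using w[OF n] t by simp
      also have "\<dots> \<le> (1 / fact k - w n k) * t ^ k * (B * K ^ k)"
        using w[OF n, of k] t a by (intro mult_left_mono) auto
      finally show ?thesis by (simp add: algebra_simps power_mult_distrib)
    qed
    from norm_suminf_le[OF this sums_summable[OF s2]] show ?thesis
      by (simp only: sums_unique[OF s1, symmetric] sums_unique[OF s2, symmetric])
  qed
  have "(\<lambda>n. B * exp (t * K) - B * (1 + t * K / n) ^ n) \<longlonglongrightarrow> B * exp (t * K) - B * exp (t * K)"
    by (intro tendsto_intros tendsto_exp_limit_sequentially)
  hence "(\<lambda>n. S - (\<Sum>k\<le>n. (n choose k) * complex_of_real (t / n) ^ k * a k)) \<longlonglongrightarrow> 0"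
    unfolding diff_self
    by (rule tendsto_0_le[where K = 1], intro eventually_sequentiallyI[of 1])
       (rule order.trans[OF main], auto)
  from tendsto_diff[OF tendsto_const[of S] this] show ?thesis by (simp add: S_def)
qed

text \<open>\<open>N\<close> is a dimension that includes the reference system, while
  \<open>K\<close>, \<open>c\<close> and \<open>s0\<close> will be independent of it.
  \<open>s0 \<le> 1\<close> allows cubic terms to be absorbed into quadratic ones.\<close>

locale first_order_approximation =
  fixes N :: nat and S :: "real \<Rightarrow> complex mat \<Rightarrow> complex mat" and G :: "complex mat \<Rightarrow> complex mat"
    and K c s0 :: real
  assumes K: "0 \<le> K" and c: "0 \<le> c" and s0: "s0 \<le> 1"
    and linS: "0 \<le> s \<Longrightarrow> s \<le> s0 \<Longrightarrow> linear_superop N N (S s)"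
    and linG: "linear_superop N N G"
    and S_jb: "0 \<le> s \<Longrightarrow> s \<le> s0 \<Longrightarrow> jbound N x X \<Longrightarrow> jbound N x (S s X)"
    and G_jb: "jbound N x X \<Longrightarrow> jbound N (K * x) (G X)"
    and R_jb: "0 \<le> s \<Longrightarrow> s \<le> s0 \<Longrightarrow> jbound N x X \<Longrightarrow>
      jbound N (c * s\<^sup>2 * x) (S s X - X - complex_of_real s \<cdot>\<^sub>m G X)"
begin

text \<open>One more step propagates the accumulated error by contraction and creates two new
  errors: the remainder at \<open>X\<close>, and \<open>m * s\<close> times the change of
  \<open>G X\<close> under a step. That change is \<open>s G (G X)\<close> plus a remainder, hence
  at most \<open>s * (K + c) * K * x\<close> for \<open>s \<le> 1\<close>; summation over the steps
  gives the factor \<open>m\<^sup>2\<close>.\<close>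

lemma power_first_order:
  assumes s: "0 \<le> s" "s \<le> s0" and X: "jbound N x X"
  shows "jbound N ((m * c + (real m)\<^sup>2 * ((K + c) * K)) * s\<^sup>2 * x)
    ((S s ^^ m) X - X - complex_of_real (m * s) \<cdot>\<^sub>m G X)"
proof (induction m)
  case 0
  have "X - X - 0 \<cdot>\<^sub>m G X = 0\<^sub>m N N"
    using jbound_carrier[OF X] linear_superopD(1)[OF linG jbound_carrier[OF X]] by (intro eq_matI) auto
  thus ?case using jbound_zero by simp
next
  case (Suc m)
  note Xc = jbound_carrier[OF X] and linS = linS[OF s]
  note GX = linear_superopD(1)[OF linG Xc]
  note GGX = linear_superopD(1)[OF linG GX]
  note SX = linear_superopD(1)[OF linS Xc]
  note SGX = linear_superopD(1)[OF linS GX]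
  define T where "T = (S s ^^ m) X"
  have T: "T \<in> carrier_mat N N"
    unfolding T_def using linear_superopD(1)[OF linear_superop_funpow[OF linS]] Xc by blast
  note ST = linear_superopD(1)[OF linS T]
  \<comment> \<open>The terms in \<open>S s X\<close>, \<open>S s (G X)\<close> and
    \<open>G (G X)\<close> cancel, which leaves the error after \<open>Suc m\<close> steps.\<close>
  define D where "D = S s (T - X - complex_of_real (m * s) \<cdot>\<^sub>m G X) +
    ((S s X - X - complex_of_real s \<cdot>\<^sub>m G X) +
     complex_of_real (m * s) \<cdot>\<^sub>m ((S s (G X) - G X - complex_of_real s \<cdot>\<^sub>m G (G X)) +
       complex_of_real s \<cdot>\<^sub>m G (G X)))"
  have "S s (T - X - complex_of_real (m * s) \<cdot>\<^sub>m G X) = S s T - S s X - complex_of_real (m * s) \<cdot>\<^sub>m S s (G X)"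
    using T Xc GX by (simp add: linear_superop_diff[OF linS] linear_superopD(3)[OF linS] minus_carrier_mat)
  hence "(S s ^^ Suc m) X - X - complex_of_real (Suc m * s) \<cdot>\<^sub>m G X = D"
    unfolding D_def using T Xc GX GGX SX SGX ST
    by (intro eq_matI) (auto simp: T_def[symmetric] algebra_simps)
  moreover have "jbound N ((m * c + (real m)\<^sup>2 * ((K + c) * K)) * s\<^sup>2 * x +
     (c * s\<^sup>2 * x + (m * s) * (c * s\<^sup>2 * (K * x) + s * (K * (K * x))))) D"
    unfolding D_def using s
    by (intro jbound_add jbound_smult S_jb R_jb G_jb X Suc.IH[folded T_def]) auto
  moreover have "(m * c + (real m)\<^sup>2 * ((K + c) * K)) * s\<^sup>2 * x +
     (c * s\<^sup>2 * x + (m * s) * (c * s\<^sup>2 * (K * x) + s * (K * (K * x)))) \<le>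
     (Suc m * c + (real (Suc m))\<^sup>2 * ((K + c) * K)) * s\<^sup>2 * x"
  proof -
    define y where "y = s\<^sup>2 * x"
    have y: "0 \<le> y" using jbound_nonneg[OF X] by (simp add: y_def)
    have "s * c \<le> 1 * c" using s s0 c by (intro mult_right_mono) auto
    hence "m * (K * (s * c + K)) \<le> m * (K * (c + K))"
      using K by (intro mult_left_mono) auto
    moreover have "0 \<le> (m + 1) * ((K + c) * K)" using K c by simp
    ultimately have "(m + 1) * c + (real m)\<^sup>2 * ((K + c) * K) + m * (K * (s * c + K)) \<le>
        (m + 1) * c + (real m + 1)\<^sup>2 * ((K + c) * K)"
      by (simp add: algebra_simps power2_eq_square)
    from mult_right_mono[OF this y] show ?thesis
      by (simp add: y_def algebra_simps power2_eq_square)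
  qed
  ultimately show ?case by (rule jbound_eq_mono)
qed

text \<open>One long step and \<open>m\<close> short ones have the same first-order part. Their
  remainders give \<open>2 * c\<close>, by \<open>m \<le> m\<^sup>2\<close>, and
  \<open>(K + c) * K\<close> is inherited from \<open>power_first_order\<close>.\<close>

lemma step_refinement:
  assumes s: "0 \<le> s" "real m * s \<le> s0" and m: "1 \<le> m" and X: "jbound N x X"
  shows "jbound N ((2 * c + (K + c) * K) * (m * s)\<^sup>2 * x) (S (m * s) X - (S s ^^ m) X)"
proof -
  have s': "s \<le> s0" "0 \<le> m * s"
    using s m mult_right_mono[of 1 "real m" s] by auto
  note Xc = jbound_carrier[OF X]
  define T where "T = (S s ^^ m) X"
  have T: "T \<in> carrier_mat N N"
    unfolding T_def using linear_superopD(1)[OF linear_superop_funpow[OF linS[OF s(1) s'(1)]]] Xc by blast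
  have "S (m * s) X - T = (S (m * s) X - X - complex_of_real (m * s) \<cdot>\<^sub>m G X) -
      (T - X - complex_of_real (m * s) \<cdot>\<^sub>m G X)"
    using T Xc linear_superopD(1)[OF linG Xc] linear_superopD(1)[OF linS[OF s'(2) s(2)] Xc]
    by (intro eq_matI) auto
  moreover have "jbound N (c * (m * s)\<^sup>2 * x + (m * c + (real m)\<^sup>2 * ((K + c) * K)) * s\<^sup>2 * x)
      ((S (m * s) X - X - complex_of_real (m * s) \<cdot>\<^sub>m G X) - (T - X - complex_of_real (m * s) \<cdot>\<^sub>m G X))"
    unfolding T_def by (intro jbound_diff R_jb power_first_order s s' X)
  moreover have "c * (m * s)\<^sup>2 * x + (m * c + (real m)\<^sup>2 * ((K + c) * K)) * s\<^sup>2 * x \<le>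
      (2 * c + (K + c) * K) * (m * s)\<^sup>2 * x"
  proof -
    have "real m * (c * s\<^sup>2 * x) \<le> (real m)\<^sup>2 * (c * s\<^sup>2 * x)"
      using m c jbound_nonneg[OF X] by (intro mult_right_mono) (auto simp: power2_eq_square)
    thus ?thesis by (simp add: algebra_simps power2_eq_square)
  qed
  ultimately show ?thesis unfolding T_def by (rule jbound_eq_mono)
qed

definition euler :: "real \<Rightarrow> complex mat \<Rightarrow> complex mat" where
  "euler s X = X + complex_of_real s \<cdot>\<^sub>m G X"

lemma euler_power_carrier: "X \<in> carrier_mat N N \<Longrightarrow> (euler s ^^ n) X \<in> carrier_mat N N"
proof (induction n)
  case (Suc n)
  note Y = Suc.IH[OF Suc.prems]
  show ?case using Y linear_superopD(1)[OF linG Y] by (simp add: euler_def)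
qed simp

text \<open>Binomial theorem for \<open>I + s G\<close>. The step applied first is peeled off, which
  is why the induction varies \<open>X\<close>.\<close>

lemma euler_power_index:
  assumes "X \<in> carrier_mat N N" "i < N" "j < N"
  shows "(euler s ^^ n) X $$ (i, j) = (\<Sum>k\<le>n. (n choose k) * complex_of_real s ^ k * (G ^^ k) X $$ (i, j))"
  using assms(1)
proof (induction n arbitrary: X)
  case (Suc n)
  note GX = linear_superopD(1)[OF linG Suc.prems]
  have Gk: "(G ^^ k) (euler s X) $$ (i, j) = (G ^^ k) X $$ (i, j) + complex_of_real s * (G ^^ Suc k) X $$ (i, j)" for k
  proof -
    note l = linear_superop_funpow[OF linG, of k]
    have "(G ^^ k) (euler s X) = (G ^^ k) X + complex_of_real s \<cdot>\<^sub>m (G ^^ k) (G X)"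
      unfolding euler_def using GX Suc.prems by (simp add: linear_superopD(2,3)[OF l])
    thus ?thesis
      using linear_superopD(1)[OF l Suc.prems] linear_superopD(1)[OF l GX] assms(2,3)
      by (simp add: funpow_swap1)
  qed
  have "(euler s ^^ Suc n) X $$ (i, j) = (euler s ^^ n) (euler s X) $$ (i, j)"
    by (simp add: funpow_swap1)
  also have "\<dots> = (\<Sum>k\<le>n. (n choose k) * complex_of_real s ^ k * (G ^^ k) (euler s X) $$ (i, j))"
    using GX Suc.prems by (intro Suc.IH) (simp add: euler_def)
  also have "\<dots> = (\<Sum>k\<le>n. (n choose k) * complex_of_real s ^ k * (G ^^ k) X $$ (i, j)) +
      complex_of_real s * (\<Sum>k\<le>n. (n choose k) * complex_of_real s ^ k * (G ^^ Suc k) X $$ (i, j))"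
    by (simp only: Gk distrib_left sum.distrib sum_distrib_left mult_ac)
  finally show ?case using binomial_step[of n "complex_of_real s" "\<lambda>k. (G ^^ k) X $$ (i, j)"] by simp
qed simp

lemma euler_jb:
  assumes "0 \<le> s" "jbound N x X"
  shows "jbound N ((1 + K * s) * x) (euler s X)"
  using jbound_add[OF assms(2) jbound_smult[OF G_jb[OF assms(2)] assms(1)]]
  by (simp add: euler_def algebra_simps)

text \<open>For fixed \<open>n * s\<close> the bound is proportional to \<open>s\<close>, so the
  exponential growth of the Euler steps disappears in the limit of fine steps.\<close>

lemma power_vs_euler:
  assumes s: "0 \<le> s" "s \<le> s0" and X: "jbound N x X"
  shows "jbound N (n * (c * s\<^sup>2) * exp (K * (n * s)) * x) ((S s ^^ n) X - (euler s ^^ n) X)"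
proof -
  have "jbound N (n * (c * s\<^sup>2) * (1 + K * s) ^ n * x) ((S s ^^ n) X - (euler s ^^ n) X)"
  proof (rule jbound_telescope[OF linS[OF s]])
    show "jbound N (c * s\<^sup>2 * x) (S s X - euler s X)" if X: "jbound N x X" for x X
    proof -
      have "S s X - euler s X = S s X - X - complex_of_real s \<cdot>\<^sub>m G X"
        using jbound_carrier[OF X] linear_superopD(1)[OF linG jbound_carrier[OF X]]
          linear_superopD(1)[OF linS[OF s] jbound_carrier[OF X]]
        by (intro eq_matI) (auto simp: euler_def)
      thus ?thesis using R_jb[OF s X] by simp
    qed
  qed (use s X K c S_jb euler_jb in auto)
  moreover have "(1 + K * s) ^ n \<le> exp (K * (n * s))"
  proof -
    have "(1 + K * s) ^ n \<le> exp (K * s) ^ n"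
      using K s by (intro power_mono exp_ge_add_one_self) auto
    thus ?thesis by (simp add: exp_of_nat_mult[symmetric] mult_ac)
  qed
  ultimately show ?thesis
    using c jbound_nonneg[OF X] by (elim jbound_mono) (intro mult_right_mono mult_left_mono; simp)
qed

text \<open>
  The exponential is only reached as a limit of Euler steps of size \<open>t / (n (m + 1))\<close>; comparing
  with \<open>S\<close> at that finer scale keeps the constant free of the factor \<open>exp (K t)\<close>, because \<open>S\<close>,
  unlike the Euler step, is a contraction.
\<close>

theorem trace_norm_power_exp:
  assumes t: "0 \<le> t" and n: "1 \<le> n" "t / n \<le> s0" and X: "jbound N x X"
    and E: "E \<in> carrier_mat N N"
      "\<And>i j. i < N \<Longrightarrow> j < N \<Longrightarrow> E $$ (i, j) = (\<Sum>k. (G ^^ k) X $$ (i, j) * complex_of_real (t ^ k / fact k))"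
  shows "trace_norm ((S (t / n) ^^ n) X - E) \<le> (2 * c + (K + c) * K) * t\<^sup>2 / n * x"
proof -
  define C3 where "C3 = 2 * c + (K + c) * K"
  \<comment> \<open>Each of the \<open>n\<close> steps is divided into \<open>Suc m\<close> substeps
    of length \<open>s m\<close>.\<close>
  define M where "M m = n * Suc m" for m
  define s where "s m = t / M m" for m
  define P where "P = (S (t / n) ^^ n) X"
  note Xc = jbound_carrier[OF X]
  have tn: "0 \<le> t / n" using t by simp
  have Pc: "P \<in> carrier_mat N N"
    unfolding P_def using linear_superopD(1)[OF linear_superop_funpow[OF linS[OF tn n(2)]]] Xc by blast
  have s: "0 \<le> s m" "s m \<le> s0" "Suc m * s m = t / n" for m
  proof -
    show e: "Suc m * s m = t / n"
    proof -
      have "real (Suc m) * (t / (real n * real (Suc m))) = t / n"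
        using n by (simp only: times_divide_eq_right) (simp only: mult.commute[of "real n"] mult_divide_mult_cancel_left of_nat_eq_0_iff Suc_not_Zero not_False_eq_True)
      thus ?thesis by (simp only: s_def M_def of_nat_mult)
    qed
    show s_nn: "0 \<le> s m" using t by (simp add: s_def)
    have "1 * s m \<le> Suc m * s m" using s_nn by (intro mult_right_mono) auto
    thus "s m \<le> s0" using n e by simp
  qed
  have G_pow: "jbound N (K ^ k * x) ((G ^^ k) X)" for k
    by (induction k) (use X G_jb in \<open>auto simp: mult.assoc\<close>)
  have C3: "0 \<le> C3" using K c by (simp add: C3_def)
  \<comment> \<open>The first summand compares the coarse steps with their subdivisions, both
    contractions, hence \<open>g = 1\<close>. The second compares the fine steps with Euler
    steps.\<close>
  have Pm: "jbound N (n * (C3 * (t / n)\<^sup>2) * 1 ^ n * x + M m * (c * (s m)\<^sup>2) * exp (K * (M m * s m)) * x)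
      (P - (euler (s m) ^^ M m) X)" for m
  proof -
    define Q where "Q = (S (s m) ^^ M m) X"
    have Qc: "Q \<in> carrier_mat N N"
      unfolding Q_def using linear_superopD(1)[OF linear_superop_funpow[OF linS[OF s(1,2)]]] Xc by blast
    have euler_c: "(euler (s m) ^^ k) X \<in> carrier_mat N N" for k
      by (rule euler_power_carrier[OF Xc])
    have "(S (s m) ^^ Suc m) ^^ n = S (s m) ^^ M m"
      by (simp only: funpow_mult M_def mult.commute)
    moreover have "jbound N (n * (C3 * (t / n)\<^sup>2) * 1 ^ n * x)
        (P - ((S (s m) ^^ Suc m) ^^ n) X)"
      unfolding P_def
    proof (rule jbound_telescope[OF linS[OF tn n(2)]])
      show "jbound N (1 * x) ((S (s m) ^^ Suc m) X)" if "jbound N x X" for x X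
      proof -
        have "jbound N x ((S (s m) ^^ k) X)" for k
          by (induction k) (use that S_jb s in auto)
        thus ?thesis by (simp only: mult_1)
      qed
      show "jbound N (C3 * (t / n)\<^sup>2 * x) (S (t / n) X - (S (s m) ^^ Suc m) X)" if "jbound N x X" for x X
        using step_refinement[OF s(1) _ _ that, of "Suc m" m] s n(2) unfolding C3_def by simp
    qed (use S_jb tn n X C3 in auto)
    ultimately have 1: "jbound N (n * (C3 * (t / n)\<^sup>2) * 1 ^ n * x) (P - Q)"
      by (simp add: Q_def)
    have "P - (euler (s m) ^^ M m) X = (P - Q) + (Q - (euler (s m) ^^ M m) X)"
      by (intro diff_add_diff_mat[of _ N N] Pc Qc euler_c)
    thus ?thesis using jbound_add[OF 1 power_vs_euler[OF s(1,2) X, of "M m" m, folded Q_def]] by simp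
  qed
  have "trace_norm (P - E) \<le> C3 * t\<^sup>2 / n * x + 0"
  proof (rule trace_norm_limit[OF Pm])
    show "P - E \<in> carrier_mat N N" using Pc E(1) by auto
    have Mlim: "filterlim M at_top sequentially"
      unfolding M_def using n(1)
      by (intro filterlim_subseq) (auto simp: strict_mono_def)
    show "(\<lambda>m. (P - (euler (s m) ^^ M m) X) $$ (i, j)) \<longlonglongrightarrow> (P - E) $$ (i, j)" if ij: "i < N" "j < N" for i j
    proof -
      have b: "cmod ((G ^^ k) X $$ (i, j)) \<le> x * K ^ k" for k
        using jbound_entry[OF G_pow ij] by (simp add: mult.commute)
      have "(\<lambda>m. (euler (s m) ^^ M m) X $$ (i, j)) \<longlonglongrightarrow> E $$ (i, j)"
        unfolding euler_power_index[OF Xc ij] E(2)[OF ij] s_def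
        by (rule filterlim_compose[OF binomial_exp_limit[OF b t K] Mlim])
      hence "(\<lambda>m. P $$ (i, j) - (euler (s m) ^^ M m) X $$ (i, j)) \<longlonglongrightarrow> P $$ (i, j) - E $$ (i, j)"
        by (intro tendsto_intros)
      thus ?thesis
        using ij Pc E(1) carrier_matD[OF euler_power_carrier[OF Xc]] by simp
    qed
    \<comment> \<open>The first part does not depend on \<open>m\<close>, the second is a multiple
      of \<open>1 / Suc m\<close>; only the former survives in the limit.\<close>
    have "(\<lambda>m. n * (C3 * (t / n)\<^sup>2) * 1 ^ n * x + M m * (c * (s m)\<^sup>2) * exp (K * (M m * s m)) * x) =
        (\<lambda>m. C3 * t\<^sup>2 / n * x + c * t\<^sup>2 * exp (K * t) * x / n * inverse (real (Suc m)))"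
    proof (rule ext)
      fix m
      have Ms: "M m * s m = t" using n by (simp add: s_def M_def del: of_nat_Suc of_nat_mult)
      have sm: "s m = t / n * inverse (real (Suc m))"
        unfolding s_def M_def of_nat_mult by (simp only: divide_inverse inverse_mult_distrib mult.assoc)
      have "M m * (c * (s m)\<^sup>2) * exp (K * (M m * s m)) * x = c * (M m * s m) * s m * exp (K * (M m * s m)) * x"
        by (simp add: power2_eq_square del: of_nat_Suc)
      also have "\<dots> = c * t\<^sup>2 * exp (K * t) * x / n * inverse (real (Suc m))"
        unfolding Ms by (simp add: sm power2_eq_square del: of_nat_Suc)
      moreover have "n * (C3 * (t / n)\<^sup>2) * 1 ^ n * x = C3 * t\<^sup>2 / n * x"
        using n by (simp add: power2_eq_square)
      ultimately show "n * (C3 * (t / n)\<^sup>2) * 1 ^ n * x + M m * (c * (s m)\<^sup>2) * exp (K * (M m * s m)) * x =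
        C3 * t\<^sup>2 / n * x + c * t\<^sup>2 * exp (K * t) * x / n * inverse (real (Suc m))" by simp
    qed
    moreover have "(\<lambda>m. C3 * t\<^sup>2 / n * x + c * t\<^sup>2 * exp (K * t) * x / n * inverse (real (Suc m))) \<longlonglongrightarrow>
        C3 * t\<^sup>2 / n * x + c * t\<^sup>2 * exp (K * t) * x / n * 0"
      by (intro tendsto_intros LIMSEQ_inverse_real_of_nat)
    ultimately show "(\<lambda>m. n * (C3 * (t / n)\<^sup>2) * 1 ^ n * x + M m * (c * (s m)\<^sup>2) * exp (K * (M m * s m)) * x)
        \<longlonglongrightarrow> C3 * t\<^sup>2 / n * x + 0" by simp
  qed
  thus ?thesis by (simp add: P_def C3_def)
qed

end

section \<open>The channel of one step\<close>

text \<open>A constant in place of a conditional, so that \<open>sum_kd\<close> removes sums without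
  case distinctions.\<close>

definition kd :: "nat \<Rightarrow> nat \<Rightarrow> complex" where
  "kd i j = (if i = j then 1 else 0)"

lemma sum_kd:
  assumes "j < d"
  shows "(\<Sum>x<d. kd j x * f x) = f j" "(\<Sum>x<d. kd x j * f x) = f j"
  using assms by (simp_all add: kd_def)

lemma kd_sym: "kd i j = kd j i"
  by (auto simp: kd_def)

lemma kd_cnj [simp]: "cnj (kd i j) = kd i j"
  by (simp add: kd_def)

lemma kd_same [simp]: "kd i i = 1"
  by (simp add: kd_def)

lemma quantum_channel_cong:
  assumes "quantum_channel m n \<Phi>" "\<And>A. A \<in> carrier_mat m m \<Longrightarrow> \<Psi> A = \<Phi> A"
  shows "quantum_channel m n \<Psi>"
proof -
  have "id_tensor r m n \<Psi> X = id_tensor r m n \<Phi> X" for r X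
    by (simp add: id_tensor_def assms(2))
  thus ?thesis
    using assms unfolding quantum_channel_def linear_superop_def completely_positive_def by simp
qed

lemma trace_kron:
  assumes "A \<in> carrier_mat m m" "B \<in> carrier_mat n n"
  shows "trace (kron A B) = trace A * trace B"
  using assms carrier_matD[OF kron_carrier[OF assms]]
  by (simp add: trace_def sum_mult_split kron_index sum_product)

text \<open>The Kraus operators are \<open>I \<otimes> |C g>\<close>, where \<open>|C g>\<close>
  runs through the columns of a factor of \<open>\<omega>\<close>.\<close>

lemma quantum_channel_attach:
  fixes C :: "nat \<Rightarrow> nat \<Rightarrow> complex"
  assumes \<omega>: "\<omega> \<in> carrier_mat D D" "trace \<omega> = 1"
    and C: "\<And>u w. u < D \<Longrightarrow> w < D \<Longrightarrow> \<omega> $$ (u, w) = (\<Sum>g<m. C u g * cnj (C w g))"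
  shows "quantum_channel d (d * D) (\<lambda>\<rho>. kron \<rho> \<omega>)"
proof -
  define K where "K g I x = kd (I div D) x * C (I mod D) g" for g I x :: nat
  have k: "kron \<rho> \<omega> = kraus {..<m} K d (d * D) \<rho>" if "\<rho> \<in> carrier_mat d d" for \<rho>
  proof (rule block_eqI[of _ d D])
    fix i k u w assume ik: "i < d" "k < d" "u < D" "w < D"
    have idx: "K g (i * D + u) x = kd i x * C u g" "K g (k * D + w) x = kd k x * C w g" for g x
      using ik by (simp_all add: K_def)
    have "kraus {..<m} K d (d * D) \<rho> $$ (i * D + u, k * D + w) =
      (\<Sum>g<m. \<Sum>x<d. kd i x * (\<Sum>y<d. kd k y * (C u g * \<rho> $$ (x, y) * cnj (C w g))))"
      unfolding kraus_index[OF mult_split_less[OF ik(1,3)] mult_split_less[OF ik(2,4)]] sum_distrib_left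
      by (intro sum.cong[OF refl]) (simp only: idx, simp)
    also have "\<dots> = kron \<rho> \<omega> $$ (i * D + u, k * D + w)"
      unfolding kron_index[OF that \<omega>(1) ik(1,2,3,4)]
      using ik by (simp add: C sum_kd) (simp add: sum_distrib_left mult_ac)
    finally show "kron \<rho> \<omega> $$ (i * D + u, k * D + w) =
      kraus {..<m} K d (d * D) \<rho> $$ (i * D + u, k * D + w)" ..
  qed (use that \<omega> in auto)
  have "completely_positive d (d * D) (\<lambda>\<rho>. kron \<rho> \<omega>)"
  proof -
    have "id_tensor r d (d * D) (\<lambda>\<rho>. kron \<rho> \<omega>) X = id_tensor r d (d * D) (kraus {..<m} K d (d * D)) X" for r X
      by (simp add: id_tensor_def k)
    thus ?thesis using completely_positive_kraus[of d "d * D" "{..<m}" K]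
      by (simp add: completely_positive_def)
  qed
  moreover have "linear_superop d (d * D) (\<lambda>\<rho>. kron \<rho> \<omega>)"
    using linear_superop_kraus[of d "d * D" "{..<m}" K] by (simp add: linear_superop_def k)
  ultimately show ?thesis
    using \<omega> by (simp add: quantum_channel_def trace_kron[of _ d \<omega> D])
qed

text \<open>Contraction with the kernel of \<open>I + \<beta> SWAP\<close>, needed both for the
  completeness of the swap branch and for its action.\<close>

lemma sum_two_kd:
  assumes "h < d" "k < d"
  shows "(\<Sum>y<d. \<Sum>h'<d. (kd h h' * kd k y + \<beta> * (kd k h' * kd y h)) * g y h') = g k h + \<beta> * g h k"
proof -
  have "(\<Sum>y<d. \<Sum>h'<d. (kd h h' * kd k y + \<beta> * (kd k h' * kd y h)) * g y h') =
    (\<Sum>y<d. kd k y * (\<Sum>h'<d. kd h h' * g y h')) + (\<Sum>y<d. kd y h * (\<Sum>h'<d. kd k h' * (\<beta> * g y h')))"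
    by (simp add: algebra_simps sum.distrib sum_distrib_left)
  also have "\<dots> = g k h + \<beta> * g h k" using assms by (simp add: sum_kd)
  finally show ?thesis .
qed

text \<open>
  A Kraus family on \<open>\<H>\<^sub>S \<otimes> \<H>\<^sub>H \<otimes> \<H>\<^sub>P \<otimes> \<H>\<^sub>Q\<close>: an equal mixture of the channel that applies
  \<open>(I - 2is SWAP) / sqrt (1 + 4s\<^sup>2)\<close> to \<open>S, H\<close>, and of the channel with Kraus operators
  \<open>sqrt (2s - ds\<^sup>2) W\<close> and \<open>I - s W\<^sup>\<dagger> W\<close>, where \<open>W = I\<^sub>P \<otimes> \<langle>\<Gamma>|\<^sub>S\<^sub>Q\<close>; since \<open>W\<^sup>\<dagger> W W\<^sup>\<dagger> W = d W\<^sup>\<dagger> W\<close>, the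
  latter is trace preserving. The indices \<open>h0, p0, q0\<close> come from tracing out the program.
\<close>

definition step_amp ::
  "nat \<Rightarrow> real \<Rightarrow> nat \<times> nat \<times> nat \<times> nat \<Rightarrow> nat \<Rightarrow> nat \<Rightarrow> nat \<Rightarrow> nat \<Rightarrow> nat \<Rightarrow> complex" where
  "step_amp d s = (\<lambda>(b, h0, p0, q0) h p q i x.
     if b = 0 then sqrt (1 / (2 * (1 + 4 * s\<^sup>2))) * (kd p0 p * kd q0 q *
       (kd h0 h * kd i x + (- 2 * \<i> * s) * (kd i h * kd x h0)))
     else if b = 1 then sqrt ((2 * s - d * s\<^sup>2) / 2) * (kd p0 0 * kd q0 0 * kd h0 h * kd i p * kd x q)
     else sqrt (1 / 2) * (kd h0 h * kd p0 p * (kd q0 q * kd i x - s * (kd i q0 * kd x q))))"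

text \<open>The column index encodes \<open>S \<otimes> H \<otimes> P \<otimes> Q\<close> as
  \<open>x * (d * d * d) + ((h * d + p) * d + q)\<close>.\<close>

definition step_kraus ::
  "nat \<Rightarrow> real \<Rightarrow> nat \<times> nat \<times> nat \<times> nat \<Rightarrow> nat \<Rightarrow> nat \<Rightarrow> complex" where
  "step_kraus d s a i X = (let j = X mod (d * d * d) in
     step_amp d s a (j div d div d) (j div d mod d) (j mod d) i (X div (d * d * d)))"

text \<open>In branch 1 only labels with \<open>p0 = q0 = 0\<close> give nonzero operators; the full
  product keeps a common index set for all branches.\<close>

definition step_index :: "nat \<Rightarrow> (nat \<times> nat \<times> nat \<times> nat) set" where
  "step_index d = {..<3} \<times> {..<d} \<times> {..<d} \<times> {..<d}"

definition step_channel :: "nat \<Rightarrow> real \<Rightarrow> complex mat \<Rightarrow> complex mat" where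
  "step_channel d s = kraus (step_index d) (step_kraus d s) (d * (d * d * d)) d"

lemma sum_step_index:
  "(\<Sum>a\<in>step_index d. f a) = (\<Sum>h<d. \<Sum>p<d. \<Sum>q<d. f (0, h, p, q)) +
     (\<Sum>h<d. \<Sum>p<d. \<Sum>q<d. f (1, h, p, q)) + (\<Sum>h<d. \<Sum>p<d. \<Sum>q<d. f (2, h, p, q))"
proof -
  have "(\<Sum>a\<in>step_index d. f a) = (\<Sum>b<3. \<Sum>h<d. \<Sum>p<d. \<Sum>q<d. f (b, h, p, q))"
    by (simp add: step_index_def sum.cartesian_product)
  thus ?thesis by (simp add: numeral_3_eq_3 numeral_2_eq_2)
qed

text \<open>The swap branch contributes half the identity, as its cross terms cancel because their
  coefficient is imaginary. The no-jump branch contributes the other half plus a multiple of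
  \<open>W\<^sup>\<dagger> W\<close>, which the jump branch cancels.\<close>

lemma kraus_complete_step_amp:
  fixes s :: real
  assumes lt: "x < d" "h < d" "p < d" "q < d" "x' < d" "h' < d" "p' < d" "q' < d"
    and s: "0 \<le> s" "s * d \<le> 1"
  shows "(\<Sum>a\<in>step_index d. \<Sum>i<d. cnj (step_amp d s a h p q i x) * step_amp d s a h' p' q' i x') =
    kd x x' * kd h h' * kd p p' * kd q q'"
proof -
  have d: "0 < d" using lt by auto
  define g0 where "g0 = complex_of_real (sqrt (1 / (2 * (1 + 4 * s\<^sup>2))))"
  define g1 where "g1 = complex_of_real (sqrt ((2 * s - d * s\<^sup>2) / 2))"
  define g2 where "g2 = complex_of_real (sqrt (1 / 2))"
  have amp:
    "step_amp d s (0, h0, p0, q0) h p q i x = g0 * (kd p0 p * kd q0 q *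
       (kd h0 h * kd i x + (- 2 * \<i> * s) * (kd i h * kd x h0)))"
    "step_amp d s (1, h0, p0, q0) h p q i x = g1 * (kd p0 0 * kd q0 0 * kd h0 h * kd i p * kd x q)"
    "step_amp d s (2, h0, p0, q0) h p q i x =
       g2 * (kd h0 h * kd p0 p * (kd q0 q * kd i x - s * (kd i q0 * kd x q)))"
    for h0 p0 q0 h p q i x
    by (simp_all only: step_amp_def g0_def g1_def g2_def prod.case if_True if_False one_neq_zero
        zero_neq_numeral[symmetric] numeral_eq_one_iff num.distinct) simp_all
  have g_cnj: "cnj g0 = g0" "cnj g1 = g1" "cnj g2 = g2" by (simp_all add: g0_def g1_def g2_def)
  \<comment> \<open>Makes the jump weight nonnegative, so that squaring its root gives it
    back.\<close>
  have "s * (s * d) \<le> s * 2" using s by (intro mult_left_mono) auto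
  hence nn: "0 \<le> 2 * s - d * s\<^sup>2" by (simp add: power2_eq_square mult_ac)
  have gg: "g0 * g0 = complex_of_real (1 / (2 * (1 + 4 * s\<^sup>2)))"
    "g1 * g1 = complex_of_real ((2 * s - d * s\<^sup>2) / 2)" "g2 * g2 = complex_of_real (1 / 2)"
    unfolding g0_def g1_def g2_def using nn by (intro of_real_sqrt_square; simp)+
  have ampc:
    "cnj (step_amp d s (1, h0, p0, q0) h p q i x) = g1 * (kd p0 0 * kd q0 0 * kd h0 h * kd i p * kd x q)"
    "cnj (step_amp d s (2, h0, p0, q0) h p q i x) =
       g2 * (kd h0 h * kd p0 p * (kd q0 q * kd i x - s * (kd i q0 * kd x q)))"
    for h0 p0 q0 h p q i x
    unfolding amp by (simp_all add: g_cnj)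
  have 0: "(\<Sum>h0<d. \<Sum>p0<d. \<Sum>q0<d. \<Sum>i<d. cnj (step_amp d s (0, h0, p0, q0) h p q i x) *
      step_amp d s (0, h0, p0, q0) h' p' q' i x') =
      g0 * g0 * ((1 + 4 * s\<^sup>2) * (kd x x' * kd h h' * kd p p' * kd q q'))"
  proof -
    define \<beta> where "\<beta> = 2 * \<i> * complex_of_real s"
    have amp': "cnj (step_amp d s (0, h0, p0, q0) h p q i x) =
        g0 * (kd p0 p * kd q0 q * (kd h0 h * kd i x + \<beta> * (kd i h * kd x h0)))"
      "step_amp d s (0, h0, p0, q0) h p q i x =
        g0 * (kd p0 p * kd q0 q * (kd h0 h * kd i x + - \<beta> * (kd i h * kd x h0)))"
      for h0 p0 q0 h p q i x
      unfolding amp by (simp_all add: g_cnj \<beta>_def)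
    have "(\<Sum>h0<d. \<Sum>p0<d. \<Sum>q0<d. \<Sum>i<d. cnj (step_amp d s (0, h0, p0, q0) h p q i x) *
      step_amp d s (0, h0, p0, q0) h' p' q' i x') =
      (\<Sum>h0<d. \<Sum>p0<d. kd p0 p * (\<Sum>q0<d. kd q0 q * (\<Sum>i<d. g0 * g0 * (kd p0 p' * kd q0 q' *
        ((kd h0 h * kd i x + \<beta> * (kd i h * kd x h0)) *
         (kd h0 h' * kd i x' + - \<beta> * (kd i h' * kd x' h0)))))))"
      unfolding sum_distrib_left
      by (intro sum.cong[OF refl]) (simp only: amp'(1), simp only: amp'(2) mult_ac)
    also have "\<dots> = g0 * g0 * (kd p p' * kd q q') * (\<Sum>h0<d. \<Sum>i<d.
        (kd x i * kd h h0 + \<beta> * (kd h i * kd h0 x)) * (kd h0 h' * kd i x' + - \<beta> * (kd i h' * kd x' h0)))"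
    proof -
      have "kd h0 h * kd i x + \<beta> * (kd i h * kd x h0) = kd x i * kd h h0 + \<beta> * (kd h i * kd h0 x)" for h0 i
        by (simp only: kd_sym[of h0 h] kd_sym[of i x] kd_sym[of i h] kd_sym[of x h0] mult.commute)
      thus ?thesis using lt by (simp only: sum_kd) (simp only: sum_distrib_left mult.assoc)
    qed
    also have "\<dots> = g0 * g0 * (kd p p' * kd q q') * (kd h h' * kd x x' + - \<beta> * (kd x h' * kd x' h) +
        \<beta> * (kd x h' * kd h x' + - \<beta> * (kd h h' * kd x' x)))"
      using lt by (simp only: sum_two_kd)
    also have "kd h h' * kd x x' + - \<beta> * (kd x h' * kd x' h) +
        \<beta> * (kd x h' * kd h x' + - \<beta> * (kd h h' * kd x' x)) = (1 + 4 * s\<^sup>2) * (kd x x' * kd h h')"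
    proof -
      have "kd x' h = kd h x'" "kd x' x = kd x x'" by (auto simp: kd_def)
      moreover have "\<beta> * \<beta> = - (4 * s\<^sup>2)" by (simp add: \<beta>_def power2_eq_square algebra_simps)
      ultimately show ?thesis
        by (simp add: algebra_simps) (simp add: mult.assoc[symmetric])
    qed
    finally show ?thesis by (simp add: mult_ac)
  qed
  \<comment> \<open>The kernel \<open>kd x q * kd x' q'\<close> is that of
    \<open>|\<Gamma>><\<Gamma>|\<close> on \<open>S\<close> and \<open>Q\<close>, the nontrivial
    factor of \<open>W\<^sup>\<dagger> W\<close>.\<close>
  have 1: "(\<Sum>h0<d. \<Sum>p0<d. \<Sum>q0<d. \<Sum>i<d. cnj (step_amp d s (1, h0, p0, q0) h p q i x) *
      step_amp d s (1, h0, p0, q0) h' p' q' i x') =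
      g1 * g1 * (kd h h' * kd p p' * (kd x q * kd x' q'))"
  proof -
    have "(\<Sum>h0<d. \<Sum>p0<d. \<Sum>q0<d. \<Sum>i<d. cnj (step_amp d s (1, h0, p0, q0) h p q i x) *
      step_amp d s (1, h0, p0, q0) h' p' q' i x') =
      (\<Sum>h0<d. kd h0 h * (\<Sum>p0<d. kd p0 0 * (\<Sum>q0<d. kd q0 0 * (\<Sum>i<d. kd i p *
         (g1 * g1 * (kd p0 0 * kd q0 0 * kd h0 h' * kd i p' * (kd x q * kd x' q')))))))"
      unfolding sum_distrib_left
      by (intro sum.cong[OF refl]) (simp only: ampc, simp only: amp mult_ac)
    also have "\<dots> = g1 * g1 * (kd h h' * kd p p' * (kd x q * kd x' q'))"
      using lt d by (simp only: sum_kd kd_same mult_1)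
    finally show ?thesis .
  qed
  have 2: "(\<Sum>h0<d. \<Sum>p0<d. \<Sum>q0<d. \<Sum>i<d. cnj (step_amp d s (2, h0, p0, q0) h p q i x) *
      step_amp d s (2, h0, p0, q0) h' p' q' i x') =
      g2 * g2 * (kd h h' * kd p p' * (kd q q' * kd x x' + (d * s\<^sup>2 - 2 * s) * (kd x q * kd x' q')))"
  proof -
    have "(\<Sum>h0<d. \<Sum>p0<d. \<Sum>q0<d. \<Sum>i<d. cnj (step_amp d s (2, h0, p0, q0) h p q i x) *
      step_amp d s (2, h0, p0, q0) h' p' q' i x') =
      (\<Sum>h0<d. kd h0 h * (\<Sum>p0<d. kd p0 p * (g2 * g2 * (kd h0 h' * kd p0 p' * (\<Sum>q0<d. \<Sum>i<d.
         (kd q0 q * kd i x - s * (kd i q0 * kd x q)) * (kd q0 q' * kd i x' - s * (kd i q0 * kd x' q')))))))"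
      unfolding sum_distrib_left
      by (intro sum.cong[OF refl]) (simp only: ampc, simp only: amp mult_ac)
    also have "\<dots> = g2 * g2 * (kd h h' * kd p p' * (\<Sum>q0<d. \<Sum>i<d.
         (kd q0 q * kd i x - s * (kd i q0 * kd x q)) * (kd q0 q' * kd i x' - s * (kd i q0 * kd x' q'))))"
      using lt by (simp add: sum_kd)
    also have "(\<Sum>q0<d. \<Sum>i<d.
         (kd q0 q * kd i x - s * (kd i q0 * kd x q)) * (kd q0 q' * kd i x' - s * (kd i q0 * kd x' q'))) =
       (\<Sum>q0<d. kd q0 q * (\<Sum>i<d. kd i x * (kd q0 q' * kd i x' - s * (kd i q0 * kd x' q')))) -
       (\<Sum>q0<d. \<Sum>i<d. kd i q0 * (s * kd x q * (kd q0 q' * kd i x' - s * (kd i q0 * kd x' q'))))"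
      by (simp add: algebra_simps sum.distrib sum_subtractf sum_distrib_left)
    also have "\<dots> = (kd q q' * kd x x' - s * (kd x q * kd x' q')) -
       (\<Sum>q0<d. s * kd x q * (kd q0 q' * kd q0 x' - s * kd x' q'))"
      using lt by (simp add: sum_kd)
    \<comment> \<open>The part whose summand is independent of \<open>q0\<close> supplies the factor
      \<open>d\<close>, the squared length of \<open>|\<Gamma>>\<close>.\<close>
    also have "(\<Sum>q0<d. s * kd x q * (kd q0 q' * kd q0 x' - s * kd x' q')) =
       (\<Sum>q0<d. kd q0 q' * (s * kd x q * kd q0 x')) - d * (s * kd x q * (s * kd x' q'))"
      by (simp add: algebra_simps sum_subtractf)
    also have "\<dots> = s * kd x q * kd q' x' - d * (s * kd x q * (s * kd x' q'))"
      using lt by (simp add: sum_kd)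
    also have "kd q' x' = kd x' q'" by (auto simp: kd_def)
    finally show ?thesis by (simp add: algebra_simps power2_eq_square)
  qed
  have w: "g0 * g0 * (1 + 4 * s\<^sup>2) = 1 / 2"
  proof -
    have "1 / (2 * (1 + 4 * s\<^sup>2)) * (1 + 4 * s\<^sup>2) = 1 / 2"
    proof -
      have "1 / (2 * y) * y = 1 / 2" if "y \<noteq> 0" for y :: real using that by simp
      moreover have "1 + 4 * s\<^sup>2 \<noteq> 0" using zero_le_power2[of s] by linarith
      ultimately show ?thesis by blast
    qed
    hence "complex_of_real (1 / (2 * (1 + 4 * s\<^sup>2)) * (1 + 4 * s\<^sup>2)) = complex_of_real (1 / 2)"
      by (simp only:)
    thus ?thesis unfolding gg by simp
  qed
  define c where "c = complex_of_real (2 * s - d * s\<^sup>2)"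
  have c: "complex_of_real ((2 * s - d * s\<^sup>2) / 2) = c / 2" "complex_of_real (d * s\<^sup>2 - 2 * s) = - c"
    "complex_of_real (1 / 2) = 1 / 2"
    by (simp_all add: c_def)
  have z: "g0 * g0 * (complex_of_real (1 + 4 * s\<^sup>2) * Z) = Z / 2" for Z
    unfolding mult.assoc[symmetric] w by simp
  have alg: "X * H * P * Q / 2 + c / 2 * (H * P * W) + 1 / 2 * (H * P * (Q * X + - c * W)) = X * H * P * Q"
    for X H P Q W :: complex
    by (simp add: algebra_simps add_divide_distrib[symmetric] diff_divide_distrib[symmetric])
  show ?thesis
    unfolding sum_step_index 0 1 2 gg(2,3) c z by (rule alg)
qed

lemma kraus_complete_step:
  fixes s :: real
  assumes s: "0 \<le> s" "s * d \<le> 1"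
  shows "kraus_complete (step_index d) (step_kraus d s) (d * (d * d * d)) d"
  unfolding kraus_complete_def
proof (intro allI impI)
  fix X Y assume XY: "X < d * (d * d * d)" "Y < d * (d * d * d)"
  have dec: "\<exists>x h p q. X = x * (d * d * d) + ((h * d + p) * d + q) \<and> x < d \<and> h < d \<and> p < d \<and> q < d"
    if "X < d * (d * d * d)" for X
  proof -
    define j where "j = X mod (d * d * d)"
    have lt: "X div (d * d * d) < d" "j < d * d * d"
      using div_mod_less[OF that] by (auto simp: j_def)
    have lt2: "j div d < d * d" "j mod d < d" using div_mod_less[OF lt(2)] by auto
    have lt3: "j div d div d < d" "j div d mod d < d" using div_mod_less[OF lt2(1)] by auto
    have "X = X div (d * d * d) * (d * d * d) + ((j div d div d * d + j div d mod d) * d + j mod d)"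
      unfolding div_mult_mod_eq j_def ..
    thus ?thesis using lt(1) lt2(2) lt3 by blast
  qed
  obtain x h p q where x: "X = x * (d * d * d) + ((h * d + p) * d + q)" "x < d" "h < d" "p < d" "q < d"
    using dec[OF XY(1)] by blast
  obtain x' h' p' q' where x': "Y = x' * (d * d * d) + ((h' * d + p') * d + q')" "x' < d" "h' < d" "p' < d" "q' < d"
    using dec[OF XY(2)] by blast
  have lt: "(h * d + p) * d + q < d * d * d" "(h' * d + p') * d + q' < d * d * d"
    using x x' by (intro mult_split_less; simp)+
  have e: "step_kraus d s a i X = step_amp d s a h p q i x"
    "step_kraus d s a i Y = step_amp d s a h' p' q' i x'" for a i
    using x x' lt by (simp_all add: step_kraus_def)
  have "X = Y \<longleftrightarrow> x = x' \<and> h = h' \<and> p = p' \<and> q = q'"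
  proof
    assume "X = Y"
    hence "X div (d * d * d) = Y div (d * d * d)" "X mod (d * d * d) = Y mod (d * d * d)" by auto
    hence "x = x'" and 1: "(h * d + p) * d + q = (h' * d + p') * d + q'"
      using x x' lt by (auto simp: x(1) x'(1))
    from arg_cong[OF 1, of "\<lambda>z. z div d"] arg_cong[OF 1, of "\<lambda>z. z mod d"]
    have "q = q'" and 2: "h * d + p = h' * d + p'" using x x' by auto
    from arg_cong[OF 2, of "\<lambda>z. z div d"] arg_cong[OF 2, of "\<lambda>z. z mod d"]
    show "x = x' \<and> h = h' \<and> p = p' \<and> q = q'" using x x' \<open>x = x'\<close> \<open>q = q'\<close> by auto
  qed (use x x' in auto)
  thus "(\<Sum>a\<in>step_index d. \<Sum>i<d. cnj (step_kraus d s a i X) * step_kraus d s a i Y) =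
      (if X = Y then 1 else 0)"
    unfolding e kraus_complete_step_amp[OF x(2-5) x'(2-5) s] by (auto simp: kd_def)
qed

section \<open>The program state\<close>

lemma max_entangled_index:
  assumes "p < d" "q < d"
  shows "max_entangled d $ (p * d + q) = kd p q"
proof -
  have "max_entangled d $ (p * d + q) = (\<Sum>j<d. kd p j * kd q j)"
    using assms unfolding max_entangled_def
    by (auto simp: mult_split_less kron_vec_def kd_def intro!: sum.cong)
  also have "\<dots> = kd p q" using assms by (simp add: sum_kd kd_sym)
  finally show ?thesis .
qed

lemma program_vec_dim [simp]: "dim_row L = d \<Longrightarrow> dim_vec (program_vec d L) = d * d"
  by (simp add: program_vec_def kron_def)

text \<open>Row-wise vectorisation of \<open>L\<close>; the weak teleportation reads the matrix back
  from these coefficients.\<close>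

lemma program_vec_index:
  assumes L: "L \<in> carrier_mat d d" and pq: "p < d" "q < d"
  shows "program_vec d L $ (p * d + q) = L $$ (p, q)"
proof -
  have c: "kron L (1\<^sub>m d) \<in> carrier_mat (d * d) (d * d)" using L by simp
  have dim: "dim_vec (max_entangled d) = d * d" by (simp add: max_entangled_def)
  have "program_vec d L $ (p * d + q) =
      (\<Sum>r<d * d. kron L (1\<^sub>m d) $$ (p * d + q, r) * max_entangled d $ r)"
    using c pq dim unfolding program_vec_def
    by (simp add: scalar_prod_def atLeast0LessThan mult_split_less)
  also have "\<dots> = (\<Sum>p'<d. \<Sum>q'<d. kd p' q' * (kd q q' * L $$ (p, p')))"
    unfolding sum_mult_split using pq L
    by (intro sum.cong[OF refl]) (simp add: kron_index[OF L one_carrier_mat] max_entangled_index kd_def)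
  also have "\<dots> = (\<Sum>p'<d. kd q p' * L $$ (p, p'))"
    by (intro sum.cong[OF refl]) (simp add: sum_kd)
  also have "\<dots> = L $$ (p, q)" using pq by (simp add: sum_kd)
  finally show ?thesis .
qed

lemma ket_bra_carrier: "L \<in> carrier_mat d d \<Longrightarrow> ket_bra (program_vec d L) \<in> carrier_mat (d * d) (d * d)"
  by (auto simp: ket_bra_def)

lemma program_state_carrier:
  "\<sigma> \<in> carrier_mat d d \<Longrightarrow> L \<in> carrier_mat d d \<Longrightarrow> program_state d \<sigma> L \<in> carrier_mat (d * d * d) (d * d * d)"
  using kron_carrier[OF _ ket_bra_carrier, of \<sigma> d d L d] by (simp add: program_state_def mult.assoc)

lemma program_state_index:
  assumes \<sigma>: "\<sigma> \<in> carrier_mat d d" and L: "L \<in> carrier_mat d d"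
    and lt: "h < d" "p < d" "q < d" "h' < d" "p' < d" "q' < d"
  shows "program_state d \<sigma> L $$ ((h * d + p) * d + q, (h' * d + p') * d + q') =
    \<sigma> $$ (h, h') * (L $$ (p, q) * cnj (L $$ (p', q')))"
proof -
  have e: "(h * d + p) * d + q = h * (d * d) + (p * d + q)" for h p q by (simp add: algebra_simps)
  show ?thesis
    unfolding e program_state_def
    using lt carrier_matD(1)[OF L]
    by (subst kron_index[OF \<sigma> ket_bra_carrier[OF L]])
       (simp_all add: mult_split_less ket_bra_def program_vec_index[OF L])
qed

text \<open>Normalisation of the program vector. It gives the program trace 1 and sums out
  \<open>P\<close> and \<open>Q\<close> in the swap branch, which leaves them untouched.\<close>

lemma hs_norm_one:
  assumes "L \<in> carrier_mat d d" "hs_norm L = 1"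
  shows "(\<Sum>p<d. \<Sum>q<d. L $$ (p, q) * cnj (L $$ (p, q))) = 1"
proof -
  have "trace (mat_adjoint L * L) = (\<Sum>q<d. \<Sum>p<d. L $$ (p, q) * cnj (L $$ (p, q)))"
    using assms(1) by (simp add: trace_def mult_index[of _ d d _ d] mult.commute)
  also have "\<dots> = (\<Sum>p<d. \<Sum>q<d. complex_of_real ((cmod (L $$ (p, q)))\<^sup>2))"
    unfolding complex_norm_square by (rule sum.swap)
  finally have t: "trace (mat_adjoint L * L) = complex_of_real (\<Sum>p<d. \<Sum>q<d. (cmod (L $$ (p, q)))\<^sup>2)"
    by simp
  have "(\<Sum>p<d. \<Sum>q<d. (cmod (L $$ (p, q)))\<^sup>2) = 1"
    using assms(2) unfolding hs_norm_def t by simp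
  hence "complex_of_real (\<Sum>p<d. \<Sum>q<d. (cmod (L $$ (p, q)))\<^sup>2) = 1" by simp
  thus ?thesis by (simp add: complex_norm_square[symmetric])
qed

lemma hs_norm_entry:
  assumes "L \<in> carrier_mat d d" "hs_norm L = 1" "p < d" "q < d"
  shows "cmod (L $$ (p, q)) \<le> 1"
proof -
  have "complex_of_real (\<Sum>p<d. \<Sum>q<d. (cmod (L $$ (p, q)))\<^sup>2) = 1"
    using hs_norm_one[OF assms(1,2)] by (simp add: complex_norm_square[symmetric])
  hence 1: "(\<Sum>p<d. \<Sum>q<d. (cmod (L $$ (p, q)))\<^sup>2) = 1" by (simp only: of_real_eq_1_iff)
  have "(cmod (L $$ (p, q)))\<^sup>2 \<le> (\<Sum>q<d. (cmod (L $$ (p, q)))\<^sup>2)"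
    using assms(4) by (intro member_le_sum[of q "{..<d}" "\<lambda>q. (cmod (L $$ (p, q)))\<^sup>2"]) auto
  also have "\<dots> \<le> (\<Sum>p<d. \<Sum>q<d. (cmod (L $$ (p, q)))\<^sup>2)"
    using assms(3) by (intro member_le_sum[of p "{..<d}" "\<lambda>p. \<Sum>q<d. (cmod (L $$ (p, q)))\<^sup>2"])
      (auto intro: sum_nonneg)
  finally show ?thesis unfolding 1 by (simp add: abs_square_le_1)
qed

lemma trace_program_state:
  assumes "density_operator d \<sigma>" and L: "L \<in> carrier_mat d d" "hs_norm L = 1"
  shows "trace (program_state d \<sigma> L) = 1"
proof -
  have \<sigma>: "\<sigma> \<in> carrier_mat d d" "trace \<sigma> = 1"
    using assms(1) by (auto simp: density_operator_def psd_def)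
  have "trace (ket_bra (program_vec d L)) = (\<Sum>p<d. \<Sum>q<d. L $$ (p, q) * cnj (L $$ (p, q)))"
    using carrier_matD(1)[OF L(1)]
    by (simp add: trace_def ket_bra_def sum_mult_split mult_split_less program_vec_index[OF L(1)])
  thus ?thesis
    using hs_norm_one[OF L] \<sigma>(2) by (simp add: program_state_def trace_kron[OF \<sigma>(1) ket_bra_carrier[OF L(1)]])
qed

lemma quantum_channel_attach_program:
  assumes "density_operator d \<sigma>" and L: "L \<in> carrier_mat d d" "hs_norm L = 1"
  shows "quantum_channel d (d * (d * d * d)) (\<lambda>\<rho>. kron \<rho> (program_state d \<sigma> L))"
proof -
  have \<sigma>: "psd d \<sigma>" "\<sigma> \<in> carrier_mat d d"
    using assms(1) by (auto simp: density_operator_def psd_def)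
  obtain B where B: "\<And>i j. i < d \<Longrightarrow> j < d \<Longrightarrow> \<sigma> $$ (i, j) = (\<Sum>k<d. B $$ (i, k) * cnj (B $$ (j, k)))"
    using psd_factor[OF \<sigma>(1)] by blast
  define C where "C u g = B $$ (u div d div d, g) * L $$ (u div d mod d, u mod d)" for u g
  show ?thesis
  proof (rule quantum_channel_attach[OF program_state_carrier[OF \<sigma>(2) L(1)] trace_program_state[OF assms]])
    fix u w assume uw: "u < d * d * d" "w < d * d * d"
    note b = uw[THEN div_mod_less]
    note b' = b[THEN conjunct1, THEN div_mod_less]
    have "program_state d \<sigma> L $$ ((u div d div d * d + u div d mod d) * d + u mod d,
        (w div d div d * d + w div d mod d) * d + w mod d) =
      \<sigma> $$ (u div d div d, w div d div d) * (L $$ (u div d mod d, u mod d) * cnj (L $$ (w div d mod d, w mod d)))"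
      using b b' by (intro program_state_index \<sigma> L) auto
    thus "program_state d \<sigma> L $$ (u, w) = (\<Sum>g<d. C u g * cnj (C w g))"
      unfolding div_mult_mod_eq using b' by (simp add: B C_def sum_distrib_left sum_distrib_right mult_ac)
  qed
qed

text \<open>The program vector is pure, so its sums factor into \<open>v\<close> and the conjugate
  of \<open>v\<close>, where \<open>v a\<close> is the Kraus operator with \<open>L\<close>
  inserted. The state \<open>\<sigma>\<close> may be mixed and stays inside.\<close>

lemma step_channel_program_index:
  assumes \<rho>: "\<rho> \<in> carrier_mat d d" and \<sigma>: "\<sigma> \<in> carrier_mat d d" and L: "L \<in> carrier_mat d d"
    and ik: "i < d" "k < d"
    and v: "\<And>a h i x. v a h i x = (\<Sum>p<d. \<Sum>q<d. step_amp d s a h p q i x * L $$ (p, q))"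
  shows "step_channel d s (kron \<rho> (program_state d \<sigma> L)) $$ (i, k) =
    (\<Sum>a\<in>step_index d. \<Sum>x<d. \<Sum>h<d. v a h i x *
       (\<Sum>y<d. \<Sum>h'<d. cnj (v a h' k y) * (\<rho> $$ (x, y) * \<sigma> $$ (h, h'))))"
proof -
  let ?\<omega> = "program_state d \<sigma> L"
  note \<omega> = program_state_carrier[OF \<sigma> L]
  have amp: "step_kraus d s a i (x * (d * d * d) + ((h * d + p) * d + q)) = step_amp d s a h p q i x"
    if "h < d" "p < d" "q < d" for a i x h p q
  proof -
    have "(h * d + p) * d + q < d * d * d" using that by (intro mult_split_less; simp)+
    thus ?thesis using that by (simp add: step_kraus_def)
  qed
  have ent: "kron \<rho> ?\<omega> $$ (x * (d * d * d) + ((h * d + p) * d + q), y * (d * d * d) + ((h' * d + p') * d + q')) =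
      \<rho> $$ (x, y) * (\<sigma> $$ (h, h') * (L $$ (p, q) * cnj (L $$ (p', q'))))"
    if "x < d" "h < d" "p < d" "q < d" "y < d" "h' < d" "p' < d" "q' < d" for x h p q y h' p' q'
  proof -
    have "(h * d + p) * d + q < d * d * d" "(h' * d + p') * d + q' < d * d * d"
      using that by (intro mult_split_less; simp)+
    thus ?thesis using that by (simp only: kron_index[OF \<rho> \<omega>] program_state_index[OF \<sigma> L])
  qed
  have "step_channel d s (kron \<rho> ?\<omega>) $$ (i, k) =
    (\<Sum>a\<in>step_index d. \<Sum>x<d. \<Sum>h<d. \<Sum>p<d. \<Sum>q<d. \<Sum>y<d. \<Sum>h'<d. \<Sum>p'<d. \<Sum>q'<d.
      step_amp d s a h p q i x * (\<rho> $$ (x, y) * (\<sigma> $$ (h, h') * (L $$ (p, q) * cnj (L $$ (p', q'))))) *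
      cnj (step_amp d s a h' p' q' k y))"
    unfolding step_channel_def kraus_index[OF ik] sum_mult_split
    by (intro sum.cong[OF refl]) (simp only: amp ent lessThan_iff)
  also have "\<dots> = (\<Sum>a\<in>step_index d. \<Sum>x<d. \<Sum>h<d. v a h i x *
       (\<Sum>y<d. \<Sum>h'<d. cnj (v a h' k y) * (\<rho> $$ (x, y) * \<sigma> $$ (h, h'))))"
    unfolding v cnj_sum complex_cnj_mult sum_distrib_right
    by (intro sum.cong[OF refl]) (simp only: sum_distrib_left mult_ac)
  finally show ?thesis .
qed

text \<open>The summands are the three branches. The swap, traced over \<open>H\<close>, yields the
  commutator at first order and \<open>\<sigma>\<close> at second order; the jump yields
  \<open>L * \<rho> * mat_adjoint L\<close>; the no-jump operator yields the anticommutator at first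
  order.\<close>

lemma step_channel_program:
  fixes s :: real
  assumes \<rho>: "\<rho> \<in> carrier_mat d d" and \<sigma>: "density_operator d \<sigma>"
    and L: "L \<in> carrier_mat d d" "hs_norm L = 1"
    and ik: "i < d" "k < d" and s: "0 \<le> s" "s * d \<le> 1"
  shows "step_channel d s (kron \<rho> (program_state d \<sigma> L)) $$ (i, k) =
     complex_of_real (1 / (2 * (1 + 4 * s\<^sup>2))) * (\<rho> $$ (i, k) - 2 * \<i> * s * (\<sigma> * \<rho>) $$ (i, k)
       + 2 * \<i> * s * (\<rho> * \<sigma>) $$ (i, k) + 4 * s\<^sup>2 * (trace \<rho> * \<sigma> $$ (i, k)))
   + complex_of_real ((2 * s - d * s\<^sup>2) / 2) * (L * \<rho> * mat_adjoint L) $$ (i, k)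
   + complex_of_real (1 / 2) * (\<rho> $$ (i, k) - s * (\<rho> * (mat_adjoint L * L)) $$ (i, k)
       - s * (mat_adjoint L * L * \<rho>) $$ (i, k) + s\<^sup>2 * (kd i k * trace (L * \<rho> * mat_adjoint L)))"
proof -
  have d: "0 < d" using ik by auto
  have \<sigma>c: "\<sigma> \<in> carrier_mat d d" and tr\<sigma>: "(\<Sum>h<d. \<sigma> $$ (h, h)) = 1"
    using \<sigma> by (auto simp: density_operator_def psd_def trace_def)
  note LL = hs_norm_one[OF L]
  define g0 where "g0 = complex_of_real (sqrt (1 / (2 * (1 + 4 * s\<^sup>2))))"
  define g1 where "g1 = complex_of_real (sqrt ((2 * s - d * s\<^sup>2) / 2))"
  define g2 where "g2 = complex_of_real (sqrt (1 / 2))"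
  define \<beta> where "\<beta> = 2 * \<i> * complex_of_real s"
  have cnjs: "cnj g0 = g0" "cnj g1 = g1" "cnj g2 = g2" "cnj \<beta> = - \<beta>"
    by (simp_all add: g0_def g1_def g2_def \<beta>_def)
  have "s * (s * d) \<le> s * 2" using s by (intro mult_left_mono) auto
  hence nn: "0 \<le> 2 * s - d * s\<^sup>2" by (simp add: power2_eq_square mult_ac)
  have gg: "g0 * g0 = complex_of_real (1 / (2 * (1 + 4 * s\<^sup>2)))"
    "g1 * g1 = complex_of_real ((2 * s - d * s\<^sup>2) / 2)" "g2 * g2 = complex_of_real (1 / 2)"
    unfolding g0_def g1_def g2_def using nn by (intro of_real_sqrt_square; simp)+
  define v where "v a h i x = (\<Sum>p<d. \<Sum>q<d. step_amp d s a h p q i x * L $$ (p, q))" for a h i x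
  have v0: "v (0, h0, p0, q0) h i x = g0 * L $$ (p0, q0) * (kd h0 h * kd i x + - \<beta> * (kd i h * kd x h0))"
    if "p0 < d" "q0 < d" for h0 p0 q0 h i x
  proof -
    have "v (0, h0, p0, q0) h i x = (\<Sum>p<d. kd p0 p * (\<Sum>q<d. kd q0 q *
        (g0 * L $$ (p, q) * (kd h0 h * kd i x + - \<beta> * (kd i h * kd x h0)))))"
    proof -
      have "step_amp d s (0, h0, p0, q0) h p q i x =
          g0 * (kd p0 p * kd q0 q * (kd h0 h * kd i x + - \<beta> * (kd i h * kd x h0)))" for p q
        unfolding step_amp_def g0_def \<beta>_def by simp
      thus ?thesis unfolding v_def sum_distrib_left by (simp only: mult_ac)
    qed
    thus ?thesis using that by (simp add: sum_kd)
  qed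
  \<comment> \<open>Contracting \<open>kd i p * kd x q\<close> with the program vector leaves an
    entry of \<open>L\<close>: this is the teleported action on the system.\<close>
  have v1: "v (1, h0, p0, q0) h i x = g1 * kd p0 0 * kd q0 0 * kd h0 h * L $$ (i, x)"
    if "i < d" "x < d" for h0 p0 q0 h i x
  proof -
    have "v (1, h0, p0, q0) h i x = (\<Sum>p<d. kd i p * (\<Sum>q<d. kd x q *
        (g1 * kd p0 0 * kd q0 0 * kd h0 h * L $$ (p, q))))"
      unfolding v_def sum_distrib_left
      by (intro sum.cong[OF refl]) (simp add: step_amp_def flip: g1_def)
    thus ?thesis using that by (simp add: sum_kd)
  qed
  have v2: "v (2, h0, p0, q0) h i x = g2 * kd h0 h * (L $$ (p0, q0) * kd i x - s * kd i q0 * L $$ (p0, x))"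
    if "p0 < d" "q0 < d" "x < d" for h0 p0 q0 h i x
  proof -
    have "v (2, h0, p0, q0) h i x = (\<Sum>p<d. kd p0 p * (\<Sum>q<d. kd q0 q * (g2 * kd h0 h * kd i x * L $$ (p, q)))) -
       (\<Sum>p<d. kd p0 p * (\<Sum>q<d. kd x q * (g2 * kd h0 h * s * kd i q0 * L $$ (p, q))))"
      unfolding v_def sum_distrib_left sum_subtractf[symmetric]
      by (intro sum.cong[OF refl]) (simp add: step_amp_def algebra_simps flip: g2_def)
    thus ?thesis using that by (simp only: sum_kd) (simp only: right_diff_distrib mult_ac)
  qed
  define F where "F a = (\<Sum>x<d. \<Sum>h<d. v a h i x *
       (\<Sum>y<d. \<Sum>h'<d. cnj (v a h' k y) * (\<rho> $$ (x, y) * \<sigma> $$ (h, h'))))" for a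
  have F0: "(\<Sum>h<d. \<Sum>p<d. \<Sum>q<d. F (0, h, p, q)) = g0 * g0 * (\<rho> $$ (i, k) - \<beta> * (\<sigma> * \<rho>) $$ (i, k)
       + \<beta> * (\<rho> * \<sigma>) $$ (i, k) - \<beta> * \<beta> * (trace \<rho> * \<sigma> $$ (i, k)))"
  proof -
    have "F (0, h0, p0, q0) = L $$ (p0, q0) * cnj (L $$ (p0, q0)) * (g0 * g0 *
        (\<rho> $$ (i, k) * \<sigma> $$ (h0, h0) + \<beta> * (\<rho> $$ (i, h0) * \<sigma> $$ (h0, k)) +
         - \<beta> * (\<rho> $$ (h0, k) * \<sigma> $$ (i, h0) + \<beta> * (\<rho> $$ (h0, h0) * \<sigma> $$ (i, k)))))"
      if lt: "h0 < d" "p0 < d" "q0 < d" for h0 p0 q0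
    proof -
      have "(\<Sum>y<d. \<Sum>h'<d. cnj (v (0, h0, p0, q0) h' k y) * (\<rho> $$ (x, y) * \<sigma> $$ (h, h'))) =
        g0 * cnj (L $$ (p0, q0)) * (\<rho> $$ (x, k) * \<sigma> $$ (h, h0) + \<beta> * (\<rho> $$ (x, h0) * \<sigma> $$ (h, k)))" for x h
      proof -
        have "cnj (v (0, h0, p0, q0) h' k y) = g0 * cnj (L $$ (p0, q0)) *
            (kd h0 h' * kd k y + \<beta> * (kd k h' * kd y h0))" for h' y
          unfolding v0[OF lt(2,3)] by (simp add: cnjs)
        thus ?thesis using lt ik
          by (simp only: mult.assoc[of "g0 * cnj (L $$ (p0, q0))"] sum_distrib_left[symmetric] sum_two_kd)
      qed
      hence "F (0, h0, p0, q0) = (\<Sum>x<d. \<Sum>h<d. g0 * L $$ (p0, q0) * ((kd h0 h * kd i x + - \<beta> * (kd i h * kd x h0)) *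
         (g0 * cnj (L $$ (p0, q0)) * (\<rho> $$ (x, k) * \<sigma> $$ (h, h0) + \<beta> * (\<rho> $$ (x, h0) * \<sigma> $$ (h, k))))))"
        unfolding F_def v0[OF lt(2,3)] by (simp only: mult.assoc)
      also have "\<dots> = g0 * L $$ (p0, q0) * (g0 * cnj (L $$ (p0, q0)) * (\<rho> $$ (i, k) * \<sigma> $$ (h0, h0) + \<beta> * (\<rho> $$ (i, h0) * \<sigma> $$ (h0, k))) +
         - \<beta> * (g0 * cnj (L $$ (p0, q0)) * (\<rho> $$ (h0, k) * \<sigma> $$ (i, h0) + \<beta> * (\<rho> $$ (h0, h0) * \<sigma> $$ (i, k)))))"
        using lt ik by (simp only: sum_distrib_left[symmetric] sum_two_kd)
      finally show ?thesis by (simp add: algebra_simps)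
    qed
    hence "(\<Sum>h<d. \<Sum>p<d. \<Sum>q<d. F (0, h, p, q)) = (\<Sum>h0<d. (\<Sum>p<d. \<Sum>q<d. L $$ (p, q) * cnj (L $$ (p, q))) * (g0 * g0 *
        (\<rho> $$ (i, k) * \<sigma> $$ (h0, h0) + \<beta> * (\<rho> $$ (i, h0) * \<sigma> $$ (h0, k)) +
         - \<beta> * (\<rho> $$ (h0, k) * \<sigma> $$ (i, h0) + \<beta> * (\<rho> $$ (h0, h0) * \<sigma> $$ (i, k))))))"
      by (simp add: sum_distrib_right)
    also have "\<dots> = g0 * g0 * (\<rho> $$ (i, k) * (\<Sum>h<d. \<sigma> $$ (h, h)) + \<beta> * (\<Sum>h<d. \<rho> $$ (i, h) * \<sigma> $$ (h, k)) +
         - \<beta> * ((\<Sum>h<d. \<sigma> $$ (i, h) * \<rho> $$ (h, k)) + \<beta> * (\<sigma> $$ (i, k) * (\<Sum>h<d. \<rho> $$ (h, h)))))"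
      unfolding LL by (simp add: sum_distrib_left sum.distrib sum_negf sum_subtractf algebra_simps)
    finally show ?thesis using \<rho> \<sigma>c ik unfolding tr\<sigma>
      by (simp add: mult_index[of _ d d _ d] trace_def algebra_simps)
  qed
  have LRL: "(L * \<rho> * mat_adjoint L) $$ (i, k) = (\<Sum>x<d. L $$ (i, x) * (\<Sum>y<d. cnj (L $$ (k, y)) * \<rho> $$ (x, y)))"
    if "i < d" "k < d" for i k
  proof -
    have "(L * \<rho> * mat_adjoint L) $$ (i, k) = (\<Sum>x<d. \<Sum>y<d. L $$ (i, x) * \<rho> $$ (x, y) * cnj (L $$ (k, y)))"
      using conj_index[OF \<rho> mat_adjoint_carrier[OF L(1)] that] L(1) that by simp
    thus ?thesis by (simp add: sum_distrib_left mult_ac)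
  qed
  have F1: "(\<Sum>h<d. \<Sum>p<d. \<Sum>q<d. F (1, h, p, q)) = g1 * g1 * (L * \<rho> * mat_adjoint L) $$ (i, k)"
  proof -
    have "F (1, h0, p0, q0) = kd p0 0 * (kd q0 0 * (g1 * g1 * (\<sigma> $$ (h0, h0) * (L * \<rho> * mat_adjoint L) $$ (i, k))))"
      if lt: "h0 < d" "p0 < d" "q0 < d" for h0 p0 q0
    proof -
      have "F (1, h0, p0, q0) = (\<Sum>x<d. \<Sum>h<d. kd h0 h * (\<Sum>y<d. \<Sum>h'<d. kd h0 h' * (kd p0 0 * kd q0 0 * (kd p0 0 * kd q0 0) * (g1 * g1 *
          (L $$ (i, x) * cnj (L $$ (k, y)) * (\<rho> $$ (x, y) * \<sigma> $$ (h, h')))))))"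
        unfolding F_def sum_distrib_left
        by (intro sum.cong[OF refl]) (simp only: v1 ik lessThan_iff complex_cnj_mult cnjs kd_cnj mult_ac)
      also have "\<dots> = (\<Sum>x<d. \<Sum>y<d. kd p0 0 * kd q0 0 * (kd p0 0 * kd q0 0) * (g1 * g1 *
          (L $$ (i, x) * cnj (L $$ (k, y)) * (\<rho> $$ (x, y) * \<sigma> $$ (h0, h0)))))"
        using lt by (simp only: sum_kd)
      also have "kd p0 0 * kd q0 0 * (kd p0 0 * kd q0 0) = kd p0 0 * kd q0 0" by (simp add: kd_def)
      finally show ?thesis unfolding LRL[OF ik] by (simp add: sum_distrib_left mult_ac)
    qed
    hence "(\<Sum>h<d. \<Sum>p<d. \<Sum>q<d. F (1, h, p, q)) = (\<Sum>h0<d. \<Sum>p0<d. kd p0 0 * (\<Sum>q0<d. kd q0 0 *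
        (g1 * g1 * (\<sigma> $$ (h0, h0) * (L * \<rho> * mat_adjoint L) $$ (i, k)))))"
      by (simp add: sum_distrib_left)
    also have "\<dots> = g1 * g1 * ((\<Sum>h<d. \<sigma> $$ (h, h)) * (L * \<rho> * mat_adjoint L) $$ (i, k))"
      using d by (simp add: sum_kd sum_distrib_left sum_distrib_right)
    finally show ?thesis by (simp add: tr\<sigma>)
  qed
  have LLR: "(mat_adjoint L * L * \<rho>) $$ (i, k) = (\<Sum>p<d. cnj (L $$ (p, i)) * (\<Sum>x<d. L $$ (p, x) * \<rho> $$ (x, k)))"
  proof -
    have "mat_adjoint L * L * \<rho> = mat_adjoint L * (L * \<rho>)" using L \<rho> by (simp add: mult_assoc_dim)
    thus ?thesis using L \<rho> ik by (simp add: mult_index[of _ d d _ d])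
  qed
  have RLL: "(\<rho> * (mat_adjoint L * L)) $$ (i, k) = (\<Sum>p<d. L $$ (p, k) * (\<Sum>y<d. cnj (L $$ (p, y)) * \<rho> $$ (i, y)))"
  proof -
    have "\<rho> * (mat_adjoint L * L) = \<rho> * mat_adjoint L * L" using L \<rho> by (simp add: mult_assoc_dim)
    thus ?thesis using L \<rho> ik by (simp add: mult_index[of _ d d _ d] mult.commute)
  qed
  have F2: "(\<Sum>h<d. \<Sum>p<d. \<Sum>q<d. F (2, h, p, q)) = g2 * g2 * (\<rho> $$ (i, k) - s * (\<rho> * (mat_adjoint L * L)) $$ (i, k)
       - s * (mat_adjoint L * L * \<rho>) $$ (i, k) + s\<^sup>2 * (kd i k * trace (L * \<rho> * mat_adjoint L)))"
  proof -
    \<comment> \<open>\<open>B p x\<close> is the entry \<open>(x, p)\<close> of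
      \<open>\<rho> * mat_adjoint L\<close>; \<open>E p q\<close> is the no-jump operator applied on
      both sides, for the traced-out value \<open>(p, q)\<close> of the program.\<close>
    define B where "B p x = (\<Sum>y<d. cnj (L $$ (p, y)) * \<rho> $$ (x, y))" for p x
    define E where "E p q = L $$ (p, q) * (cnj (L $$ (p, q)) * \<rho> $$ (i, k) - s * kd k q * B p i) -
        s * kd i q * (\<Sum>x<d. L $$ (p, x) * (cnj (L $$ (p, q)) * \<rho> $$ (x, k) - s * kd k q * B p x))" for p q
    have "F (2, h0, p0, q0) = g2 * g2 * (\<sigma> $$ (h0, h0) * E p0 q0)" if lt: "h0 < d" "p0 < d" "q0 < d" for h0 p0 q0
    proof -
      let ?w = "\<lambda>i x. L $$ (p0, q0) * kd i x - s * kd i q0 * L $$ (p0, x)"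
      have inner: "(\<Sum>y<d. cnj (?w k y) * \<rho> $$ (x, y)) = cnj (L $$ (p0, q0)) * \<rho> $$ (x, k) - s * kd k q0 * B p0 x" for x
      proof -
        have "(\<Sum>y<d. cnj (?w k y) * \<rho> $$ (x, y)) =
          (\<Sum>y<d. kd k y * (cnj (L $$ (p0, q0)) * \<rho> $$ (x, y))) - s * kd k q0 * B p0 x"
          unfolding B_def sum_distrib_left sum_subtractf[symmetric]
          by (intro sum.cong[OF refl]) (simp add: algebra_simps)
        thus ?thesis using ik by (simp add: sum_kd)
      qed
      have outer: "(\<Sum>x<d. ?w i x * (cnj (L $$ (p0, q0)) * \<rho> $$ (x, k) - s * kd k q0 * B p0 x)) = E p0 q0"
      proof -
        have "(\<Sum>x<d. ?w i x * (cnj (L $$ (p0, q0)) * \<rho> $$ (x, k) - s * kd k q0 * B p0 x)) =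
          (\<Sum>x<d. kd i x * (L $$ (p0, q0) * (cnj (L $$ (p0, q0)) * \<rho> $$ (x, k) - s * kd k q0 * B p0 x))) -
          s * kd i q0 * (\<Sum>x<d. L $$ (p0, x) * (cnj (L $$ (p0, q0)) * \<rho> $$ (x, k) - s * kd k q0 * B p0 x))"
          unfolding sum_distrib_left sum_subtractf[symmetric]
          by (intro sum.cong[OF refl]) (simp add: left_diff_distrib mult_ac)
        thus ?thesis using ik by (simp add: sum_kd E_def)
      qed
      have "F (2, h0, p0, q0) = (\<Sum>x<d. \<Sum>h<d. kd h0 h * (\<Sum>y<d. \<Sum>h'<d. kd h0 h' * (g2 * g2 *
          (?w i x * cnj (?w k y) * (\<rho> $$ (x, y) * \<sigma> $$ (h, h'))))))"
        unfolding F_def sum_distrib_left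
        by (intro sum.cong[OF refl]) (simp add: v2 lt cnjs)
      also have "\<dots> = (\<Sum>x<d. \<Sum>y<d. g2 * g2 * (?w i x * cnj (?w k y) * (\<rho> $$ (x, y) * \<sigma> $$ (h0, h0))))"
        using lt by (simp only: sum_kd)
      also have "\<dots> = g2 * g2 * (\<sigma> $$ (h0, h0) * (\<Sum>x<d. ?w i x * (\<Sum>y<d. cnj (?w k y) * \<rho> $$ (x, y))))"
        by (simp only: sum_distrib_left mult_ac)
      finally show ?thesis unfolding inner outer .
    qed
    hence "(\<Sum>h<d. \<Sum>p<d. \<Sum>q<d. F (2, h, p, q)) = (\<Sum>h<d. \<Sum>p<d. \<Sum>q<d. g2 * g2 * (\<sigma> $$ (h, h) * E p q))"
      by simp
    also have "\<dots> = g2 * g2 * ((\<Sum>h<d. \<sigma> $$ (h, h)) * (\<Sum>p<d. \<Sum>q<d. E p q))"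
      by (simp only: sum_distrib_right) (simp only: sum_distrib_left)
    also have "(\<Sum>p<d. \<Sum>q<d. E p q) = (\<Sum>p<d. \<Sum>q<d. L $$ (p, q) * cnj (L $$ (p, q))) * \<rho> $$ (i, k)
      - s * (\<Sum>p<d. \<Sum>q<d. kd k q * (L $$ (p, q) * B p i))
      - s * (\<Sum>p<d. \<Sum>q<d. kd i q * (cnj (L $$ (p, q)) * (\<Sum>x<d. L $$ (p, x) * \<rho> $$ (x, k))))
      + s\<^sup>2 * (\<Sum>p<d. \<Sum>q<d. kd i q * (kd k q * (\<Sum>x<d. L $$ (p, x) * B p x)))"
    proof -
      have "E p q = L $$ (p, q) * cnj (L $$ (p, q)) * \<rho> $$ (i, k) - s * (kd k q * (L $$ (p, q) * B p i))
        - s * (kd i q * (cnj (L $$ (p, q)) * (\<Sum>x<d. L $$ (p, x) * \<rho> $$ (x, k))))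
        + s\<^sup>2 * (kd i q * (kd k q * (\<Sum>x<d. L $$ (p, x) * B p x)))" for p q
        unfolding E_def right_diff_distrib sum_subtractf
        by (simp add: sum_distrib_left power2_eq_square mult_ac)
      thus ?thesis by (simp add: sum.distrib sum_subtractf sum_distrib_left sum_distrib_right)
    qed
    also have "\<dots> = \<rho> $$ (i, k) - s * (\<rho> * (mat_adjoint L * L)) $$ (i, k)
       - s * (mat_adjoint L * L * \<rho>) $$ (i, k) + s\<^sup>2 * (kd i k * trace (L * \<rho> * mat_adjoint L))"
    proof -
      have t: "trace (L * \<rho> * mat_adjoint L) = (\<Sum>p<d. \<Sum>x<d. L $$ (p, x) * B p x)"
        using L(1) by (simp add: trace_def LRL B_def)
      show ?thesis using ik unfolding LL LLR RLL t B_def[symmetric]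
        by (simp only: sum_kd mult_1) (simp only: kd_sym[of k i] sum_distrib_left)
    qed
    finally show ?thesis by (simp add: tr\<sigma>)
  qed
  have bb: "\<beta> * \<beta> = - (4 * complex_of_real (s\<^sup>2))" by (simp add: \<beta>_def power2_eq_square algebra_simps)
  show ?thesis
    unfolding step_channel_program_index[OF \<rho> \<sigma>c L(1) ik v_def] F_def[symmetric] sum_step_index F0 F1 F2 gg bb
    by (simp only: \<beta>_def minus_mult_left[symmetric] diff_minus_eq_add mult.assoc)
       (simp only: of_real_mult of_real_numeral mult.assoc)
qed

section \<open>The step agrees with the Lindbladian to first order\<close>

lemma lindbladian_index:
  assumes "\<sigma> \<in> carrier_mat d d" "L \<in> carrier_mat d d" "\<rho> \<in> carrier_mat d d" "i < d" "k < d"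
  shows "lindbladian \<sigma> L \<rho> $$ (i, k) = - \<i> * ((\<sigma> * \<rho>) $$ (i, k) - (\<rho> * \<sigma>) $$ (i, k))
    + (L * \<rho> * mat_adjoint L) $$ (i, k)
    - 1 / 2 * ((mat_adjoint L * L * \<rho>) $$ (i, k) + (\<rho> * (mat_adjoint L * L)) $$ (i, k))"
  using assms by (simp add: lindbladian_def commutator_def anticommutator_def)

lemma lindbladian_carrier:
  assumes "\<sigma> \<in> carrier_mat d d" "L \<in> carrier_mat d d" "\<rho> \<in> carrier_mat d d"
  shows "lindbladian \<sigma> L \<rho> \<in> carrier_mat d d"
  using assms by (auto simp: lindbladian_def commutator_def anticommutator_def)

lemma linear_superop_lindbladian:
  assumes \<sigma>: "\<sigma> \<in> carrier_mat d d" and L: "L \<in> carrier_mat d d"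
  shows "linear_superop d d (lindbladian \<sigma> L)"
  unfolding linear_superop_def
proof (intro conjI ballI allI)
  note L' = mat_adjoint_carrier[OF L]
  note LL = mult_carrier_mat[OF L' L]
  fix A B :: "complex mat" assume A: "A \<in> carrier_mat d d" and B: "B \<in> carrier_mat d d"
  note LA = mult_carrier_mat[OF L A] and LB = mult_carrier_mat[OF L B]
  have AB: "A + B \<in> carrier_mat d d" using A B by simp
  show "lindbladian \<sigma> L (A + B) = lindbladian \<sigma> L A + lindbladian \<sigma> L B"
  proof (rule eq_matI)
    fix i k assume "i < dim_row (lindbladian \<sigma> L A + lindbladian \<sigma> L B)"
      "k < dim_col (lindbladian \<sigma> L A + lindbladian \<sigma> L B)"
    hence ik: "i < d" "k < d" using carrier_matD[OF lindbladian_carrier[OF \<sigma> L B]] by auto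
    show "lindbladian \<sigma> L (A + B) $$ (i, k) = (lindbladian \<sigma> L A + lindbladian \<sigma> L B) $$ (i, k)"
      using \<sigma> L A B ik carrier_matD[OF lindbladian_carrier[OF \<sigma> L A]] carrier_matD[OF lindbladian_carrier[OF \<sigma> L B]]
      by (simp add: lindbladian_index[OF \<sigma> L _ ik] mult_add_distrib_mat[OF \<sigma> A B] add_mult_distrib_mat[OF A B \<sigma>]
          mult_add_distrib_mat[OF L A B] add_mult_distrib_mat[OF LA LB L'] mult_add_distrib_mat[OF LL A B]
          add_mult_distrib_mat[OF A B LL] algebra_simps add_divide_distrib)
  qed (use carrier_matD[OF lindbladian_carrier[OF \<sigma> L AB]] carrier_matD[OF lindbladian_carrier[OF \<sigma> L B]] in auto)
next
  note L' = mat_adjoint_carrier[OF L]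
  note LL = mult_carrier_mat[OF L' L]
  fix c and A :: "complex mat" assume A: "A \<in> carrier_mat d d"
  note LA = mult_carrier_mat[OF L A]
  have cA: "c \<cdot>\<^sub>m A \<in> carrier_mat d d" using A by simp
  show "lindbladian \<sigma> L (c \<cdot>\<^sub>m A) = c \<cdot>\<^sub>m lindbladian \<sigma> L A"
  proof (rule eq_matI)
    fix i k assume "i < dim_row (c \<cdot>\<^sub>m lindbladian \<sigma> L A)" "k < dim_col (c \<cdot>\<^sub>m lindbladian \<sigma> L A)"
    hence ik: "i < d" "k < d" using carrier_matD[OF lindbladian_carrier[OF \<sigma> L A]] by auto
    show "lindbladian \<sigma> L (c \<cdot>\<^sub>m A) $$ (i, k) = (c \<cdot>\<^sub>m lindbladian \<sigma> L A) $$ (i, k)"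
      using \<sigma> L A ik carrier_matD[OF lindbladian_carrier[OF \<sigma> L A]]
      by (simp add: lindbladian_index[OF \<sigma> L _ ik] mult_smult_distrib[OF \<sigma> A] mult_smult_assoc_mat[OF A \<sigma>]
          mult_smult_distrib[OF L A] mult_smult_assoc_mat[OF LA L'] mult_smult_distrib[OF LL A]
          mult_smult_assoc_mat[OF A LL] algebra_simps)
  qed (use carrier_matD[OF lindbladian_carrier[OF \<sigma> L cA]] carrier_matD[OF lindbladian_carrier[OF \<sigma> L A]] in auto)
qed (rule lindbladian_carrier[OF \<sigma> L])

text \<open>Hermiticity preservation, which \<open>jbound_id_tensor_bounded\<close> requires of the
  generator.\<close>

lemma lindbladian_adjoint:
  assumes \<sigma>: "hermitian d \<sigma>" and L: "L \<in> carrier_mat d d" and A: "A \<in> carrier_mat d d"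
  shows "lindbladian \<sigma> L (mat_adjoint A) = mat_adjoint (lindbladian \<sigma> L A)"
proof -
  note \<sigma>c = hermitianD(1)[OF \<sigma>]
  note L' = mat_adjoint_carrier[OF L] and A' = mat_adjoint_carrier[OF A]
  note LL = mult_carrier_mat[OF L' L]
  note c = carrier_matD[OF lindbladian_carrier[OF \<sigma>c L A]] carrier_matD[OF lindbladian_carrier[OF \<sigma>c L A']]
  have adjs: "\<sigma> * mat_adjoint A = mat_adjoint (A * \<sigma>)" "mat_adjoint A * \<sigma> = mat_adjoint (\<sigma> * A)"
    by (simp_all add: mat_adjoint_mult[OF A \<sigma>c] mat_adjoint_mult[OF \<sigma>c A] hermitian_adjoint[OF \<sigma>])
  have LLa: "mat_adjoint (mat_adjoint L * L) = mat_adjoint L * L"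
    by (simp add: mat_adjoint_mult[OF L' L])
  have adjs': "mat_adjoint L * L * mat_adjoint A = mat_adjoint (A * (mat_adjoint L * L))"
    "mat_adjoint A * (mat_adjoint L * L) = mat_adjoint (mat_adjoint L * L * A)"
    by (simp_all add: mat_adjoint_mult[OF A LL] mat_adjoint_mult[OF LL A] LLa)
  have adjs'': "L * mat_adjoint A * mat_adjoint L = mat_adjoint (L * A * mat_adjoint L)"
    unfolding mat_adjoint_mult[OF mult_carrier_mat[OF L A] L'] mat_adjoint_mult[OF L A] mat_adjoint_adjoint
    using L A by (simp add: mult_assoc_dim)
  show ?thesis
    unfolding eq_commute[of _ "mat_adjoint (lindbladian \<sigma> L A)"]
  proof (rule eq_matI)
    fix i k assume "i < dim_row (lindbladian \<sigma> L (mat_adjoint A))" "k < dim_col (lindbladian \<sigma> L (mat_adjoint A))"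
    hence ik: "i < d" "k < d" using c by auto
    show "mat_adjoint (lindbladian \<sigma> L A) $$ (i, k) = lindbladian \<sigma> L (mat_adjoint A) $$ (i, k)"
      using ik c \<sigma>c L A
      by (simp add: lindbladian_index[OF \<sigma>c L A ik(2,1)] lindbladian_index[OF \<sigma>c L A' ik] adjs adjs' adjs'' algebra_simps)
  qed (use c in auto)
qed

lemma mult_entry_bound:
  fixes A B :: "complex mat"
  assumes "A \<in> carrier_mat d d" "B \<in> carrier_mat d d"
    and "\<And>i j. i < d \<Longrightarrow> j < d \<Longrightarrow> cmod (A $$ (i, j)) \<le> a"
    and "\<And>i j. i < d \<Longrightarrow> j < d \<Longrightarrow> cmod (B $$ (i, j)) \<le> b"
    and ij: "i < d" "j < d"
  shows "cmod ((A * B) $$ (i, j)) \<le> d * (a * b)"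
proof -
  have "cmod ((A * B) $$ (i, j)) \<le> (\<Sum>k<d. cmod (A $$ (i, k) * B $$ (k, j)))"
    unfolding mult_index[OF assms(1,2) ij] by (rule norm_sum)
  also have "\<dots> \<le> (\<Sum>k<d. a * b)"
    unfolding norm_mult using assms(3,4) ij
    by (intro sum_mono mult_mono) (auto intro: order.trans[OF norm_ge_zero])
  finally show ?thesis by simp
qed

lemma trace_entry_bound:
  assumes "A \<in> carrier_mat d d" "\<And>i j. i < d \<Longrightarrow> j < d \<Longrightarrow> cmod (A $$ (i, j)) \<le> a"
  shows "cmod (trace A) \<le> d * a"
proof -
  have "cmod (trace A) \<le> (\<Sum>i<d. cmod (A $$ (i, i)))"
    using assms(1) norm_sum[of "\<lambda>i. A $$ (i, i)" "{..<d}"] by (simp add: trace_def)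
  also have "\<dots> \<le> (\<Sum>i<d. a)" using assms(2) by (intro sum_mono) auto
  finally show ?thesis by simp
qed

text \<open>Trace 1 bounds the entries of \<open>\<sigma>\<close> by 1, the Hilbert-Schmidt norm
  those of \<open>L\<close>, and each matrix product costs a factor \<open>d\<close>. This makes all
  later constants depend on \<open>d\<close> alone.\<close>

lemma lindblad_term_bounds:
  assumes \<rho>: "\<rho> \<in> carrier_mat d d" "\<forall>i<d. \<forall>j<d. cmod (\<rho> $$ (i, j)) \<le> 1"
    and \<sigma>: "density_operator d \<sigma>" and L: "L \<in> carrier_mat d d" "hs_norm L = 1"
    and ik: "i < d" "k < d"
  shows "cmod ((\<sigma> * \<rho>) $$ (i, k)) \<le> d" "cmod ((\<rho> * \<sigma>) $$ (i, k)) \<le> d"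
    "cmod (\<sigma> $$ (i, k)) \<le> 1" "cmod ((L * \<rho> * mat_adjoint L) $$ (i, k)) \<le> (real d)\<^sup>2"
    "cmod ((mat_adjoint L * L * \<rho>) $$ (i, k)) \<le> (real d)\<^sup>2"
    "cmod ((\<rho> * (mat_adjoint L * L)) $$ (i, k)) \<le> (real d)\<^sup>2"
    "cmod (trace \<rho>) \<le> d" "cmod (trace (L * \<rho> * mat_adjoint L)) \<le> real d ^ 3"
proof -
  have \<sigma>c: "\<sigma> \<in> carrier_mat d d" and \<sigma>1: "cmod (\<sigma> $$ (i, j)) \<le> 1" if "i < d" "j < d" for i j
    using \<sigma> psd_entry_bound[OF _ that, of \<sigma>] psd_carrier[of d \<sigma>] by (auto simp: density_operator_def)
  note \<sigma>c = \<sigma>c[OF ik]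
  have \<rho>1: "cmod (\<rho> $$ (i, j)) \<le> 1" if "i < d" "j < d" for i j using \<rho>(2) that by auto
  have L1: "cmod (L $$ (i, j)) \<le> 1" if "i < d" "j < d" for i j using hs_norm_entry[OF L that] .
  note L' = mat_adjoint_carrier[OF L(1)]
  have L'1: "cmod (mat_adjoint L $$ (i, j)) \<le> 1" if "i < d" "j < d" for i j
    using L1[OF that(2,1)] L(1) that by simp
  note LL = mult_carrier_mat[OF L' L(1)] and LR = mult_carrier_mat[OF L(1) \<rho>(1)]
  have LL1: "cmod ((mat_adjoint L * L) $$ (i, j)) \<le> d" if "i < d" "j < d" for i j
    using mult_entry_bound[OF L' L(1) L'1 L1 that] by simp
  have LR1: "cmod ((L * \<rho>) $$ (i, j)) \<le> d" if "i < d" "j < d" for i j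
    using mult_entry_bound[OF L(1) \<rho>(1) L1 \<rho>1 that] by simp
  have LRL: "cmod ((L * \<rho> * mat_adjoint L) $$ (i, j)) \<le> (real d)\<^sup>2" if "i < d" "j < d" for i j
    using mult_entry_bound[OF LR L' LR1 L'1 that] by (simp add: power2_eq_square)
  show "cmod ((\<sigma> * \<rho>) $$ (i, k)) \<le> d" using mult_entry_bound[OF \<sigma>c \<rho>(1) \<sigma>1 \<rho>1 ik] by simp
  show "cmod ((\<rho> * \<sigma>) $$ (i, k)) \<le> d" using mult_entry_bound[OF \<rho>(1) \<sigma>c \<rho>1 \<sigma>1 ik] by simp
  show "cmod (\<sigma> $$ (i, k)) \<le> 1" by (rule \<sigma>1[OF ik])
  show "cmod ((L * \<rho> * mat_adjoint L) $$ (i, k)) \<le> (real d)\<^sup>2" by (rule LRL[OF ik])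
  show "cmod ((mat_adjoint L * L * \<rho>) $$ (i, k)) \<le> (real d)\<^sup>2"
    using mult_entry_bound[OF LL \<rho>(1) LL1 \<rho>1 ik] by (simp add: power2_eq_square)
  show "cmod ((\<rho> * (mat_adjoint L * L)) $$ (i, k)) \<le> (real d)\<^sup>2"
    using mult_entry_bound[OF \<rho>(1) LL \<rho>1 LL1 ik] by (simp add: power2_eq_square)
  show "cmod (trace \<rho>) \<le> d" using trace_entry_bound[OF \<rho>(1) \<rho>1] by simp
  have "L * \<rho> * mat_adjoint L \<in> carrier_mat d d" by (rule mult_carrier_mat[OF LR L'])
  from trace_entry_bound[OF this LRL] show "cmod (trace (L * \<rho> * mat_adjoint L)) \<le> real d ^ 3"
    by (simp add: power2_eq_square power3_eq_cube)
qed

lemma lindbladian_bound: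
  assumes \<rho>: "\<rho> \<in> carrier_mat d d" "\<forall>i<d. \<forall>j<d. cmod (\<rho> $$ (i, j)) \<le> 1"
    and \<sigma>: "density_operator d \<sigma>" and L: "L \<in> carrier_mat d d" "hs_norm L = 1"
    and ik: "i < d" "k < d"
  shows "cmod (lindbladian \<sigma> L \<rho> $$ (i, k)) \<le> 2 * real d + 2 * (real d)\<^sup>2"
proof -
  have \<sigma>c: "\<sigma> \<in> carrier_mat d d" using \<sigma> by (auto simp: density_operator_def psd_def)
  note b = lindblad_term_bounds[OF assms]
  have tri: "cmod (- \<i> * (x - y) + z - 1 / 2 * (u + w)) \<le> cmod x + cmod y + cmod z + (cmod u + cmod w) / 2"
    for x y z u w
  proof -
    have "cmod (- \<i> * (x - y) + z - 1 / 2 * (u + w)) \<le> cmod (- \<i> * (x - y)) + cmod z + cmod (1 / 2 * (u + w))"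
      by (intro order.trans[OF norm_triangle_ineq4] add_mono norm_triangle_ineq) auto
    moreover have "cmod (- \<i> * (x - y)) \<le> cmod x + cmod y"
      by (simp add: norm_mult norm_triangle_ineq4)
    moreover have "cmod (1 / 2 * (u + w)) \<le> (cmod u + cmod w) / 2"
      using norm_triangle_ineq[of u w] by (simp add: norm_mult norm_divide)
    ultimately show ?thesis by linarith
  qed
  have "cmod (lindbladian \<sigma> L \<rho> $$ (i, k)) \<le> real d + real d + (real d)\<^sup>2 + ((real d)\<^sup>2 + (real d)\<^sup>2) / 2"
    unfolding lindbladian_index[OF \<sigma>c L(1) \<rho>(1) ik]
    by (intro order.trans[OF tri] add_mono divide_right_mono b) simp
  thus ?thesis by simp
qed

text \<open>Terms of order zero and one cancel. \<open>Z\<close> collects the error of the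
  normalised swap, bounded by \<open>5 * d + 1\<close>, and \<open>V\<close> that of the jump and
  no-jump branches, bounded by \<open>2 * d ^ 3\<close>.\<close>

lemma step_remainder_bound:
  fixes s :: real
  assumes \<rho>: "\<rho> \<in> carrier_mat d d" "\<forall>i<d. \<forall>j<d. cmod (\<rho> $$ (i, j)) \<le> 1"
    and \<sigma>: "density_operator d \<sigma>" and L: "L \<in> carrier_mat d d" "hs_norm L = 1"
    and ik: "i < d" "k < d" and s: "0 \<le> s" "s * d \<le> 1" "s \<le> 1"
  shows "cmod (step_channel d s (kron \<rho> (program_state d \<sigma> L)) $$ (i, k) - \<rho> $$ (i, k)
      - s * lindbladian \<sigma> L \<rho> $$ (i, k)) \<le> (2 * (5 * real d + 1) + real d ^ 3) * s\<^sup>2"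
proof -
  have \<sigma>c: "\<sigma> \<in> carrier_mat d d" using \<sigma> by (auto simp: density_operator_def psd_def)
  note b = lindblad_term_bounds[OF assms(1-7)]
  define u where "u = complex_of_real (1 / (2 * (1 + 4 * s\<^sup>2)))"
  define Z where "Z = trace \<rho> * \<sigma> $$ (i, k) - \<rho> $$ (i, k) + 2 * \<i> * s * ((\<sigma> * \<rho>) $$ (i, k) - (\<rho> * \<sigma>) $$ (i, k))"
  define V where "V = kd i k * trace (L * \<rho> * mat_adjoint L) - d * (L * \<rho> * mat_adjoint L) $$ (i, k)"
  have pos: "0 < 1 + 4 * s\<^sup>2" using zero_le_power2[of s] by linarith
  have "u * complex_of_real (2 * (1 + 4 * s\<^sup>2)) = 1"
    unfolding u_def using pos by (simp only: flip: of_real_mult) simp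
  hence u1: "2 * u + 8 * u * (complex_of_real s)\<^sup>2 = 1" by (simp add: algebra_simps)
  have "step_channel d s (kron \<rho> (program_state d \<sigma> L)) $$ (i, k) - \<rho> $$ (i, k) - s * lindbladian \<sigma> L \<rho> $$ (i, k)
      = 4 * (complex_of_real s)\<^sup>2 * u * Z + (complex_of_real s)\<^sup>2 / 2 * V"
  proof -
    \<comment> \<open>The two sides differ by a multiple of
      \<open>1 - (2 * u + 8 * u * s\<^sup>2)\<close>, which vanishes by the choice of
      \<open>u\<close>.\<close>
    have alg: "u * (r - 2 * \<i> * s * A + 2 * \<i> * s * B + 4 * s\<^sup>2 * (T * g)) + (2 * s - d * s\<^sup>2) / 2 * W
        + 1 / 2 * (r - s * R1 - s * R2 + s\<^sup>2 * (K * T')) - r - s * (- \<i> * (A - B) + W - 1 / 2 * (R2 + R1))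
      = 4 * s\<^sup>2 * u * (T * g - r + 2 * \<i> * s * (A - B)) + s\<^sup>2 / 2 * (K * T' - d * W)"
      if 1: "2 * u + 8 * u * s\<^sup>2 = 1" for u r s A B T g d W R1 R2 K T' :: complex
    proof -
      have "u * (r - 2 * \<i> * s * A + 2 * \<i> * s * B + 4 * s\<^sup>2 * (T * g)) + (2 * s - d * s\<^sup>2) / 2 * W
        + 1 / 2 * (r - s * R1 - s * R2 + s\<^sup>2 * (K * T')) - r - s * (- \<i> * (A - B) + W - 1 / 2 * (R2 + R1))
      = 4 * s\<^sup>2 * u * (T * g - r + 2 * \<i> * s * (A - B)) + s\<^sup>2 / 2 * (K * T' - d * W)
        + (1 - (2 * u + 8 * u * s\<^sup>2)) * (- r / 2 + \<i> * s * (A - B))"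
        by (simp add: field_simps power2_eq_square)
      thus ?thesis unfolding 1 by simp
    qed
    note 2 = alg[OF u1, of "\<rho> $$ (i, k)" "(\<sigma> * \<rho>) $$ (i, k)" "(\<rho> * \<sigma>) $$ (i, k)" "trace \<rho>" "\<sigma> $$ (i, k)"
        "of_nat d" "(L * \<rho> * mat_adjoint L) $$ (i, k)" "(\<rho> * (mat_adjoint L * L)) $$ (i, k)"
        "(mat_adjoint L * L * \<rho>) $$ (i, k)" "kd i k" "trace (L * \<rho> * mat_adjoint L)"]
    show ?thesis
      unfolding step_channel_program[OF \<rho>(1) \<sigma> L ik s(1,2)] lindbladian_index[OF \<sigma>c L(1) \<rho>(1) ik] Z_def V_def
        u_def[symmetric]
      using 2 by (simp only: of_real_mult of_real_power of_real_diff of_real_divide of_real_numeral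
          of_real_of_nat_eq of_real_1 mult.assoc)
  qed
  also have "cmod \<dots> \<le> 4 * s\<^sup>2 * cmod u * cmod Z + s\<^sup>2 / 2 * cmod V"
    by (rule order.trans[OF norm_triangle_ineq]) (simp add: norm_mult norm_divide norm_power)
  also have "\<dots> \<le> 4 * s\<^sup>2 * (1 / 2) * (5 * d + 1) + s\<^sup>2 / 2 * (2 * real d ^ 3)"
  proof (intro add_mono mult_mono)
    show "cmod u \<le> 1 / 2"
    proof -
      have "1 / (2 * (1 + 4 * s\<^sup>2)) \<le> 1 / 2" by (intro divide_left_mono) (use pos in auto)
      thus ?thesis unfolding u_def norm_of_real using pos by simp
    qed
    have "cmod Z \<le> cmod (trace \<rho>) * cmod (\<sigma> $$ (i, k)) + cmod (\<rho> $$ (i, k)) +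
        2 * s * (cmod ((\<sigma> * \<rho>) $$ (i, k)) + cmod ((\<rho> * \<sigma>) $$ (i, k)))"
      unfolding Z_def
    proof (intro order.trans[OF norm_triangle_ineq] add_mono)
      show "cmod (trace \<rho> * \<sigma> $$ (i, k) - \<rho> $$ (i, k)) \<le> cmod (trace \<rho>) * cmod (\<sigma> $$ (i, k)) + cmod (\<rho> $$ (i, k))"
        by (rule order.trans[OF norm_triangle_ineq4]) (simp add: norm_mult)
      show "cmod (2 * \<i> * s * ((\<sigma> * \<rho>) $$ (i, k) - (\<rho> * \<sigma>) $$ (i, k))) \<le>
          2 * s * (cmod ((\<sigma> * \<rho>) $$ (i, k)) + cmod ((\<rho> * \<sigma>) $$ (i, k)))"
        using s(1) by (simp add: norm_mult mult_left_mono norm_triangle_ineq4)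
    qed
    also have "\<dots> \<le> real d * 1 + 1 + 2 * 1 * (real d + real d)"
      using b \<rho>(2) ik s by (intro add_mono mult_mono) auto
    finally show "cmod Z \<le> 5 * d + 1" by simp
    have "cmod V \<le> cmod (kd i k) * cmod (trace (L * \<rho> * mat_adjoint L)) + d * cmod ((L * \<rho> * mat_adjoint L) $$ (i, k))"
      unfolding V_def by (rule order.trans[OF norm_triangle_ineq4]) (simp add: norm_mult)
    also have "\<dots> \<le> 1 * real d ^ 3 + d * (real d)\<^sup>2"
      using b by (intro add_mono mult_mono) (auto simp: kd_def)
    finally show "cmod V \<le> 2 * real d ^ 3" by (simp add: power2_eq_square power3_eq_cube)
  qed auto
  also have "\<dots> = (2 * (5 * real d + 1) + real d ^ 3) * s\<^sup>2" by (simp add: algebra_simps)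
  finally show ?thesis .
qed

section \<open>Hermiticity preservation of the step\<close>

lemma kraus_adjoint:
  assumes "\<tau> \<in> carrier_mat m m"
  shows "kraus A K m n (mat_adjoint \<tau>) = mat_adjoint (kraus A K m n \<tau>)"
proof (rule eq_matI)
  fix i k assume "i < dim_row (mat_adjoint (kraus A K m n \<tau>))" "k < dim_col (mat_adjoint (kraus A K m n \<tau>))"
  hence ik: "i < n" "k < n" by auto
  have "kraus A K m n (mat_adjoint \<tau>) $$ (i, k) = (\<Sum>a\<in>A. \<Sum>x<m. \<Sum>y<m. K a i x * cnj (\<tau> $$ (y, x)) * cnj (K a k y))"
    unfolding kraus_index[OF ik] using assms by (intro sum.cong) auto
  also have "\<dots> = (\<Sum>a\<in>A. \<Sum>y<m. \<Sum>x<m. K a i x * cnj (\<tau> $$ (y, x)) * cnj (K a k y))"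
    by (intro sum.cong[OF refl] sum.swap)
  also have "\<dots> = mat_adjoint (kraus A K m n \<tau>) $$ (i, k)"
    using ik by (simp add: kraus_index mult_ac)
  finally show "kraus A K m n (mat_adjoint \<tau>) $$ (i, k) = mat_adjoint (kraus A K m n \<tau>) $$ (i, k)" .
qed auto

lemma kron_adjoint:
  assumes "A \<in> carrier_mat m m" "B \<in> carrier_mat n n"
  shows "kron (mat_adjoint A) (mat_adjoint B) = mat_adjoint (kron A B)"
  using assms carrier_matD[OF kron_carrier[OF assms]]
  by (intro block_eqI[of _ m n]) (auto simp: kron_index[of _ m m _ n n] mult_split_less)

lemma hermitian_program_state:
  assumes \<sigma>: "hermitian d \<sigma>" and L: "L \<in> carrier_mat d d"
  shows "mat_adjoint (program_state d \<sigma> L) = program_state d \<sigma> L"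
proof -
  have "mat_adjoint (ket_bra (program_vec d L)) = ket_bra (program_vec d L)"
    by (intro eq_matI) (auto simp: ket_bra_def)
  thus ?thesis
    unfolding program_state_def kron_adjoint[OF hermitianD(1)[OF \<sigma>] ket_bra_carrier[OF L], symmetric]
    by (simp add: hermitian_adjoint[OF \<sigma>])
qed

section \<open>Consuming the copies of the program\<close>

lemma quantum_channel_id: "quantum_channel d d (\<lambda>X. X)"
proof -
  have "id_tensor r d d (\<lambda>X. X) X = X" if "psd (r * d) X" for r X
    using psd_carrier[OF that] by (intro block_eqI[of _ r d]) (auto simp: id_tensor_index)
  thus ?thesis by (simp add: quantum_channel_def linear_superop_def completely_positive_def)
qed

text \<open>Each step acts on \<open>S\<close> and the first remaining copy, and as the identity on
  the other \<open>n\<close>. This will be the channel \<open>\<Lambda>\<close>; neither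
  \<open>L\<close> nor \<open>\<sigma>\<close> enters it.\<close>

fun iterated_step :: "nat \<Rightarrow> real \<Rightarrow> nat \<Rightarrow> complex mat \<Rightarrow> complex mat" where
  "iterated_step d s 0 X = X"
| "iterated_step d s (Suc n) X = iterated_step d s n (kraus (step_index d)
     (kraus_ampl ((d * d * d) ^ n) (step_kraus d s))
     (d * (d * d * d) * (d * d * d) ^ n) (d * (d * d * d) ^ n) X)"

lemma quantum_channel_iterated_step:
  fixes s :: real
  assumes "0 \<le> s" "s * d \<le> 1"
  shows "quantum_channel (d * (d * d * d) ^ n) d (iterated_step d s n)"
proof (induction n)
  case 0
  show ?case by (simp add: quantum_channel_id)
next
  case (Suc n)
  have "quantum_channel (d * (d * d * d) * (d * d * d) ^ n) d (iterated_step d s (Suc n))"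
    using quantum_channel_cong[OF quantum_channel_comp[OF
        quantum_channel_kraus[OF kraus_complete_ampl[OF kraus_complete_step[OF assms]]] Suc.IH]]
    by simp
  thus ?case by (simp only: power_Suc mult.assoc)
qed

lemma tensor_power_carrier: "A \<in> carrier_mat m m \<Longrightarrow> tensor_power A n \<in> carrier_mat (m ^ n) (m ^ n)"
  by (induction n) auto

text \<open>Since the copies are independent, every step leaves its output in a product with the
  copies that remain.\<close>

lemma iterated_step_program:
  assumes "\<rho> \<in> carrier_mat d d" and \<omega>: "\<omega> \<in> carrier_mat (d * d * d) (d * d * d)"
  shows "iterated_step d s n (kron \<rho> (tensor_power \<omega> n)) = ((\<lambda>\<rho>. step_channel d s (kron \<rho> \<omega>)) ^^ n) \<rho>"
  using assms(1)
proof (induction n arbitrary: \<rho>)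
  case 0
  have "kron \<rho> (1\<^sub>m 1) = \<rho>" using 0 by (intro eq_matI) (auto simp: kron_def)
  thus ?case by simp
next
  case (Suc n)
  note w = tensor_power_carrier[OF \<omega>, of n]
  have r\<omega>: "kron \<rho> \<omega> \<in> carrier_mat (d * (d * d * d)) (d * (d * d * d))" using Suc.prems \<omega> by simp
  have "kron \<rho> (tensor_power \<omega> (Suc n)) = kron (kron \<rho> \<omega>) (tensor_power \<omega> n)"
    using kron_assoc[OF Suc.prems \<omega> w] by simp
  hence "iterated_step d s (Suc n) (kron \<rho> (tensor_power \<omega> (Suc n))) =
      iterated_step d s n (kron (step_channel d s (kron \<rho> \<omega>)) (tensor_power \<omega> n))"
    by (simp add: kraus_ampl_kron[OF r\<omega> w] step_channel_def)
  also have "\<dots> = ((\<lambda>\<rho>. step_channel d s (kron \<rho> \<omega>)) ^^ n) (step_channel d s (kron \<rho> \<omega>))"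
    by (rule Suc.IH) (simp add: step_channel_def)
  finally show ?case by (simp only: funpow_Suc_right o_apply)
qed

text \<open>Serves the case in which no step is made; a constant sequence meets the limit
  criterion.\<close>

lemma trace_norm_zero: "trace_norm (0\<^sub>m n n) \<le> 0"
  by (rule trace_norm_limit[where Y = "\<lambda>_. 0\<^sub>m n n" and c = "\<lambda>_. 0"]) (auto simp: jbound_zero)

lemma trace_norm_minus_commute:
  assumes "A \<in> carrier_mat n n" "B \<in> carrier_mat n n"
  shows "trace_norm (A - B) = trace_norm (B - A)"
proof -
  have "mat_adjoint (A - B) * (A - B) = mat_adjoint (B - A) * (B - A)"
    using assms by (intro eq_matI)
      (auto simp: mult_index[of _ n n _ n] minus_carrier_mat algebra_simps intro!: sum.cong)
  thus ?thesis by (simp add: trace_norm_def)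
qed

text \<open>The factor \<open>3 * (a * d ^ 3)\<close> of \<open>jbound_id_tensor_bounded\<close>
  with \<open>a\<close> from \<open>lindbladian_bound\<close>. Likewise \<open>rem_const\<close>
  comes from \<open>step_remainder_bound\<close>, with \<open>s\<^sup>2\<close> split off.\<close>

definition gen_const :: "nat \<Rightarrow> real" where
  "gen_const d = 3 * ((2 * real d + 2 * (real d)\<^sup>2) * real d ^ 3)"

definition rem_const :: "nat \<Rightarrow> real" where
  "rem_const d = 3 * ((2 * (5 * real d + 1) + real d ^ 3) * real d ^ 3)"

lemma quantum_channel_step_program:
  fixes s :: real
  assumes "density_operator d \<sigma>" "L \<in> carrier_mat d d" "hs_norm L = 1" "0 \<le> s" "s * d \<le> 1"
  shows "quantum_channel d d (\<lambda>\<rho>. step_channel d s (kron \<rho> (program_state d \<sigma> L)))"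
  unfolding step_channel_def
  by (rule quantum_channel_comp[OF quantum_channel_attach_program[OF assms(1-3)]
      quantum_channel_kraus[OF kraus_complete_step[OF assms(4,5)]]])

text \<open>The constants are free of \<open>r\<close>, \<open>\<sigma>\<close> and
  \<open>L\<close>, as entry bounds on the system alone are lifted by domination. The limit
  \<open>1 / d\<close> is the completeness condition \<open>s * d \<le> 1\<close>.\<close>

lemma first_order_approximation_step:
  assumes d: "1 \<le> d" and \<sigma>: "density_operator d \<sigma>" and L: "L \<in> carrier_mat d d" "hs_norm L = 1"
  shows "first_order_approximation (r * d)
    (\<lambda>s. id_tensor r d d (\<lambda>\<rho>. step_channel d s (kron \<rho> (program_state d \<sigma> L))))
    (id_tensor r d d (lindbladian \<sigma> L)) (gen_const d) (rem_const d) (1 / d)"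
proof
  let ?\<omega> = "program_state d \<sigma> L"
  have \<sigma>h: "hermitian d \<sigma>" and \<sigma>c: "\<sigma> \<in> carrier_mat d d"
    using \<sigma> psd_hermitian by (auto simp: density_operator_def psd_def)
  note linL = linear_superop_lindbladian[OF \<sigma>c L(1)]
  note \<omega> = program_state_carrier[OF \<sigma>c L(1)]
  show "0 \<le> gen_const d" "0 \<le> rem_const d" by (simp_all add: gen_const_def rem_const_def)
  show "1 / real d \<le> 1" using d by simp
  show "linear_superop (r * d) (r * d) (id_tensor r d d (lindbladian \<sigma> L))"
    by (rule linear_superop_id_tensor[OF linL])
  show "jbound (r * d) (gen_const d * x) (id_tensor r d d (lindbladian \<sigma> L) X)" if "jbound (r * d) x X" for x X
  proof -
    have "jbound (r * d) (3 * ((2 * real d + 2 * (real d)\<^sup>2) * real (d ^ 3)) * x) (id_tensor r d d (lindbladian \<sigma> L) X)"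
    proof (rule jbound_id_tensor_bounded[where \<Psi> = "lindbladian \<sigma> L"])
      show "cmod (lindbladian \<sigma> L A $$ (i, j)) \<le> 2 * real d + 2 * (real d)\<^sup>2"
        if "A \<in> carrier_mat d d" "\<forall>i<d. \<forall>j<d. cmod (A $$ (i, j)) \<le> 1" "i < d" "j < d" for A i j
        by (rule lindbladian_bound[OF that(1,2) \<sigma> L that(3,4)])
    qed (use linL lindbladian_adjoint[OF \<sigma>h L(1)] that in auto)
    thus ?thesis by (simp add: gen_const_def)
  qed
  fix s x :: real and X assume s: "0 \<le> s" "s \<le> 1 / real d"
  have s': "s * d \<le> 1" "s \<le> 1"
  proof -
    have "s * d \<le> 1 / d * d" using s by (intro mult_right_mono) auto
    thus "s * d \<le> 1" using d by simp
    have "1 / real d \<le> 1" using d by simp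
    thus "s \<le> 1" using s by linarith
  qed
  note ch = quantum_channel_step_program[OF \<sigma> L s(1) s'(1)]
  let ?S = "\<lambda>\<rho>. step_channel d s (kron \<rho> ?\<omega>)"
  have linS: "linear_superop d d ?S" using ch by (simp add: quantum_channel_def)
  show "linear_superop (r * d) (r * d) (id_tensor r d d ?S)" by (rule linear_superop_id_tensor[OF linS])
  assume X: "jbound (r * d) x X"
  show "jbound (r * d) x (id_tensor r d d ?S X)" by (rule jbound_id_tensor_channel[OF ch X])
  \<comment> \<open>The remainder as a superoperator on the system alone. Its extension is the
    remainder of the extended step, so the uniform bound applies.\<close>
  define R where "R \<rho> = ?S \<rho> - \<rho> - complex_of_real s \<cdot>\<^sub>m lindbladian \<sigma> L \<rho>" for \<rho>
  have dims: "dim_row (?S \<rho>) = d" "dim_col (?S \<rho>) = d" for \<rho> by (simp_all add: step_channel_def)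
  note Lc = linear_superopD(1)[OF linL]
  have Lsc: "lindbladian \<sigma> L (sub_block d X a b) \<in> carrier_mat d d" for a b by (rule Lc) simp
  have linR: "linear_superop d d R"
    unfolding linear_superop_def
  proof (intro conjI ballI allI)
    fix A B :: "complex mat" and c assume A: "A \<in> carrier_mat d d"
    show "R A \<in> carrier_mat d d" using A Lc[OF A] by (auto simp: R_def)
    show "R (c \<cdot>\<^sub>m A) = c \<cdot>\<^sub>m R A"
      using A Lc[OF A] dims[of A]
      by (auto simp: R_def linear_superopD(3)[OF linS A] linear_superopD(3)[OF linL A] algebra_simps intro!: eq_matI)
    assume B: "B \<in> carrier_mat d d"
    show "R (A + B) = R A + R B"
      using A B Lc[OF A] Lc[OF B] dims[of A] dims[of B]
      by (auto simp: R_def linear_superopD(2)[OF linS A B] linear_superopD(2)[OF linL A B] algebra_simps intro!: eq_matI)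
  qed
  have adjR: "R (mat_adjoint A) = mat_adjoint (R A)" if A: "A \<in> carrier_mat d d" for A
  proof -
    have "kron (mat_adjoint A) ?\<omega> = mat_adjoint (kron A ?\<omega>)"
      using kron_adjoint[OF A \<omega>] hermitian_program_state[OF \<sigma>h L(1)] by simp
    hence "?S (mat_adjoint A) = mat_adjoint (?S A)"
      unfolding step_channel_def by (simp add: kraus_adjoint[OF kron_carrier[OF A \<omega>]])
    thus ?thesis
      using A Lc[OF A] dims[of A] by (intro eq_matI) (auto simp: R_def lindbladian_adjoint[OF \<sigma>h L(1) A])
  qed
  have bR: "cmod (R A $$ (i, k)) \<le> (2 * (5 * real d + 1) + real d ^ 3) * s\<^sup>2"
    if "A \<in> carrier_mat d d" "\<forall>i<d. \<forall>j<d. cmod (A $$ (i, j)) \<le> 1" "i < d" "k < d" for A i k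
    using step_remainder_bound[OF that(1,2) \<sigma> L that(3,4) s(1) s'] that Lc[OF that(1)] dims[of A]
    by (simp add: R_def)
  have "id_tensor r d d ?S X - X - complex_of_real s \<cdot>\<^sub>m id_tensor r d d (lindbladian \<sigma> L) X = id_tensor r d d R X"
  proof (rule block_eqI[of _ r d])
    fix a b i j assume ab: "a < r" "b < r" "i < d" "j < d"
    show "(id_tensor r d d ?S X - X - complex_of_real s \<cdot>\<^sub>m id_tensor r d d (lindbladian \<sigma> L) X) $$ (a * d + i, b * d + j) =
        id_tensor r d d R X $$ (a * d + i, b * d + j)"
      using ab jbound_carrier[OF X] Lsc dims
      by (simp add: id_tensor_index mult_split_less R_def carrier_matD[OF Lsc])
  qed (use jbound_carrier[OF X] in auto)
  moreover have "jbound (r * d) (3 * ((2 * (5 * real d + 1) + real d ^ 3) * s\<^sup>2 * real (d ^ 3)) * x) (id_tensor r d d R X)"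
    by (rule jbound_id_tensor_bounded[where \<Psi> = R]) (use linR adjR bR X in auto)
  ultimately show "jbound (r * d) (rem_const d * s\<^sup>2 * x)
      (id_tensor r d d ?S X - X - complex_of_real s \<cdot>\<^sub>m id_tensor r d d (lindbladian \<sigma> L) X)"
    by (simp add: rem_const_def mult_ac)
qed

text \<open>The second alternative for \<open>n\<close> covers \<open>t = 0\<close>, where no copy
  is used. There \<open>t / n\<close> and the bound are 0 by the convention for division by zero, so
  the difference has to vanish.\<close>

lemma trace_norm_exp_iterated_step:
  fixes t :: real and n :: nat
  assumes d: "1 \<le> d" and \<sigma>: "density_operator d \<sigma>" and L: "L \<in> carrier_mat d d" "hs_norm L = 1"
    and t: "0 \<le> t" and n: "1 \<le> n \<and> t / n \<le> 1 / d \<or> n = 0 \<and> t = 0"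
    and X: "density_operator (r * d) X"
  defines "C \<equiv> 2 * rem_const d + (gen_const d + rem_const d) * gen_const d"
  shows "trace_norm (id_tensor r d d (exp_superop d (lindbladian \<sigma> L) t) X -
      id_tensor r d d (\<lambda>\<rho>. iterated_step d (t / n) n (kron \<rho> (tensor_power (program_state d \<sigma> L) n))) X)
    \<le> C * t\<^sup>2 / n"
proof -
  let ?\<omega> = "program_state d \<sigma> L" and ?G = "lindbladian \<sigma> L"
  let ?S = "\<lambda>\<rho>. step_channel d (t / n) (kron \<rho> ?\<omega>)"
  have \<sigma>c: "\<sigma> \<in> carrier_mat d d" using \<sigma> by (auto simp: density_operator_def psd_def)
  note \<omega> = program_state_carrier[OF \<sigma>c L(1)] and linL = linear_superop_lindbladian[OF \<sigma>c L(1)]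
  have Xp: "psd (r * d) X" "trace X = 1" using X by (auto simp: density_operator_def)
  note Xc = psd_carrier[OF Xp(1)]
  have "(t / n) * d \<le> 1"
  proof -
    have "t / n * d \<le> 1 / d * d" using n by (intro mult_right_mono) auto
    thus ?thesis using d by simp
  qed
  hence linS: "linear_superop d d ?S"
    using quantum_channel_step_program[OF \<sigma> L, of "t / n"] t by (simp add: quantum_channel_def)
  define E where "E = id_tensor r d d (exp_superop d ?G t) X"
  \<comment> \<open>The extension of the exponential is the exponential series of the extended
    generator.\<close>
  have E: "E $$ (I, J) = (\<Sum>k. (id_tensor r d d ?G ^^ k) X $$ (I, J) * complex_of_real (t ^ k / fact k))"
    if "I < r * d" "J < r * d" for I J
  proof -
    note b = that[THEN div_mod_less]
    obtain a i b j where ij: "I = a * d + i" "J = b * d + j" "a < r" "b < r" "i < d" "j < d"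
      using b by (metis div_mult_mod_eq)
    have "(id_tensor r d d ?G ^^ k) X $$ (I, J) = (?G ^^ k) (sub_block d X a b) $$ (i, j)" for k
      using ij sub_block_funpow_id_tensor[OF linL ij(3,4), of k X] sub_block_index[OF ij(5,6)] by metis
    thus ?thesis using ij by (simp add: E_def id_tensor_index exp_superop_def)
  qed
  have S: "id_tensor r d d (\<lambda>\<rho>. iterated_step d (t / n) n (kron \<rho> (tensor_power ?\<omega> n))) X =
      (id_tensor r d d ?S ^^ n) X"
  proof (rule block_eqI[of _ r d])
    fix a b i j assume ij: "a < r" "b < r" "i < d" "j < d"
    have "(id_tensor r d d ?S ^^ n) X $$ (a * d + i, b * d + j) = (?S ^^ n) (sub_block d X a b) $$ (i, j)"
      using sub_block_funpow_id_tensor[OF linS ij(1,2), of n X] sub_block_index[OF ij(3,4)] by metis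
    thus "id_tensor r d d (\<lambda>\<rho>. iterated_step d (t / n) n (kron \<rho> (tensor_power ?\<omega> n))) X $$ (a * d + i, b * d + j) =
      (id_tensor r d d ?S ^^ n) X $$ (a * d + i, b * d + j)"
      using ij by (simp add: id_tensor_index iterated_step_program[OF _ \<omega>])
  qed (use linear_superopD(1)[OF linear_superop_funpow[OF linear_superop_id_tensor[OF linS]] Xc] in auto)
  have Ec: "E \<in> carrier_mat (r * d) (r * d)" by (simp add: E_def)
  have Sc: "(id_tensor r d d ?S ^^ n) X \<in> carrier_mat (r * d) (r * d)"
    by (rule linear_superopD(1)[OF linear_superop_funpow[OF linear_superop_id_tensor[OF linS]] Xc])
  show ?thesis
  proof (cases "n = 0")
    case True
    hence t0: "t = 0" using n by auto
    have "E = X"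
    proof (rule eq_matI)
      fix I J assume "I < dim_row X" "J < dim_col X"
      hence IJ: "I < r * d" "J < r * d" using Xc by auto
      \<comment> \<open>At \<open>t = 0\<close> only the term with \<open>0 ^ 0 = 1\<close> is
        left.\<close>
      have e: "(\<lambda>k. (id_tensor r d d ?G ^^ k) X $$ (I, J) * complex_of_real (t ^ k / fact k)) =
          (\<lambda>k. if k = 0 then X $$ (I, J) else 0)"
        using t0 by auto
      show "E $$ (I, J) = X $$ (I, J)"
        unfolding E[OF IJ] e by (subst suminf_finite[of "{0}"]) auto
    qed (use Ec Xc in auto)
    hence "E - X = 0\<^sub>m (r * d) (r * d)" using Xc by auto
    thus ?thesis unfolding S using True trace_norm_zero[of "r * d"] by (simp add: E_def)
  next
    case False
    interpret first_order_approximation "r * d"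
      "\<lambda>s. id_tensor r d d (\<lambda>\<rho>. step_channel d s (kron \<rho> ?\<omega>))" "id_tensor r d d ?G"
      "gen_const d" "rem_const d" "1 / d"
      by (rule first_order_approximation_step[OF d \<sigma> L])
    have "jbound (r * d) 1 X" using jbound_psd[OF Xp(1)] Xp(2) by simp
    from trace_norm_power_exp[OF t _ _ this Ec E, of n] n False
    have "trace_norm ((id_tensor r d d ?S ^^ n) X - E) \<le> C * t\<^sup>2 / n" by (simp add: C_def)
    thus ?thesis
      unfolding S using trace_norm_minus_commute[OF Ec Sc] by (simp add: E_def)
  qed
qed

theorem theorem3:
  fixes d :: nat
  assumes "d \<ge> 1"
  shows "\<exists>C::real. C > 0 \<and>
    (\<forall>t::real. \<forall>\<epsilon>::real. t \<ge> 0 \<longrightarrow> 0 < \<epsilon> \<longrightarrow> \<epsilon> < 1 \<longrightarrow>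
      (\<exists>(n::nat) \<Lambda>.
        (t > 0 \<longrightarrow> n > 0) \<and> int n \<le> \<lceil>C * t\<^sup>2 / \<epsilon>\<rceil> \<and>
        quantum_channel (d * (d * d * d) ^ n) d \<Lambda> \<and>
        (\<forall>\<sigma> L. density_operator d \<sigma> \<longrightarrow> L \<in> carrier_mat d d \<longrightarrow> hs_norm L = 1 \<longrightarrow>
          ereal (1 / 2) * diamond_dist d
            (exp_superop d (lindbladian \<sigma> L) t)
            (\<lambda>\<rho>. \<Lambda> (kron \<rho> (tensor_power (program_state d \<sigma> L) n)))
          \<le> ereal \<epsilon>)))"
proof -
  define C0 where "C0 = 2 * rem_const d + (gen_const d + rem_const d) * gen_const d"
  \<comment> \<open>\<open>C0\<close> controls the error; the square of \<open>d\<close> forces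
    \<open>n \<ge> d * t\<close>, that is, steps of length at most \<open>1 / d\<close>.\<close>
  define C where "C = C0 + (real d)\<^sup>2"
  have C0: "0 \<le> C0" by (simp add: C0_def gen_const_def rem_const_def)
  have d2: "1 \<le> (real d)\<^sup>2" using assms by simp
  have "0 < C" using C0 d2 by (simp add: C_def)
  moreover have "\<exists>(n::nat) \<Lambda>.
        (t > 0 \<longrightarrow> n > 0) \<and> int n \<le> \<lceil>C * t\<^sup>2 / \<epsilon>\<rceil> \<and>
        quantum_channel (d * (d * d * d) ^ n) d \<Lambda> \<and>
        (\<forall>\<sigma> L. density_operator d \<sigma> \<longrightarrow> L \<in> carrier_mat d d \<longrightarrow> hs_norm L = 1 \<longrightarrow>
          ereal (1 / 2) * diamond_dist d
            (exp_superop d (lindbladian \<sigma> L) t)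
            (\<lambda>\<rho>. \<Lambda> (kron \<rho> (tensor_power (program_state d \<sigma> L) n)))
          \<le> ereal \<epsilon>)"
    if t: "0 \<le> t" and \<epsilon>: "0 < \<epsilon>" "\<epsilon> < 1" for t \<epsilon> :: real
  proof -
    \<comment> \<open>All copies that the bound allows are used. For \<open>t = 0\<close> there are
      none.\<close>
    define n where "n = nat \<lceil>C * t\<^sup>2 / \<epsilon>\<rceil>"
    have nn: "0 \<le> C * t\<^sup>2 / \<epsilon>" using \<open>0 < C\<close> \<epsilon> by simp
    have n_int: "int n = \<lceil>C * t\<^sup>2 / \<epsilon>\<rceil>" using nn by (simp add: n_def)
    have n_ge: "C * t\<^sup>2 / \<epsilon> \<le> n"
      using le_of_int_ceiling[of "C * t\<^sup>2 / \<epsilon>"] n_int by (metis of_int_of_nat_eq)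
    have n_pos: "0 < n" if "0 < t"
    proof -
      have "0 < C * t\<^sup>2 / \<epsilon>" using that \<open>0 < C\<close> \<epsilon> by simp
      thus ?thesis using n_ge by (cases n) auto
    qed
    have n_cases: "1 \<le> n \<and> t / n \<le> 1 / d \<or> n = 0 \<and> t = 0"
    proof (cases "t = 0")
      case True
      thus ?thesis by (simp add: n_def)
    next
      case False
      hence n1: "1 \<le> n" using n_pos t by simp
      \<comment> \<open>If \<open>d * t \<le> 1\<close>, then \<open>n \<ge> 1\<close> suffices;
        otherwise \<open>d * t\<close> is below its square, which \<open>C * t\<^sup>2\<close>
        dominates.\<close>
      have "d * t \<le> n"
      proof (cases "d * t \<le> 1")
        case True
        thus ?thesis using n1 by simp
      next
        case False
        hence "d * t * 1 \<le> d * t * (d * t)" using t by (intro mult_left_mono) auto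
        also have "\<dots> = (real d)\<^sup>2 * t\<^sup>2" by (simp add: power2_eq_square)
        also have "\<dots> \<le> C * t\<^sup>2" using C0 by (intro mult_right_mono) (auto simp: C_def)
        also have "\<dots> \<le> C * t\<^sup>2 / \<epsilon>"
        proof -
          have "C * t\<^sup>2 * \<epsilon> \<le> C * t\<^sup>2 * 1" using \<open>0 < C\<close> \<epsilon> by (intro mult_left_mono) auto
          thus ?thesis using \<epsilon> by (simp add: pos_le_divide_eq)
        qed
        finally show ?thesis using n_ge by simp
      qed
      thus ?thesis using n1 assms by (simp add: field_simps)
    qed
    have sd: "t / n * d \<le> 1"
    proof -
      have "t / n * d \<le> 1 / d * d" using n_cases by (intro mult_right_mono) auto
      thus ?thesis using assms by simp
    qed
    have err: "C0 * t\<^sup>2 / n \<le> \<epsilon>"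
    proof (cases "n = 0")
      case False
      have "C0 * t\<^sup>2 \<le> C * t\<^sup>2" by (intro mult_right_mono) (auto simp: C_def)
      also have "\<dots> \<le> \<epsilon> * n" using n_ge \<epsilon> by (simp add: field_simps)
      finally show ?thesis using False by (simp add: field_simps)
    qed (use \<epsilon> in simp)
    show ?thesis
    proof (intro exI[of _ n] exI[of _ "iterated_step d (t / n) n"] conjI allI impI)
      show "0 < t \<Longrightarrow> 0 < n" by (rule n_pos)
      show "int n \<le> \<lceil>C * t\<^sup>2 / \<epsilon>\<rceil>" using n_int by simp
      show "quantum_channel (d * (d * d * d) ^ n) d (iterated_step d (t / n) n)"
        using t sd by (intro quantum_channel_iterated_step) auto
      fix \<sigma> L assume \<sigma>: "density_operator d \<sigma>" and L: "L \<in> carrier_mat d d" "hs_norm L = 1"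
      let ?D = "diamond_dist d (exp_superop d (lindbladian \<sigma> L) t)
        (\<lambda>\<rho>. iterated_step d (t / n) n (kron \<rho> (tensor_power (program_state d \<sigma> L) n)))"
      \<comment> \<open>The distance is at most \<open>\<epsilon>\<close> even before normalisation;
        the factor 1/2 is slack.\<close>
      have "?D \<le> ereal \<epsilon>"
        unfolding diamond_dist_def
      proof (rule SUP_least, clarify)
        fix r \<rho> assume "density_operator (r * d) \<rho>"
        from trace_norm_exp_iterated_step[OF assms \<sigma> L t n_cases this] err
        show "ereal (trace_norm (id_tensor r d d (exp_superop d (lindbladian \<sigma> L) t) \<rho> -
          id_tensor r d d (\<lambda>\<rho>. iterated_step d (t / n) n (kron \<rho> (tensor_power (program_state d \<sigma> L) n))) \<rho>))
          \<le> ereal \<epsilon>"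
          by (simp add: C0_def)
      qed
      hence "ereal (1 / 2) * ?D \<le> ereal (1 / 2) * ereal \<epsilon>" by (intro ereal_mult_left_mono) auto
      also have "\<dots> \<le> ereal \<epsilon>" using \<epsilon> by simp
      finally show "ereal (1 / 2) * ?D \<le> ereal \<epsilon>" .
    qed
  qed
  ultimately show ?thesis by blast
qed

end
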